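(* The only monogenic cyclic quartic trinomials are $x^4-4x^2+2$, $x^4+4x^2+2$ and $x^4-5x^2+5$. That is, a monic quartic trinomial $f(x)\in\mathbb{Z}[x]$ is both monogenic and cyclic if and only if $f(x)\in\{x^4-4x^2+2,\ x^4+4x^2+2,\ x^4-5x^2+5\}$.
   Context: A monic quartic trinomial is a polynomial in $\mathbb{Z}[x]$ of one of the forms $x^4+ax^3+d$, $x^4+bx^2+d$, $x^4+cx+d$, where the two displayed lower-order coefficients are nonzero integers. A monic polynomial $f(x)\in\mathbb{Z}[x]$ of degree $n$ is called monogenic if $f(x)$ is irreducible over $\mathbb{Q}$ and $\{1,\theta,\theta^2,\ldots,\theta^{n-1}\}$ is a $\mathbb{Z}$-basis for the ring of integers $\mathbb{Z}_K$ of $K=\mathbb{Q}(\theta)$, where $f(\theta)=0$ (equivalently, $\mathbb{Z}_K=\mathbb{Z}[\theta]$). A monic polynomial $f(x)\in\mathbb{Z}[x]$ of degree $n$ that is irreducible over $\mathbb{Q}$ is called cyclic if the Galois group over $\mathbb{Q}$ of $f(x)$ (i.e. of its splitting field) is isomorphic to the cyclic group of order $n$. *)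

theory Defs
  imports Complex_Main "HOL-Algebra.Algebraic_Closure_Type" "HOL-Algebra.Bij"
    "HOL-Algebra.Elementary_Groups" "HOL-Algebra.Generated_Fields"
begin

text \<open>
  Number fields and splitting fields are realised inside the complex numbers. The name
  \<open>irreducible\<close> is qualified because HOL-Algebra has a locale-based notion of the same name.
\<close>

definition quartic_trinomial :: "int poly \<Rightarrow> bool" where
  "quartic_trinomial f \<longleftrightarrow>
     (\<exists>a d. a \<noteq> 0 \<and> d \<noteq> 0 \<and> f = monom 1 4 + monom a 3 + [:d:]) \<or>
     (\<exists>b d. b \<noteq> 0 \<and> d \<noteq> 0 \<and> f = monom 1 4 + monom b 2 + [:d:]) \<or>
     (\<exists>c d. c \<noteq> 0 \<and> d \<noteq> 0 \<and> f = monom 1 4 + monom c 1 + [:d:])"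

definition irreducible_over_rat :: "int poly \<Rightarrow> bool" where
  "irreducible_over_rat f \<longleftrightarrow> Factorial_Ring.irreducible (map_poly of_int f :: rat poly)"

definition complex_roots :: "int poly \<Rightarrow> complex set" where
  "complex_roots f = {z. poly (map_poly of_int f) z = 0}"

abbreviation complex_ring :: "complex ring" where
  "complex_ring \<equiv> ring_of_type_algebra"

definition rat_adjoin :: "complex set \<Rightarrow> complex set" where
  "rat_adjoin S = generate_field complex_ring (\<rat> \<union> S)"

definition ring_of_integers :: "complex set \<Rightarrow> complex set" where
  "ring_of_integers K = {z \<in> K. algebraic_int z}"

global_interpretation int_module: Modules.module "\<lambda>(k::int) (z::complex). of_int k * z"
  by unfold_locales (simp_all add: algebra_simps)

definition is_int_basis :: "complex set \<Rightarrow> complex set \<Rightarrow> bool" where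
  "is_int_basis B M \<longleftrightarrow> int_module.independent B \<and> int_module.span B = M"

text \<open>
  The powers of a root below are automatically pairwise distinct, since \<open>f\<close> is irreducible of
  degree \<open>n\<close>; hence it is harmless to treat the basis as a set.
\<close>

definition monogenic :: "int poly \<Rightarrow> bool" where
  "monogenic f \<longleftrightarrow> lead_coeff f = 1 \<and> irreducible_over_rat f \<and>
     (\<forall>\<theta> \<in> complex_roots f.
        is_int_basis {\<theta> ^ i | i. i < degree f} (ring_of_integers (rat_adjoin {\<theta>})))"

definition splitting_field :: "int poly \<Rightarrow> complex set" where
  "splitting_field f = rat_adjoin (complex_roots f)"

definition field_automorphisms :: "complex set \<Rightarrow> (complex \<Rightarrow> complex) set" where
  "field_automorphisms L = Bij L \<inter>
     ring_hom (complex_ring\<lparr>carrier := L\<rparr>) (complex_ring\<lparr>carrier := L\<rparr>)"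

definition galois_group :: "int poly \<Rightarrow> (complex \<Rightarrow> complex) monoid" where
  "galois_group f = BijGroup (splitting_field f)
     \<lparr>carrier := {\<sigma> \<in> field_automorphisms (splitting_field f). \<forall>q\<in>\<rat>. \<sigma> q = q}\<rparr>"

definition cyclic_poly :: "int poly \<Rightarrow> bool" where
  "cyclic_poly f \<longleftrightarrow> lead_coeff f = 1 \<and> irreducible_over_rat f \<and>
     galois_group f \<cong> integer_mod_group (degree f)"

end

theory Submission
  imports Defs "Jordan_Normal_Form.Char_Poly" "HOL-Computational_Algebra.Squarefree"
begin

text \<open>
  Suppose that \<open>f\<close> is cyclic. The fixed field of the Galois group is \<open>\<rat>\<close>, so a generator \<open>\<sigma>\<close>
  permutes the roots \<open>x0, x1, x2, x3\<close> in a 4-cycle and every algebraic integer of the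
  splitting field that is fixed by \<open>\<sigma>\<close> is a rational integer (\<open>cyclic_quartic_generator\<close>).
  Each family of trinomials is then decided by an explicit element of the field whose
  coordinates in \<open>1, \<theta>, \<theta>\<^sup>2, \<theta>\<^sup>3\<close> must be integers when \<open>f\<close> is monogenic
  (\<open>monogenic_divides\<close>), together with Diophantine equations that come from
  elements fixed by \<open>\<sigma>\<close>.

  For \<open>x\<^sup>4 + b x\<^sup>2 + d\<close> the roots are \<open>x, y, - x, - y\<close> with \<open>\<sigma> x = y\<close> and \<open>\<sigma> y = - x\<close>, the
  integer \<open>m = x y (x\<^sup>2 - y\<^sup>2)\<close> satisfies \<open>m\<^sup>2 = d (b\<^sup>2 - 4 d)\<close>, and
  \<open>m y = - (b x\<^sup>3 + (b\<^sup>2 - 2 d) x)\<close>. Hence \<open>m\<close> divides \<open>b\<close> and \<open>2 d\<close>, which leaves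
  \<open>(b, d) = (\<plusminus>4, 2)\<close> and \<open>(\<plusminus>5, 5)\<close>. The pair \<open>(5, 5)\<close> is excluded because there the field
  contains a primitive fifth root of unity outside \<open>\<int>[x]\<close>.

  For \<open>x\<^sup>4 + c x + d\<close> put \<open>s = x0 + x2\<close> and \<open>u = s\<^sup>2\<close>. Then \<open>\<sigma> s = - s\<close>, so \<open>u\<close> is an integer; it
  is a root of the cubic resolvent \<open>u\<^sup>3 - 4 d u = c\<^sup>2\<close>, and \<open>u\<^sup>3 - 4 c\<^sup>2\<close> is a square, hence
  \<open>u > 0\<close>. The coordinate of \<open>s\<close> at \<open>\<theta>\<^sup>3\<close> is \<open>- 4 u\<^sup>2 / (c\<^sup>2 + 2 u\<^sup>3)\<close>, and this is an integer
  only for \<open>u = 1\<close>, when \<open>s = \<plusminus>1\<close> is rational, against \<open>\<sigma> s = - s\<close>.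

  For \<open>x\<^sup>4 + a x\<^sup>3 + d\<close> the integrality of \<open>(\<theta>\<^sup>3 + a \<theta>\<^sup>2) / n\<close> for \<open>n\<^sup>2\<close> dividing \<open>d\<close> shows that
  \<open>d\<close> is squarefree. The numbers \<open>d / x\<^sub>i\<close> are the roots of \<open>y\<^sup>4 + a d\<^sup>2 y + d\<^sup>3\<close>, so the resolvent
  equations of the previous family apply to them, and a squarefree \<open>d\<close> makes them unsolvable
  (\<open>cubic_trinomial_arith\<close>).

  Conversely, for the three exceptional polynomials a second root \<open>\<kappa> x\<close> is a polynomial in a
  given root \<open>x\<close> with \<open>\<kappa> (\<kappa> x) = - x\<close>; this yields the cyclic Galois group (\<open>biquadratic_cyclic\<close>).
  Traces bound the denominators of algebraic integers in \<open>\<rat>(\<theta>)\<close> by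
  \<open>2 d (b\<^sup>2 - 4 d)\<close> (\<open>biquadratic_discriminant_bound\<close>), and the two primes that can occur are
  removed by an Eisenstein argument (\<open>eisenstein_saturated\<close>) and by a computation modulo 2
  (\<open>saturated_at_2\<close>).
\<close>

section \<open>The ring of algebraic integers\<close>

text \<open>
  Such a \<open>z\<close> is an eigenvalue of an integer matrix, and the characteristic polynomial of that
  matrix is monic with integer coefficients.
\<close>
lemma algebraic_int_eigenvalue:
  fixes A :: "nat \<Rightarrow> nat \<Rightarrow> int" and v :: "nat \<Rightarrow> complex"
  assumes eq: "\<And>i. i < n \<Longrightarrow> z * v i = (\<Sum>j<n. of_int (A i j) * v j)"
    and nz: "k < n" "v k \<noteq> 0"
  shows "algebraic_int z"
proof -
  define M where "M = mat n n (\<lambda>(i, j). A i j)"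
  define C where "C = (map_mat of_int M :: complex mat)"
  have M: "M \<in> carrier_mat n n" and C: "C \<in> carrier_mat n n"
    by (simp_all add: M_def C_def)
  have "C *\<^sub>v vec n v = z \<cdot>\<^sub>v vec n v"
    by (rule eq_vecI) (auto simp: C_def M_def scalar_prod_def eq lessThan_atLeast0)
  moreover have "vec n v \<noteq> 0\<^sub>v n"
    using nz by (metis index_vec index_zero_vec(1))
  ultimately have "eigenvector C (vec n v) z"
    using C by (simp add: eigenvector_def)
  hence "eigenvalue C z"
    by (auto simp: eigenvalue_def)
  hence "poly (char_poly C) z = 0"
    using eigenvalue_root_char_poly[OF C] by simp
  moreover have "char_poly C = map_poly of_int (char_poly M)"
    unfolding C_def by (rule of_int_hom.char_poly_hom[OF M])
  moreover have "lead_coeff (char_poly M) = 1"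
    using degree_monic_char_poly[OF M] by simp
  ultimately show ?thesis
    unfolding algebraic_int_altdef_ipoly by metis
qed

text \<open>
  The usual criterion: a nonzero finitely generated \<open>\<int>\<close>-module that is stable under
  multiplication by \<open>z\<close> makes \<open>z\<close> integral. It reduces closure of the algebraic integers under
  sums and products to exhibiting one module for both.
\<close>
lemma algebraic_int_stable_span:
  assumes B: "finite B" "b0 \<in> B" "b0 \<noteq> 0"
    and st: "\<And>b. b \<in> B \<Longrightarrow> z * b \<in> int_module.span B"
  shows "algebraic_int z"
proof -
  obtain v where v: "bij_betw v {..<card B} B"
    using ex_bij_betw_nat_finite[OF B(1)] by (auto simp: lessThan_atLeast0)
  have "\<exists>c. z * b = (\<Sum>x\<in>B. of_int (c x) * x)" if "b \<in> B" for b
    using st[OF that] unfolding int_module.span_finite[OF B(1)] by auto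
  then obtain c where c: "\<And>b. b \<in> B \<Longrightarrow> z * b = (\<Sum>x\<in>B. of_int (c b x) * x)"
    by metis
  have "z * v i = (\<Sum>j<card B. of_int (c (v i) (v j)) * v j)" if "i < card B" for i
  proof -
    have "v i \<in> B" using v that by (auto dest: bij_betwE)
    thus ?thesis
      using c sum.reindex_bij_betw[OF v, of "\<lambda>x. of_int (c (v i) x) * x"] by simp
  qed
  note vrel = this
  have "b0 \<in> v ` {..<card B}"
    using v B(2) by (simp add: bij_betw_def)
  then obtain k where "k < card B" "v k = b0"
    by auto
  thus ?thesis
    by (intro algebraic_int_eigenvalue[OF vrel, of k]) (use B(3) in auto)
qed

lemma span_mult_closed:
  assumes "\<And>b. b \<in> B \<Longrightarrow> z * b \<in> int_module.span B" "w \<in> int_module.span B"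
  shows "z * w \<in> int_module.span B"
  using assms(2)
proof (induction rule: int_module.span_induct_alt)
  case base
  show ?case by (simp add: int_module.span_zero)
next
  case (step c x y)
  have "z * (of_int c * x + y) = of_int c * (z * x) + z * y" by (simp add: algebra_simps)
  thus ?case
    using step assms(1) by (simp add: int_module.span_add int_module.span_scale)
qed

lemma monic_power_in_span:
  fixes x :: complex
  assumes "poly (map_poly of_int p) x = 0" "lead_coeff p = (1::int)"
  shows "x ^ degree p \<in> int_module.span {x ^ i | i. i < degree p}"
proof -
  let ?n = "degree p"
  have "0 = (\<Sum>i\<le>?n. of_int (coeff p i) * x ^ i)"
    using assms(1) by (simp add: poly_altdef of_int_hom.coeff_map_poly_hom)
  also have "\<dots> = (\<Sum>i<?n. of_int (coeff p i) * x ^ i) + x ^ ?n"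
    using assms(2) by (simp add: lessThan_Suc_atMost[symmetric])
  finally have "x ^ ?n = - (\<Sum>i<?n. of_int (coeff p i) * x ^ i)"
    by (simp add: eq_neg_iff_add_eq_0 add.commute)
  also have "\<dots> \<in> int_module.span {x ^ i | i. i < ?n}"
    by (intro int_module.span_neg int_module.span_sum int_module.span_scale int_module.span_base) auto
  finally show ?thesis .
qed

text \<open>
  The products \<open>x\<^sup>i y\<^sup>j\<close> with \<open>i\<close> and \<open>j\<close> below the degrees of monic equations for \<open>x\<close> and \<open>y\<close>
  span a module that is stable under both \<open>x\<close> and \<open>y\<close>, hence under \<open>x + y\<close> and \<open>x y\<close>.
\<close>
lemma algebraic_int_ring:
  fixes x y :: complex
  assumes "algebraic_int x" "algebraic_int y"
  shows "algebraic_int (x + y)" "algebraic_int (x * y)"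
proof -
  obtain p where p: "poly (map_poly of_int p) x = 0" "lead_coeff p = (1::int)"
    using assms(1) by (auto simp: algebraic_int_altdef_ipoly)
  obtain q where q: "poly (map_poly of_int q) y = 0" "lead_coeff q = (1::int)"
    using assms(2) by (auto simp: algebraic_int_altdef_ipoly)
  let ?n = "degree p" and ?m = "degree q"
  have n: "?n > 0"
    using p by (intro Nat.gr0I) (auto elim!: degree_eq_zeroE)
  have m: "?m > 0"
    using q by (intro Nat.gr0I) (auto elim!: degree_eq_zeroE)
  define B where "B = (\<lambda>(i, j). x ^ i * y ^ j) ` ({..<?n} \<times> {..<?m})"
  have B: "finite B" "1 \<in> B"
    using n m by (force simp: B_def)+
  have base: "x ^ i * y ^ j \<in> int_module.span B" if "i < ?n" "j < ?m" for i j
    using that by (intro int_module.span_base) (auto simp: B_def)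
  have xB: "x * b \<in> int_module.span B" if b: "b \<in> B" for b
  proof -
    obtain i j where ij: "b = x ^ i * y ^ j" "i < ?n" "j < ?m"
      using b by (auto simp: B_def)
    have "w * y ^ j \<in> int_module.span B" if "w \<in> int_module.span {x ^ i | i. i < ?n}" for w
      using that
    proof (induction rule: int_module.span_induct_alt)
      case base
      show ?case by (simp add: int_module.span_zero)
    next
      case (step c u v)
      have "(of_int c * u + v) * y ^ j = of_int c * (u * y ^ j) + v * y ^ j"
        by (simp add: algebra_simps)
      thus ?case
        using step base ij(3) by (auto intro!: int_module.span_add int_module.span_scale)
    qed
    moreover have "x * x ^ i \<in> int_module.span {x ^ i | i. i < ?n}"
    proof (cases "Suc i = ?n")
      case True
      have "x * x ^ i = x ^ degree p"
        unfolding True[symmetric] by simp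
      thus ?thesis using monic_power_in_span[OF p] by simp
    next
      case False
      thus ?thesis using ij(2)
        by (intro int_module.span_base) (intro CollectI exI[of _ "Suc i"], auto)
    qed
    ultimately show ?thesis by (auto simp: ij(1) mult.assoc[symmetric])
  qed
  have yB: "y * b \<in> int_module.span B" if b: "b \<in> B" for b
  proof -
    obtain i j where ij: "b = x ^ i * y ^ j" "i < ?n" "j < ?m"
      using b by (auto simp: B_def)
    have "x ^ i * w \<in> int_module.span B" if "w \<in> int_module.span {y ^ j | j. j < ?m}" for w
      using that
    proof (induction rule: int_module.span_induct_alt)
      case base
      show ?case by (simp add: int_module.span_zero)
    next
      case (step c u v)
      have "x ^ i * (of_int c * u + v) = of_int c * (x ^ i * u) + x ^ i * v"
        by (simp add: algebra_simps)
      thus ?case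
        using step base ij(2) by (auto intro!: int_module.span_add int_module.span_scale)
    qed
    moreover have "y * y ^ j \<in> int_module.span {y ^ j | j. j < ?m}"
    proof (cases "Suc j = ?m")
      case True
      have "y * y ^ j = y ^ degree q"
        unfolding True[symmetric] by simp
      thus ?thesis using monic_power_in_span[OF q] by simp
    next
      case False
      thus ?thesis using ij(3)
        by (intro int_module.span_base) (intro CollectI exI[of _ "Suc j"], auto)
    qed
    ultimately have "x ^ i * (y * y ^ j) \<in> int_module.span B" by blast
    thus ?thesis by (simp add: ij(1) mult.left_commute)
  qed
  show "algebraic_int (x + y)"
    by (rule algebraic_int_stable_span[OF B])
      (auto simp: distrib_right intro!: int_module.span_add xB yB)
  show "algebraic_int (x * y)"
  proof (rule algebraic_int_stable_span[OF B])
    fix b assume "b \<in> B"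
    thus "x * y * b \<in> int_module.span B"
      using span_mult_closed[OF xB yB] by (simp add: mult.assoc)
  qed simp
qed

lemma algebraic_int_diff:
  fixes x y :: complex
  shows "algebraic_int x \<Longrightarrow> algebraic_int y \<Longrightarrow> algebraic_int (x - y)"
  using algebraic_int_ring(1)[of x "- y"] by simp

lemma algebraic_int_power:
  fixes x :: complex
  shows "algebraic_int x \<Longrightarrow> algebraic_int (x ^ n)"
  by (induction n) (auto intro: algebraic_int_ring int_imp_algebraic_int)

lemma algebraic_int_of_int [simp]: "algebraic_int (of_int n :: complex)"
  by (rule int_imp_algebraic_int) simp

lemma algebraic_int_numeral [simp]: "algebraic_int (numeral n :: complex)"
  by (rule int_imp_algebraic_int) simp

lemma algebraic_int_one [simp]: "algebraic_int (1 :: complex)"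
  by (rule int_imp_algebraic_int) simp

lemmas algebraic_int_intros =
  algebraic_int_ring algebraic_int_diff algebraic_int_power algebraic_int_of_int
  algebraic_int_numeral algebraic_int_minus

section \<open>Subfields of the complex numbers and their embeddings\<close>

locale complex_subfield =
  fixes F :: "complex set"
  assumes one [simp]: "1 \<in> F"
    and add: "x \<in> F \<Longrightarrow> y \<in> F \<Longrightarrow> x + y \<in> F"
    and uminus: "x \<in> F \<Longrightarrow> - x \<in> F"
    and mult: "x \<in> F \<Longrightarrow> y \<in> F \<Longrightarrow> x * y \<in> F"
    and inverse: "x \<in> F \<Longrightarrow> x \<noteq> 0 \<Longrightarrow> inverse x \<in> F"
begin

lemma zero [simp]: "0 \<in> F"
  using add[OF one uminus[OF one]] by simp

lemma diff: "x \<in> F \<Longrightarrow> y \<in> F \<Longrightarrow> x - y \<in> F"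
  using add[of x "- y"] uminus by simp

lemma divide: "x \<in> F \<Longrightarrow> y \<in> F \<Longrightarrow> x / y \<in> F"
  using mult[of x "inverse y"] inverse[of y] by (cases "y = 0") (auto simp: field_simps)

lemma power: "x \<in> F \<Longrightarrow> x ^ n \<in> F"
  by (induction n) (auto intro: mult)

lemma of_nat [simp]: "of_nat n \<in> F"
  by (induction n) (auto intro: add)

lemma of_int [simp]: "of_int n \<in> F"
  by (cases n rule: int_cases2) (auto intro: uminus)

lemma numeral [simp]: "numeral n \<in> F"
  using of_nat[of "numeral n"] by simp

lemma Rats: "x \<in> \<rat> \<Longrightarrow> x \<in> F"
  by (elim Rats_cases') (auto intro: divide)

lemma sum: "(\<And>i. i \<in> I \<Longrightarrow> f i \<in> F) \<Longrightarrow> sum f I \<in> F"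
  by (induction I rule: infinite_finite_induct) (auto intro: add)

lemmas closed = add uminus mult diff divide power of_nat of_int numeral one zero

end

definition coeffs_in :: "complex set \<Rightarrow> complex poly \<Rightarrow> bool" where
  "coeffs_in F p \<longleftrightarrow> (\<forall>i. coeff p i \<in> F)"

context complex_subfield
begin

lemma coeffs_in_pCons [simp]: "coeffs_in F (pCons a p) \<longleftrightarrow> a \<in> F \<and> coeffs_in F p"
  unfolding coeffs_in_def by (metis coeff_pCons_0 coeff_pCons_Suc not0_implies_Suc)

lemma coeffs_in_0 [simp]: "coeffs_in F 0"
  by (simp add: coeffs_in_def)

lemma coeffs_in_1 [simp]: "coeffs_in F 1"
  by (simp add: coeffs_in_def)

lemma coeffs_in_add: "coeffs_in F p \<Longrightarrow> coeffs_in F q \<Longrightarrow> coeffs_in F (p + q)"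
  by (simp add: coeffs_in_def add)

lemma coeffs_in_diff: "coeffs_in F p \<Longrightarrow> coeffs_in F q \<Longrightarrow> coeffs_in F (p - q)"
  by (simp add: coeffs_in_def diff)

lemma coeffs_in_uminus: "coeffs_in F p \<Longrightarrow> coeffs_in F (- p)"
  by (simp add: coeffs_in_def uminus)

lemma coeffs_in_mult: "coeffs_in F p \<Longrightarrow> coeffs_in F q \<Longrightarrow> coeffs_in F (p * q)"
  by (auto simp: coeffs_in_def coeff_mult intro!: sum mult)

lemma coeffs_in_smult: "a \<in> F \<Longrightarrow> coeffs_in F p \<Longrightarrow> coeffs_in F (smult a p)"
  by (auto simp: coeffs_in_def intro: mult)

lemma coeffs_in_pderiv: "coeffs_in F p \<Longrightarrow> coeffs_in F (pderiv p)"
  unfolding coeffs_in_def coeff_pderiv by (intro allI mult) (auto simp del: of_nat_Suc)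

lemma poly_in: "coeffs_in F p \<Longrightarrow> x \<in> F \<Longrightarrow> poly p x \<in> F"
  by (auto simp: coeffs_in_def poly_altdef intro!: sum mult power)

text \<open>
  Long division, which brings down one coefficient of the dividend in each induction step. What
  matters is that quotient and remainder stay over \<open>F\<close>.
\<close>
lemma coeffs_in_division:
  assumes "coeffs_in F g" "coeffs_in F m" "m \<noteq> 0"
  shows "\<exists>q r. coeffs_in F q \<and> coeffs_in F r \<and> g = q * m + r \<and> (r = 0 \<or> degree r < degree m)"
  using assms(1)
proof (induction g)
  case 0
  show ?case
    by (intro exI[of _ 0]) auto
next
  case (pCons a g)
  then obtain q r where qr: "coeffs_in F q" "coeffs_in F r" "g = q * m + r"
    "r = 0 \<or> degree r < degree m"
    by auto
  define b where "b = coeff (pCons a r) (degree m) / coeff m (degree m)"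
  define r' where "r' = pCons a r - smult b m"
  have aF: "a \<in> F"
    using pCons by simp
  hence bF: "b \<in> F"
    using qr assms(2) coeffs_in_pCons[of a r] unfolding b_def
    by (intro divide) (auto simp: coeffs_in_def)
  have r'F: "coeffs_in F r'"
    using qr aF bF assms(2) by (simp add: r'_def coeffs_in_diff coeffs_in_smult)
  have eq: "pCons a g = pCons b q * m + r'"
    using qr(3) by (simp add: r'_def)
  have "coeff r' (degree m) = 0"
    using assms(3) by (simp add: r'_def b_def)
  moreover have "degree r' \<le> degree m"
    unfolding r'_def using qr(4) by (intro degree_diff_le) (auto simp: degree_pCons_eq_if)
  ultimately have "r' = 0 \<or> degree r' < degree m"
    by (meson eq_zero_or_degree_less)
  thus ?case
    using r'F eq bF qr(1) by (intro exI[of _ "pCons b q"] exI[of _ r']) simp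
qed

lemma exists_minimal_poly:
  assumes "coeffs_in F p" "p \<noteq> 0" "poly p z = 0"
  obtains m where "coeffs_in F m" "m \<noteq> 0" "poly m z = 0"
    "\<And>g. coeffs_in F g \<Longrightarrow> g \<noteq> 0 \<Longrightarrow> poly g z = 0 \<Longrightarrow> degree m \<le> degree g"
proof -
  let ?P = "\<lambda>m. coeffs_in F m \<and> m \<noteq> 0 \<and> poly m z = 0"
  have "?P p" using assms by simp
  from ex_has_least_nat[of ?P, OF this, of degree] show ?thesis
    using that by blast
qed

text \<open>
  Minimal polynomials are characterised throughout by minimality of the degree, which avoids
  irreducibility over a subfield. The remainder of \<open>g\<close> modulo \<open>m\<close> vanishes at \<open>z\<close>, so it is zero.
\<close>
lemma minimal_poly_dvd:
  assumes m: "coeffs_in F m" "m \<noteq> 0" "poly m z = 0"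
    and min: "\<And>g. coeffs_in F g \<Longrightarrow> g \<noteq> 0 \<Longrightarrow> poly g z = 0 \<Longrightarrow> degree m \<le> degree g"
    and g: "coeffs_in F g" "poly g z = 0"
  shows "\<exists>q. coeffs_in F q \<and> g = q * m"
proof -
  obtain q r where qr: "coeffs_in F q" "coeffs_in F r" "g = q * m + r" "r = 0 \<or> degree r < degree m"
    using coeffs_in_division[OF g(1) m(1,2)] by blast
  have "poly r z = 0"
    using qr(3) g(2) m(3) by simp
  hence "r = 0"
    using min[OF qr(2)] qr(4) by force
  thus ?thesis using qr by auto
qed

text \<open>
  This set is \<open>F(z)\<close>. Only inverses need an argument: dividing \<open>m\<close> by \<open>g\<close> expresses
  \<open>r(z)\<close> as a multiple of \<open>g(z)\<close> for the remainder \<open>r\<close>, so an inverse of \<open>g(z)\<close> is obtained from one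
  of \<open>r(z)\<close> by induction on the degree.
\<close>
lemma simple_extension_subfield:
  assumes m: "coeffs_in F m" "m \<noteq> 0" "poly m z = 0"
    and min: "\<And>g. coeffs_in F g \<Longrightarrow> g \<noteq> 0 \<Longrightarrow> poly g z = 0 \<Longrightarrow> degree m \<le> degree g"
  shows "complex_subfield ((\<lambda>g. poly g z) ` {g. coeffs_in F g})"
proof -
  define K where "K = (\<lambda>g. poly g z) ` {g. coeffs_in F g}"
  have KI: "poly g z \<in> K" if "coeffs_in F g" for g
    using that by (auto simp: K_def)
  have KE: "\<exists>g. coeffs_in F g \<and> x = poly g z" if "x \<in> K" for x
    using that by (auto simp: K_def)
  have inv_small: "\<exists>h. coeffs_in F h \<and> poly g z * poly h z = 1"
    if "coeffs_in F g" "poly g z \<noteq> 0" "degree g < degree m" for g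
    using that
  proof (induction "degree g" arbitrary: g rule: less_induct)
    case less
    show ?case
    proof (cases "degree g = 0")
      case True
      then obtain c where "g = [:c:]"
        by (auto elim: degree_eq_zeroE)
      thus ?thesis
        using less.prems by (intro exI[of _ "[:inverse c:]"]) (auto intro: inverse)
    next
      case False
      hence g0: "g \<noteq> 0" by auto
      obtain q r where qr: "coeffs_in F q" "coeffs_in F r" "m = q * g + r" "r = 0 \<or> degree r < degree g"
        using coeffs_in_division[OF m(1) less.prems(1) g0] by blast
      note mr = qr(3,4)
      have rz: "poly r z = - (poly q z * poly g z)"
        using mr(1) m(3) by (simp add: eq_neg_iff_add_eq_0 add.commute)
      have "poly q z \<noteq> 0"
      proof
        assume q0: "poly q z = 0"
        have "q \<noteq> 0"
          using mr less.prems(3) m(2) by force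
        hence "degree m \<le> degree q"
          using min qr(1) q0 by blast
        moreover have "degree (q * g + r) = degree q + degree g"
          using mr(2) \<open>q \<noteq> 0\<close> g0
          by (cases "r = 0") (auto simp: degree_mult_eq degree_add_eq_left)
        ultimately show False
          using mr(1) False by simp
      qed
      hence r0: "poly r z \<noteq> 0"
        using rz less.prems by simp
      hence "degree r < degree g"
        using mr(2) by auto
      then obtain h where h: "coeffs_in F h" "poly r z * poly h z = 1"
        using less.hyps qr(2) r0 less.prems(3) by (meson order.strict_trans)
      thus ?thesis
        using rz qr(1) by (intro exI[of _ "- (q * h)"]) (auto simp: coeffs_in_mult coeffs_in_uminus mult.commute mult.left_commute)
    qed
  qed
  have inv: "\<exists>h. coeffs_in F h \<and> poly g z * poly h z = 1" if g: "coeffs_in F g" "poly g z \<noteq> 0" for g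
  proof -
    obtain q r where qr: "coeffs_in F q" "coeffs_in F r" "g = q * m + r" "r = 0 \<or> degree r < degree m"
      using coeffs_in_division[OF g(1) m(1,2)] by blast
    note gr = qr(3,4)
    have "poly r z = poly g z"
      using gr(1) m(3) by simp
    moreover have "poly r z \<noteq> 0" "degree r < degree m"
      using gr g(2) m(3) by auto
    ultimately show ?thesis
      using inv_small[OF qr(2)] by auto
  qed
  have "complex_subfield K"
  proof
    show "1 \<in> K" using KI[of 1] by simp
  next
    fix x y assume "x \<in> K" "y \<in> K"
    then obtain g h where gh: "coeffs_in F g" "coeffs_in F h" "x = poly g z" "y = poly h z"
      using KE by metis
    show "x + y \<in> K" "x * y \<in> K"
      using KI[of "g + h"] KI[of "g * h"] gh by (auto simp: coeffs_in_add coeffs_in_mult)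
  next
    fix x assume "x \<in> K"
    then obtain g where g: "coeffs_in F g" "x = poly g z"
      using KE by metis
    show "- x \<in> K"
      using KI[of "- g"] g by (auto simp: coeffs_in_uminus)
    assume "x \<noteq> 0"
    then obtain h where "coeffs_in F h" "x * poly h z = 1"
      using inv[OF g(1)] g(2) by auto
    thus "inverse x \<in> K"
      using KI[of h] inverse_unique by metis
  qed
  thus ?thesis by (simp only: K_def)
qed

end

locale embedding = complex_subfield F for F +
  fixes \<phi> :: "complex \<Rightarrow> complex"
  assumes hom_add: "x \<in> F \<Longrightarrow> y \<in> F \<Longrightarrow> \<phi> (x + y) = \<phi> x + \<phi> y"
    and hom_mult: "x \<in> F \<Longrightarrow> y \<in> F \<Longrightarrow> \<phi> (x * y) = \<phi> x * \<phi> y"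
    and hom_one [simp]: "\<phi> 1 = 1"
begin

lemma hom_zero [simp]: "\<phi> 0 = 0"
  using hom_add[OF zero zero] by simp

lemma hom_uminus: "x \<in> F \<Longrightarrow> \<phi> (- x) = - \<phi> x"
  using hom_add[of x "- x"] uminus[of x] by (simp add: eq_neg_iff_add_eq_0 add.commute)

lemma hom_diff: "x \<in> F \<Longrightarrow> y \<in> F \<Longrightarrow> \<phi> (x - y) = \<phi> x - \<phi> y"
  using hom_add[of x "- y"] uminus[of y] by (simp add: hom_uminus)

lemma hom_inverse_mult: "x \<in> F \<Longrightarrow> x \<noteq> 0 \<Longrightarrow> \<phi> x * \<phi> (inverse x) = 1"
  using hom_mult[of x "inverse x"] inverse[of x] by simp

lemma hom_eq_0_iff [simp]: "x \<in> F \<Longrightarrow> \<phi> x = 0 \<longleftrightarrow> x = 0"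
  by (cases "x = 0") (use hom_inverse_mult[of x] in auto)

lemma hom_inverse: "x \<in> F \<Longrightarrow> \<phi> (inverse x) = inverse (\<phi> x)"
  by (cases "x = 0") (simp_all add: hom_inverse_mult inverse_unique[symmetric])

lemma hom_divide: "x \<in> F \<Longrightarrow> y \<in> F \<Longrightarrow> \<phi> (x / y) = \<phi> x / \<phi> y"
  by (cases "y = 0") (simp_all add: field_class.field_divide_inverse hom_mult hom_inverse inverse)

lemma hom_power: "x \<in> F \<Longrightarrow> \<phi> (x ^ n) = \<phi> x ^ n"
  by (induction n) (auto simp: hom_mult power)

lemma hom_of_nat [simp]: "\<phi> (of_nat n) = of_nat n"
  by (induction n) (auto simp: hom_add)

lemma hom_of_int [simp]: "\<phi> (of_int n) = of_int n"
  by (cases n rule: int_cases2) (auto simp: hom_uminus)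

lemma hom_Rats: "x \<in> \<rat> \<Longrightarrow> \<phi> x = x"
  by (elim Rats_cases') (auto simp: hom_divide)

lemma hom_sum: "(\<And>i. i \<in> I \<Longrightarrow> f i \<in> F) \<Longrightarrow> \<phi> (sum f I) = (\<Sum>i\<in>I. \<phi> (f i))"
  by (induction I rule: infinite_finite_induct) (auto simp: hom_add sum)

lemma hom_inj: "x \<in> F \<Longrightarrow> y \<in> F \<Longrightarrow> \<phi> x = \<phi> y \<Longrightarrow> x = y"
  using hom_eq_0_iff[of "x - y"] hom_diff[of x y] diff[of x y] by simp

lemma map_poly_add: "coeffs_in F p \<Longrightarrow> coeffs_in F q \<Longrightarrow> map_poly \<phi> (p + q) = map_poly \<phi> p + map_poly \<phi> q"
  by (rule poly_eqI) (simp add: coeff_map_poly coeffs_in_def hom_add)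

lemma map_poly_mult: "coeffs_in F p \<Longrightarrow> coeffs_in F q \<Longrightarrow> map_poly \<phi> (p * q) = map_poly \<phi> p * map_poly \<phi> q"
  by (rule poly_eqI) (simp add: coeff_map_poly coeffs_in_def coeff_mult hom_sum hom_mult mult)

lemma map_poly_rat: "coeffs_in \<rat> p \<Longrightarrow> map_poly \<phi> p = p"
  by (rule poly_eqI) (simp add: coeff_map_poly coeffs_in_def hom_Rats)

lemma hom_poly: "coeffs_in F p \<Longrightarrow> x \<in> F \<Longrightarrow> \<phi> (poly p x) = poly (map_poly \<phi> p) (\<phi> x)"
  by (induction p) (auto simp: map_poly_pCons hom_add hom_mult poly_in mult)

lemma hom_poly_rat: "coeffs_in \<rat> p \<Longrightarrow> x \<in> F \<Longrightarrow> \<phi> (poly p x) = poly p (\<phi> x)"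
  using hom_poly[of p x] Rats by (simp add: map_poly_rat coeffs_in_def)

text \<open>
  An embedding of \<open>F\<close> extends to \<open>F(z)\<close> by sending \<open>z\<close> to any prescribed root \<open>w\<close> of the
  transported minimal polynomial. The extension \<open>g(z) \<mapsto> (\<phi> g)(w)\<close> is well defined because
  polynomials with the same value at \<open>z\<close> differ by a multiple of \<open>m\<close>.
\<close>
lemma extend:
  assumes m: "coeffs_in F m" "m \<noteq> 0" "poly m z = 0"
    and min: "\<And>g. coeffs_in F g \<Longrightarrow> g \<noteq> 0 \<Longrightarrow> poly g z = 0 \<Longrightarrow> degree m \<le> degree g"
    and w: "poly (map_poly \<phi> m) w = 0"
  obtains K \<psi> where "embedding K \<psi>" "F \<subseteq> K" "z \<in> K" "\<And>x. x \<in> F \<Longrightarrow> \<psi> x = \<phi> x" "\<psi> z = w"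
proof -
  define K where "K = (\<lambda>g. poly g z) ` {g. coeffs_in F g}"
  define ev where "ev g = poly (map_poly \<phi> g) w" for g
  have KI: "poly g z \<in> K" if "coeffs_in F g" for g
    using that by (auto simp: K_def)
  have KE: "\<exists>g. coeffs_in F g \<and> x = poly g z" if "x \<in> K" for x
    using that by (auto simp: K_def)
  have dvd: "\<exists>q. coeffs_in F q \<and> g = q * m" if "coeffs_in F g" "poly g z = 0" for g
    by (rule minimal_poly_dvd[OF m _ that]) (rule min)
  have ev_cong: "ev g = ev h" if gh: "coeffs_in F g" "coeffs_in F h" "poly g z = poly h z" for g h
  proof -
    obtain q where q: "coeffs_in F q" "g - h = q * m"
      using dvd[of "g - h"] gh by (auto simp: coeffs_in_diff)
    hence "g = h + q * m" by (simp add: algebra_simps)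
    thus ?thesis
      using gh q m w by (simp add: ev_def map_poly_add map_poly_mult coeffs_in_mult)
  qed
  define \<psi> where "\<psi> x = ev (SOME g. coeffs_in F g \<and> x = poly g z)" for x
  have psi: "\<psi> (poly g z) = ev g" if "coeffs_in F g" for g
  proof -
    have "coeffs_in F (SOME h. coeffs_in F h \<and> poly g z = poly h z) \<and>
        poly g z = poly (SOME h. coeffs_in F h \<and> poly g z = poly h z) z"
      by (rule someI[of _ g]) (use that in simp)
    thus ?thesis
      unfolding \<psi>_def using ev_cong that by metis
  qed
  have sub: "complex_subfield K"
    unfolding K_def by (rule simple_extension_subfield[OF m]) (rule min)
  have "embedding K \<psi>"
  proof (intro embedding.intro[OF sub] embedding_axioms.intro)
    fix x y assume "x \<in> K" "y \<in> K"
    then obtain g h where gh: "coeffs_in F g" "coeffs_in F h" "x = poly g z" "y = poly h z"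
      using KE by metis
    show "\<psi> (x + y) = \<psi> x + \<psi> y"
      using psi[of "g + h"] gh psi by (simp add: coeffs_in_add ev_def map_poly_add)
    show "\<psi> (x * y) = \<psi> x * \<psi> y"
      using psi[of "g * h"] gh psi by (simp add: coeffs_in_mult ev_def map_poly_mult)
  next
    show "\<psi> 1 = 1"
      using psi[of 1] by (simp add: ev_def map_poly_1)
  qed
  moreover have "x \<in> K" "\<psi> x = \<phi> x" if "x \<in> F" for x
    using KI[of "[:x:]"] psi[of "[:x:]"] that
    by (cases "x = 0"; auto simp: ev_def map_poly_pCons)+
  moreover have "z \<in> K" "\<psi> z = w"
    using KI[of "[:0, 1:]"] psi[of "[:0, 1:]"] by (auto simp: ev_def map_poly_pCons)
  ultimately show ?thesis
    using that[of K \<psi>] by blast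
qed

text \<open>
  The larger field \<open>K\<close> is left unspecified: an embedding defined on any field that contains the
  roots of a polynomial can be restricted to the splitting field afterwards.
\<close>
lemma extend_finite:
  assumes "finite S" "\<And>z. z \<in> S \<Longrightarrow> \<exists>p. coeffs_in \<rat> p \<and> p \<noteq> 0 \<and> poly p z = 0"
  shows "\<exists>K \<psi>. embedding K \<psi> \<and> F \<subseteq> K \<and> S \<subseteq> K \<and> (\<forall>x\<in>F. \<psi> x = \<phi> x)"
  using assms
proof (induction S rule: finite_induct)
  case empty
  show ?case using embedding_axioms by auto
next
  case (insert z S)
  then obtain K \<psi> where K: "embedding K \<psi>" "F \<subseteq> K" "S \<subseteq> K" "\<And>x. x \<in> F \<Longrightarrow> \<psi> x = \<phi> x"
    by blast
  interpret K: embedding K \<psi> by (fact K(1))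
  obtain p where p: "coeffs_in \<rat> p" "p \<noteq> 0" "poly p z = 0"
    using insert.prems by blast
  have "coeffs_in K p"
    using p(1) K.Rats by (auto simp: coeffs_in_def)
  then obtain m where m: "coeffs_in K m" "m \<noteq> 0" "poly m z = 0"
    "\<And>g. coeffs_in K g \<Longrightarrow> g \<noteq> 0 \<Longrightarrow> poly g z = 0 \<Longrightarrow> degree m \<le> degree g"
    using K.exists_minimal_poly p by metis
  have "degree m \<noteq> 0"
    using m by (auto elim!: degree_eq_zeroE)
  moreover have "degree (map_poly \<psi> m) = degree m"
    using m by (intro degree_map_poly) (auto simp: coeffs_in_def)
  ultimately obtain w where w: "poly (map_poly \<psi> m) w = 0"
    using fundamental_theorem_of_algebra_alt[of "map_poly \<psi> m"]
    by (metis degree_pCons_0)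
  obtain K' \<psi>' where "embedding K' \<psi>'" "K \<subseteq> K'" "z \<in> K'"
    "\<And>x. x \<in> K \<Longrightarrow> \<psi>' x = \<psi> x"
    by (rule K.extend[OF m w]) auto
  thus ?case
    using K by (intro exI[of _ K'] exI[of _ \<psi>']) auto
qed

end

section \<open>Splitting fields and the fixed field of the Galois group\<close>

lemma complex_ring_simps:
  "carrier complex_ring = UNIV" "x \<oplus>\<^bsub>complex_ring\<^esub> y = x + y" "x \<otimes>\<^bsub>complex_ring\<^esub> y = x * y"
  "\<one>\<^bsub>complex_ring\<^esub> = 1" "\<zero>\<^bsub>complex_ring\<^esub> = 0"
  by (simp_all add: ring_of_type_algebra_def)

lemma complex_ring_a_inv: "\<ominus>\<^bsub>complex_ring\<^esub> x = - x"
proof -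
  interpret field complex_ring by (rule field_from_type_algebra)
  show ?thesis
    by (rule minus_equality) (simp_all add: complex_ring_simps)
qed

lemma complex_ring_m_inv: "x \<noteq> 0 \<Longrightarrow> inv\<^bsub>complex_ring\<^esub> x = inverse x"
proof -
  interpret field complex_ring by (rule field_from_type_algebra)
  assume "x \<noteq> 0"
  thus ?thesis
    by (intro comm_inv_char) (simp_all add: complex_ring_simps)
qed

lemma complex_subfield_rat_adjoin: "complex_subfield (rat_adjoin S)"
proof
  fix x y assume "x \<in> rat_adjoin S" "y \<in> rat_adjoin S"
  thus "x + y \<in> rat_adjoin S" "x * y \<in> rat_adjoin S"
    unfolding rat_adjoin_def
    using generate_field.eng_add[of x complex_ring _ y] generate_field.eng_mult[of x complex_ring _ y]
    by (simp_all add: complex_ring_simps)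
next
  show "1 \<in> rat_adjoin S"
    unfolding rat_adjoin_def using generate_field.one[of complex_ring] by (simp add: complex_ring_simps)
next
  fix x assume x: "x \<in> rat_adjoin S"
  show "- x \<in> rat_adjoin S"
    using x generate_field.a_inv[of x complex_ring] unfolding rat_adjoin_def
    by (simp add: complex_ring_a_inv)
  assume "x \<noteq> 0"
  thus "inverse x \<in> rat_adjoin S"
    using x generate_field.m_inv[of x complex_ring] unfolding rat_adjoin_def
    by (simp add: complex_ring_m_inv complex_ring_simps)
qed

lemma subset_rat_adjoin: "S \<subseteq> rat_adjoin S"
  unfolding rat_adjoin_def by (auto intro: generate_field.incl)

lemma rat_adjoin_subset:
  assumes "complex_subfield F" "S \<subseteq> F"
  shows "rat_adjoin S \<subseteq> F"
proof
  interpret complex_subfield F by fact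
  fix x assume "x \<in> rat_adjoin S"
  thus "x \<in> F"
    unfolding rat_adjoin_def
  proof (induction rule: generate_field.induct)
    case (incl h)
    thus ?case using assms(2) Rats by auto
  qed (auto simp: complex_ring_simps complex_ring_a_inv complex_ring_m_inv add mult uminus inverse)
qed

lemma complex_subfield_Rats: "complex_subfield \<rat>"
  by standard auto

lemma embedding_Rats: "embedding \<rat> id"
  by (intro embedding.intro complex_subfield_Rats embedding_axioms.intro) auto

context embedding
begin

lemma subfield_preimage:
  assumes "complex_subfield L"
  shows "complex_subfield {x \<in> F. \<phi> x \<in> L}"
proof -
  interpret L: complex_subfield L by fact
  show ?thesis
    by standard (auto simp: add mult uminus inverse hom_add hom_mult hom_uminus hom_inverse
        L.add L.mult L.uminus L.inverse)
qed

lemma subfield_image: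
  assumes "complex_subfield L" "L \<subseteq> F"
  shows "complex_subfield (\<phi> ` L)"
proof -
  interpret L: complex_subfield L by fact
  show ?thesis
  proof
    show "1 \<in> \<phi> ` L" using hom_one L.one by (metis imageI)
  next
    fix x y assume "x \<in> \<phi> ` L" "y \<in> \<phi> ` L"
    then obtain a b where ab: "a \<in> L" "b \<in> L" "x = \<phi> a" "y = \<phi> b" by blast
    thus "x + y \<in> \<phi> ` L" "x * y \<in> \<phi> ` L"
      using assms(2) L.add[of a b] L.mult[of a b] hom_add[of a b] hom_mult[of a b]
      by (metis imageI subsetD)+
  next
    fix x assume "x \<in> \<phi> ` L"
    then obtain a where a: "a \<in> L" "x = \<phi> a" by blast
    thus "- x \<in> \<phi> ` L"
      using assms(2) L.uminus[of a] hom_uminus[of a] by (metis imageI subsetD)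
    assume "x \<noteq> 0"
    hence "a \<noteq> 0" using a by auto
    thus "inverse x \<in> \<phi> ` L"
      using a assms(2) L.inverse[of a] hom_inverse[of a] by (metis imageI subsetD)
  qed
qed

text \<open>
  Together with \<open>rat_adjoin_subset\<close>, this shows that an embedding that fixes generators of a field
  fixes all of it.
\<close>
lemma subfield_fixed: "complex_subfield {x \<in> F. \<phi> x = x}"
  by standard (auto simp: add mult uminus inverse hom_add hom_mult hom_uminus hom_inverse)

end

abbreviation cpoly :: "int poly \<Rightarrow> complex poly" where
  "cpoly f \<equiv> map_poly of_int f"

lemma coeffs_in_cpoly [simp]: "coeffs_in \<rat> (cpoly f)"
  by (simp add: coeffs_in_def coeff_map_poly)

lemma cpoly_eq_0_iff [simp]: "cpoly f = 0 \<longleftrightarrow> f = 0"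
  by (simp add: poly_eq_iff coeff_map_poly)

lemma finite_complex_roots: "f \<noteq> 0 \<Longrightarrow> finite (complex_roots f)"
  unfolding complex_roots_def by (intro poly_roots_finite) simp

lemma (in embedding) complex_roots_image:
  "f \<noteq> 0 \<Longrightarrow> complex_roots f \<subseteq> F \<Longrightarrow> \<phi> ` complex_roots f = complex_roots f"
proof -
  assume f: "f \<noteq> 0" and sub: "complex_roots f \<subseteq> F"
  have "\<phi> ` complex_roots f \<subseteq> complex_roots f"
  proof
    fix y assume "y \<in> \<phi> ` complex_roots f"
    then obtain x where x: "x \<in> complex_roots f" "y = \<phi> x" by auto
    hence "poly (cpoly f) y = \<phi> (poly (cpoly f) x)"
      using sub by (subst hom_poly_rat) auto
    thus "y \<in> complex_roots f" using x by (simp add: complex_roots_def)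
  qed
  moreover have "inj_on \<phi> (complex_roots f)"
    using sub hom_inj by (auto simp: inj_on_def)
  ultimately show ?thesis
    using finite_complex_roots[OF f] by (metis endo_inj_surj)
qed

text \<open>
  An embedding permutes the roots of \<open>f\<close>, so it maps the field that they generate onto itself.
\<close>
lemma galois_groupI:
  assumes "embedding K \<psi>" "splitting_field f \<subseteq> K" "f \<noteq> 0"
  shows "restrict \<psi> (splitting_field f) \<in> carrier (galois_group f)"
proof -
  interpret embedding K \<psi> by fact
  let ?L = "splitting_field f" and ?R = "complex_roots f"
  interpret L: complex_subfield ?L
    unfolding splitting_field_def by (rule complex_subfield_rat_adjoin)
  have R: "?R \<subseteq> ?L"
    unfolding splitting_field_def by (rule subset_rat_adjoin)
  have img: "\<psi> ` ?R = ?R"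
    using R assms by (intro complex_roots_image) auto
  have "?L \<subseteq> {x \<in> K. \<psi> x \<in> ?L}"
    unfolding splitting_field_def
    by (intro rat_adjoin_subset subfield_preimage complex_subfield_rat_adjoin)
      (use img R assms(2) in \<open>auto simp: splitting_field_def\<close>)
  hence maps: "\<psi> x \<in> ?L" if "x \<in> ?L" for x
    using that by auto
  have "?L \<subseteq> \<psi> ` ?L"
    unfolding splitting_field_def
  proof (rule rat_adjoin_subset[OF subfield_image[OF complex_subfield_rat_adjoin]])
    show "rat_adjoin ?R \<subseteq> K" using assms(2) by (simp add: splitting_field_def)
    show "?R \<subseteq> \<psi> ` rat_adjoin ?R"
      using img R by (auto simp: splitting_field_def)
  qed
  hence "\<psi> ` ?L = ?L" using maps by auto
  moreover have "inj_on \<psi> ?L"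
    using hom_inj assms(2) by (auto simp: inj_on_def)
  ultimately have "restrict \<psi> ?L \<in> Bij ?L"
    by (simp add: Bij_def bij_betw_def)
  moreover have "restrict \<psi> ?L \<in> Ring.ring_hom (complex_ring\<lparr>carrier := ?L\<rparr>) (complex_ring\<lparr>carrier := ?L\<rparr>)"
    using assms(2) maps
    by (intro ring_hom_memI)
      (auto simp: complex_ring_simps L.add L.mult hom_add hom_mult subset_iff)
  moreover have "restrict \<psi> ?L q = q" if "q \<in> \<rat>" for q
    using that L.Rats hom_Rats by simp
  ultimately show ?thesis
    by (simp add: galois_group_def field_automorphisms_def)
qed

lemma galois_group_embedding:
  assumes "\<sigma> \<in> carrier (galois_group f)"
  shows "embedding (splitting_field f) \<sigma>" "\<sigma> ` splitting_field f = splitting_field f"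
    "\<sigma> \<in> extensional (splitting_field f)"
proof -
  let ?L = "splitting_field f"
  have B: "\<sigma> \<in> Bij ?L" and
    R: "\<sigma> \<in> Ring.ring_hom (complex_ring\<lparr>carrier := ?L\<rparr>) (complex_ring\<lparr>carrier := ?L\<rparr>)"
    using assms by (auto simp: galois_group_def field_automorphisms_def)
  show "\<sigma> ` ?L = ?L" "\<sigma> \<in> extensional ?L"
    using B by (auto simp: Bij_def bij_betw_def)
  show "embedding ?L \<sigma>"
    using ring_hom_add[OF R] ring_hom_mult[OF R] ring_hom_one[OF R]
    by (intro embedding.intro embedding_axioms.intro)
      (auto simp: complex_ring_simps splitting_field_def complex_subfield_rat_adjoin)
qed

lemma galois_group_mult:
  assumes "\<sigma> \<in> carrier (galois_group f)" "\<tau> \<in> carrier (galois_group f)"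
  shows "\<sigma> \<otimes>\<^bsub>galois_group f\<^esub> \<tau> = compose (splitting_field f) \<sigma> \<tau>"
    "compose (splitting_field f) \<sigma> \<tau> \<in> carrier (galois_group f)"
proof -
  show "\<sigma> \<otimes>\<^bsub>galois_group f\<^esub> \<tau> = compose (splitting_field f) \<sigma> \<tau>"
    using assms by (auto simp: galois_group_def BijGroup_def field_automorphisms_def)
  interpret s: embedding "splitting_field f" \<sigma> using galois_group_embedding[OF assms(1)] by blast
  interpret t: embedding "splitting_field f" \<tau> using galois_group_embedding[OF assms(2)] by blast
  have tL: "\<tau> x \<in> splitting_field f" if "x \<in> splitting_field f" for x
    using galois_group_embedding(2)[OF assms(2)] that by blast
  have sL: "\<sigma> x \<in> splitting_field f" if "x \<in> splitting_field f" for x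
    using galois_group_embedding(2)[OF assms(1)] that by blast
  have "compose (splitting_field f) \<sigma> \<tau> \<in> Bij (splitting_field f)"
    using assms by (intro compose_Bij) (auto simp: galois_group_def field_automorphisms_def)
  moreover have "compose (splitting_field f) \<sigma> \<tau> \<in> Ring.ring_hom (complex_ring\<lparr>carrier := splitting_field f\<rparr>)
      (complex_ring\<lparr>carrier := splitting_field f\<rparr>)"
    by (intro ring_hom_memI) (auto simp: complex_ring_simps compose_def s.hom_add s.hom_mult
        t.hom_add t.hom_mult tL sL s.add s.mult)
  moreover have "compose (splitting_field f) \<sigma> \<tau> q = q" if "q \<in> \<rat>" for q
    using that s.Rats[OF that] by (simp add: compose_def t.hom_Rats s.hom_Rats)
  ultimately show "compose (splitting_field f) \<sigma> \<tau> \<in> carrier (galois_group f)"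
    by (simp add: galois_group_def field_automorphisms_def)
qed

text \<open>
  The fixed field of the Galois group is \<open>\<rat>\<close>. An irrational \<open>z\<close> has a minimal polynomial of
  degree at least 2, which in characteristic 0 has a second root \<open>w\<close>; the embedding of \<open>\<rat>(z)\<close> with
  \<open>z \<mapsto> w\<close> extends to the splitting field.
\<close>
theorem exists_moving_automorphism:
  assumes f: "f \<noteq> 0" and z: "z \<in> splitting_field f" "algebraic_int z" "z \<notin> \<rat>"
  shows "\<exists>\<sigma> \<in> carrier (galois_group f). \<sigma> z \<noteq> z"
proof -
  interpret Q: embedding \<rat> id by (rule embedding_Rats)
  obtain h where h: "poly (cpoly h) z = 0" "lead_coeff h = 1"
    using z(2) by (auto simp: algebraic_int_altdef_ipoly)
  hence "h \<noteq> 0" by auto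
  then obtain m where m: "coeffs_in \<rat> m" "m \<noteq> 0" "poly m z = 0"
    "\<And>g. coeffs_in \<rat> g \<Longrightarrow> g \<noteq> 0 \<Longrightarrow> poly g z = 0 \<Longrightarrow> degree m \<le> degree g"
    using Q.exists_minimal_poly[of "cpoly h" z] h by auto
  obtain q where q: "m = [:- z, 1:] * q"
    using m(3) by (auto simp: poly_eq_0_iff_dvd)
  have q0: "q \<noteq> 0" using q m by auto
  have dm: "degree m = Suc (degree q)"
    unfolding q using q0 by (subst degree_mult_eq) auto
  have "degree q \<noteq> 0"
  proof
    assume "degree q = 0"
    then obtain c where c: "q = [:c:]" by (auto elim: degree_eq_zeroE)
    hence "m = [:- z * c, c:]" "c \<noteq> 0" using q q0 by auto
    hence "- z * c \<in> \<rat>" "c \<in> \<rat>" using m(1) by auto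
    hence "- (- z * c) / c \<in> \<rat>" by (intro Rats_divide) auto
    thus False using z(3) \<open>c \<noteq> 0\<close> by simp
  qed
  then obtain w where w: "poly q w = 0"
    using fundamental_theorem_of_algebra_alt[of q] by (metis degree_pCons_0)
  \<comment> \<open>A double root of \<open>m\<close> would be a root of its derivative, against minimality.\<close>
  have wz: "w \<noteq> z"
  proof
    assume "w = z"
    hence "poly (pderiv m) z = 0"
      using w unfolding q pderiv_mult by (simp add: pderiv_pCons)
    moreover have "pderiv m \<noteq> 0"
      using dm by (simp add: pderiv_eq_0_iff)
    ultimately have "degree m \<le> degree (pderiv m)"
      using m(4)[of "pderiv m"] Q.coeffs_in_pderiv[OF m(1)] by simp
    thus False using dm by (simp add: degree_pderiv)
  qed
  have mw: "poly (map_poly id m) w = 0"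
    using w q by simp
  obtain K \<psi> where K: "embedding K \<psi>" "\<rat> \<subseteq> K" "z \<in> K" "\<psi> z = w"
    by (rule Q.extend[OF m mw]) auto
  interpret K: embedding K \<psi> by (fact K(1))
  have "\<exists>p. coeffs_in \<rat> p \<and> p \<noteq> 0 \<and> poly p x = 0" if "x \<in> complex_roots f" for x
    using that f by (intro exI[of _ "cpoly f"]) (auto simp: complex_roots_def)
  then obtain M \<rho> where M: "embedding M \<rho>" "K \<subseteq> M" "complex_roots f \<subseteq> M" "\<forall>x\<in>K. \<rho> x = \<psi> x"
    using K.extend_finite[OF finite_complex_roots[OF f]] by blast
  have "complex_subfield M" using M(1) by (simp add: embedding_def)
  hence "splitting_field f \<subseteq> M"
    unfolding splitting_field_def using M(3) by (rule rat_adjoin_subset)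
  hence "restrict \<rho> (splitting_field f) \<in> carrier (galois_group f)"
    by (intro galois_groupI[OF M(1)] f)
  moreover have "restrict \<rho> (splitting_field f) z \<noteq> z"
    using z M K wz by simp
  ultimately show ?thesis by blast
qed

section \<open>Irreducible quartics, integral coordinates and Vieta relations\<close>

lemma coeffs_in_Rats_obtain:
  assumes "coeffs_in \<rat> p"
  obtains p' where "p = map_poly of_rat p'"
proof -
  interpret Q: complex_subfield \<rat> by (rule complex_subfield_Rats)
  have "\<exists>p'. p = map_poly of_rat p'"
    using assms
  proof (induction p)
    case 0
    show ?case by (intro exI[of _ 0]) simp
  next
    case (pCons a p)
    then obtain p' where "p = map_poly of_rat p'" by auto
    moreover obtain r where "a = of_rat r" using pCons by (auto elim: Rats_cases)
    ultimately show ?case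
      using pCons by (intro exI[of _ "pCons r p'"]) (auto simp: map_poly_pCons)
  qed
  thus ?thesis using that by blast
qed

lemma map_poly_of_rat_mult:
  "map_poly of_rat (p * q) = (map_poly of_rat p * map_poly of_rat q :: complex poly)"
  by (rule poly_eqI) (simp add: coeff_map_poly coeff_mult of_rat_sum of_rat_mult)

lemma map_poly_of_rat_inj:
  "map_poly of_rat p = (map_poly of_rat q :: complex poly) \<Longrightarrow> p = q"
  by (simp add: poly_eq_iff coeff_map_poly)

lemma degree_cpoly [simp]: "degree (cpoly f) = degree f"
  by (rule degree_map_poly) auto

lemma exists_complex_root:
  assumes "degree f \<noteq> 0"
  obtains x where "x \<in> complex_roots f"
proof -
  have "\<not> (\<exists>a l. a \<noteq> 0 \<and> l = 0 \<and> cpoly f = pCons a l)"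
  proof
    assume "\<exists>a l. a \<noteq> 0 \<and> l = 0 \<and> cpoly f = pCons a l"
    then obtain a where "cpoly f = [:a:]" by blast
    hence "degree (cpoly f) = 0" by simp
    thus False using assms by simp
  qed
  thus ?thesis
    using fundamental_theorem_of_algebra_alt[of "cpoly f"] that unfolding complex_roots_def by blast
qed

text \<open>
  The minimal polynomial of \<open>\<theta>\<close> divides \<open>f\<close> over \<open>\<rat>\<close>, so irreducibility forces it to have
  the degree of \<open>f\<close>.
\<close>
lemma irreducible_degree_le:
  assumes f: "irreducible_over_rat f" "\<theta> \<in> complex_roots f"
    and g: "coeffs_in \<rat> g" "g \<noteq> 0" "poly g \<theta> = 0"
  shows "degree f \<le> degree g"
proof -
  interpret Q: complex_subfield \<rat> by (rule complex_subfield_Rats)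
  obtain m where m: "coeffs_in \<rat> m" "m \<noteq> 0" "poly m \<theta> = 0"
    "\<And>h. coeffs_in \<rat> h \<Longrightarrow> h \<noteq> 0 \<Longrightarrow> poly h \<theta> = 0 \<Longrightarrow> degree m \<le> degree h"
    using Q.exists_minimal_poly[OF g] by metis
  have root: "poly (cpoly f) \<theta> = 0"
    using f(2) by (simp add: complex_roots_def)
  obtain q where q: "coeffs_in \<rat> q" "cpoly f = q * m"
    using Q.minimal_poly_dvd[OF m coeffs_in_cpoly root] by blast
  obtain m' q' where mq: "m = map_poly of_rat m'" "q = map_poly of_rat q'"
    using coeffs_in_Rats_obtain m(1) q(1) by metis
  have "cpoly f = map_poly of_rat (map_poly of_int f :: rat poly)"
    by (rule poly_eqI) (simp add: coeff_map_poly)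
  hence "map_poly of_rat (map_poly of_int f :: rat poly) = (map_poly of_rat (q' * m') :: complex poly)"
    using q(2) mq by (simp add: map_poly_of_rat_mult)
  hence "(map_poly of_int f :: rat poly) = q' * m'"
    by (rule map_poly_of_rat_inj)
  hence "q' dvd 1 \<or> m' dvd 1"
    using f(1) irreducibleD unfolding irreducible_over_rat_def by blast
  moreover have "\<not> m' dvd 1"
  proof
    assume "m' dvd 1"
    then obtain c where "m' = [:c:]" unfolding is_unit_poly_iff by blast
    thus False using m(2,3) mq by (cases "c = 0") (auto simp: map_poly_pCons)
  qed
  ultimately obtain c where "q' = [:c:]" unfolding is_unit_poly_iff by blast
  hence "degree q = 0" using mq by (simp add: degree_map_poly)
  moreover have "degree f = degree q + degree m" if "q \<noteq> 0"
    using q(2) m(2) that degree_cpoly[of f] degree_mult_eq by metis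
  ultimately have "degree f \<le> degree m"
    using q(2) degree_cpoly[of f] by (cases "q = 0") auto
  also have "\<dots> \<le> degree g" using m(4) g by blast
  finally show ?thesis .
qed

lemma quartic_powers_independent:
  assumes "irreducible_over_rat f" "degree f = 4" "\<theta> \<in> complex_roots f"
    and "q0 \<in> \<rat>" "q1 \<in> \<rat>" "q2 \<in> \<rat>" "q3 \<in> \<rat>"
    and "q0 + q1 * \<theta> + q2 * \<theta> ^ 2 + q3 * \<theta> ^ 3 = 0"
  shows "q0 = 0" "q1 = 0" "q2 = 0" "q3 = 0"
proof -
  interpret Q: complex_subfield \<rat> by (rule complex_subfield_Rats)
  let ?g = "[:q0, q1, q2, q3:]"
  have "poly ?g \<theta> = 0"
    using assms(8) by (simp add: power2_eq_square power3_eq_cube algebra_simps)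
  moreover have "degree ?g \<le> 3" by simp
  ultimately have "?g = 0"
    using irreducible_degree_le[OF assms(1,3), of ?g] assms(2,4-7) by (cases "?g = 0") auto
  thus "q0 = 0" "q1 = 0" "q2 = 0" "q3 = 0" by auto
qed

lemma powers_below_4: "{\<theta> ^ i | i. i < (4::nat)} = {1, \<theta>, \<theta> ^ 2, \<theta> ^ 3 :: complex}"
proof -
  have "{\<theta> ^ i | i. i < (4::nat)} = (\<lambda>i. \<theta> ^ i) ` {..<4}"
    by auto
  also have "{..<4} = {0, 1, 2, 3::nat}"
    by auto
  finally show ?thesis by simp
qed

lemma span_insert_iff:
  "z \<in> int_module.span (insert b B) \<longleftrightarrow> (\<exists>k. z - of_int k * b \<in> int_module.span B)"
  by (rule int_module.span_breakdown_eq)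

lemma span_powers_iff:
  "z \<in> int_module.span {\<theta> ^ i | i. i < (4::nat)} \<longleftrightarrow>
    (\<exists>n0 n1 n2 n3. z = of_int n0 + of_int n1 * \<theta> + of_int n2 * \<theta> ^ 2 + of_int n3 * \<theta> ^ 3)"
  unfolding powers_below_4 span_insert_iff int_module.span_empty
  by (simp add: algebra_simps)

lemma monogenic_obtain:
  assumes "monogenic f" "degree f = 4" "\<theta> \<in> complex_roots f"
    and "z \<in> rat_adjoin {\<theta>}" "algebraic_int z"
  obtains n0 n1 n2 n3 :: int
    where "z = of_int n0 + of_int n1 * \<theta> + of_int n2 * \<theta> ^ 2 + of_int n3 * \<theta> ^ 3"
proof -
  have "z \<in> int_module.span {\<theta> ^ i | i. i < (4::nat)}"
    using assms unfolding monogenic_def is_int_basis_def ring_of_integers_def by auto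
  thus ?thesis using that unfolding span_powers_iff by blast
qed

text \<open>
  The form in which monogenicity is used: an equation \<open>N z = q0 + q1 \<theta> + q2 \<theta>\<^sup>2 + q3 \<theta>\<^sup>3\<close> for an
  algebraic integer \<open>z\<close> can be divided by \<open>N\<close> coefficientwise.
\<close>
lemma monogenic_divides:
  fixes N q0 q1 q2 q3 :: int
  assumes mono: "monogenic f" and deg: "degree f = 4" and root: "\<theta> \<in> complex_roots f"
    and z: "algebraic_int z" and N: "N \<noteq> 0"
    and eq: "of_int N * z = of_int q0 + of_int q1 * \<theta> + of_int q2 * \<theta> ^ 2 + of_int q3 * \<theta> ^ 3"
  shows "N dvd q0" "N dvd q1" "N dvd q2" "N dvd q3"
proof -
  interpret A: complex_subfield "rat_adjoin {\<theta>}" by (rule complex_subfield_rat_adjoin)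
  have tA: "\<theta> \<in> rat_adjoin {\<theta>}" using subset_rat_adjoin by blast
  have "z = (of_int q0 + of_int q1 * \<theta> + of_int q2 * \<theta> ^ 2 + of_int q3 * \<theta> ^ 3) / of_int N"
    using N by (simp add: eq[symmetric])
  also have "\<dots> \<in> rat_adjoin {\<theta>}" using tA by (intro A.closed)
  finally have zA: "z \<in> rat_adjoin {\<theta>}" .
  obtain n0 n1 n2 n3 where n: "z = of_int n0 + of_int n1 * \<theta> + of_int n2 * \<theta> ^ 2 + of_int n3 * \<theta> ^ 3"
    by (rule monogenic_obtain[OF mono deg root zA z])
  have irr: "irreducible_over_rat f" using mono by (simp add: monogenic_def)
  have lin: "(M * a0 - b0) + (M * a1 - b1) * t + (M * a2 - b2) * t ^ 2 + (M * a3 - b3) * t ^ 3 =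
      M * (a0 + a1 * t + a2 * t ^ 2 + a3 * t ^ 3) - (b0 + b1 * t + b2 * t ^ 2 + b3 * t ^ 3)"
    for M t a0 a1 a2 a3 b0 b1 b2 b3 :: complex
    by (simp add: algebra_simps)
  have "of_int (N * n0 - q0) + of_int (N * n1 - q1) * \<theta> + of_int (N * n2 - q2) * \<theta> ^ 2
      + of_int (N * n3 - q3) * \<theta> ^ 3 =
    of_int N * (of_int n0 + of_int n1 * \<theta> + of_int n2 * \<theta> ^ 2 + of_int n3 * \<theta> ^ 3)
      - (of_int q0 + of_int q1 * \<theta> + of_int q2 * \<theta> ^ 2 + of_int q3 * \<theta> ^ 3)"
    unfolding of_int_diff of_int_mult by (rule lin)
  also have "\<dots> = 0"
    unfolding n[symmetric] by (simp add: eq)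
  finally have *: "of_int (N * n0 - q0) + of_int (N * n1 - q1) * \<theta> + of_int (N * n2 - q2) * \<theta> ^ 2
      + of_int (N * n3 - q3) * \<theta> ^ 3 = 0" .
  have "of_int (N * n0 - q0) = (0 :: complex)" "of_int (N * n1 - q1) = (0 :: complex)"
    "of_int (N * n2 - q2) = (0 :: complex)" "of_int (N * n3 - q3) = (0 :: complex)"
    using quartic_powers_independent[OF irr deg root _ _ _ _ *] by auto
  hence "q0 = N * n0" "q1 = N * n1" "q2 = N * n2" "q3 = N * n3"
    unfolding of_int_eq_0_iff by simp_all
  thus "N dvd q0" "N dvd q1" "N dvd q2" "N dvd q3" by simp_all
qed

text \<open>
  Split off the four distinct roots one after the other; by the degree the remaining factor is
  constant, and it is 1 because \<open>f\<close> is monic.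
\<close>
lemma quartic_split:
  assumes f: "lead_coeff f = 1" "degree f = 4"
    and r: "distinct [a, b, c, e]" "{a, b, c, e} \<subseteq> complex_roots f"
  shows "cpoly f = [:- a, 1:] * [:- b, 1:] * [:- c, 1:] * [:- e, 1:]"
proof -
  have root: "poly (cpoly f) x = 0" if "x \<in> {a, b, c, e}" for x
    using r(2) that by (auto simp: complex_roots_def)
  obtain p1 where p1: "cpoly f = [:- a, 1:] * p1"
    using root[of a] unfolding poly_eq_0_iff_dvd by (auto elim: dvdE)
  have "poly p1 b = 0" using root[of b] r(1) by (auto simp: p1 simp del: mult_pCons_left)
  then obtain p2 where p2: "p1 = [:- b, 1:] * p2"
    unfolding poly_eq_0_iff_dvd by (auto elim: dvdE)
  have "poly p2 c = 0" using root[of c] r(1) by (auto simp: p1 p2 simp del: mult_pCons_left)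
  then obtain p3 where p3: "p2 = [:- c, 1:] * p3"
    unfolding poly_eq_0_iff_dvd by (auto elim: dvdE)
  have "poly p3 e = 0" using root[of e] r(1) by (auto simp: p1 p2 p3 simp del: mult_pCons_left)
  then obtain p4 where p4: "p3 = [:- e, 1:] * p4"
    unfolding poly_eq_0_iff_dvd by (auto elim: dvdE)
  have eq: "cpoly f = [:- a, 1:] * [:- b, 1:] * [:- c, 1:] * [:- e, 1:] * p4"
    using p1 p2 p3 p4 by (simp only: mult.assoc)
  have p40: "p4 \<noteq> 0" using eq f by auto
  have "degree f = 4 + degree p4"
    using arg_cong[OF eq, of degree] p40 by (simp add: degree_mult_eq del: mult_pCons_left mult_pCons_right)
  then obtain k where k: "p4 = [:k:]" using f by (auto elim: degree_eq_zeroE)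
  have "lead_coeff (cpoly f) = 1"
    using f by (simp add: coeff_map_poly)
  hence "k = 1"
    unfolding eq k by (simp add: lead_coeff_mult del: mult_pCons_left mult_pCons_right)
  thus ?thesis using eq k by simp
qed

lemma quartic_vieta:
  assumes "lead_coeff f = 1" "degree f = 4" "distinct [a, b, c, e]" "{a, b, c, e} \<subseteq> complex_roots f"
  shows "a + b + c + e = - of_int (coeff f 3)"
    "a * b + a * c + a * e + b * c + b * e + c * e = of_int (coeff f 2)"
    "a * b * c + a * b * e + a * c * e + b * c * e = - of_int (coeff f 1)"
    "a * b * c * e = of_int (coeff f 0)"
proof -
  note eq = quartic_split[OF assms]
  have c: "of_int (coeff f n) = coeff (cpoly f) n" for n
    by (simp add: coeff_map_poly)
  show "a + b + c + e = - of_int (coeff f 3)"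
    "a * b + a * c + a * e + b * c + b * e + c * e = of_int (coeff f 2)"
    "a * b * c + a * b * e + a * c * e + b * c * e = - of_int (coeff f 1)"
    "a * b * c * e = of_int (coeff f 0)"
    unfolding c eq by (simp_all add: eval_nat_numeral algebra_simps)
qed

text \<open>
  Let \<open>\<sigma>\<close> correspond to 1 in \<open>\<int>/4\<close>. As \<open>\<sigma>\<^sup>2\<close> is not the identity, it moves some root \<open>a\<close>, and
  then \<open>\<sigma>\<^sup>4 = 1\<close> forces \<open>a, \<sigma> a, \<sigma>\<^sup>2 a, \<sigma>\<^sup>3 a\<close> to be distinct, so they are all the roots. What
  \<open>\<sigma>\<close> fixes is fixed by the whole group, hence rational.
\<close>
lemma cyclic_quartic_generator:
  assumes f: "cyclic_poly f" "degree f = 4"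
  obtains \<sigma> a b c e where
    "embedding (splitting_field f) \<sigma>" "distinct [a, b, c, e]" "complex_roots f = {a, b, c, e}"
    "\<sigma> a = b" "\<sigma> b = c" "\<sigma> c = e" "\<sigma> e = a"
    "\<And>z. z \<in> splitting_field f \<Longrightarrow> algebraic_int z \<Longrightarrow> \<sigma> z = z \<Longrightarrow> z \<in> \<int>"
proof -
  let ?G = "galois_group f" and ?L = "splitting_field f" and ?R = "complex_roots f"
  have f0: "f \<noteq> 0" using f by auto
  interpret L: complex_subfield ?L
    unfolding splitting_field_def by (rule complex_subfield_rat_adjoin)
  have R: "?R \<subseteq> ?L"
    unfolding splitting_field_def by (rule subset_rat_adjoin)
  obtain h where h: "h \<in> iso ?G (integer_mod_group 4)"
    using f by (auto simp: cyclic_poly_def is_iso_def)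
  hence hom: "h (x \<otimes>\<^bsub>?G\<^esub> y) = (h x + h y) mod 4" if "x \<in> carrier ?G" "y \<in> carrier ?G" for x y
    using that by (auto simp: iso_def hom_def)
  have bij: "bij_betw h (carrier ?G) {0..<4}"
    using h by (auto simp: iso_def carrier_integer_mod_group)
  hence inj: "x = y" if "x \<in> carrier ?G" "y \<in> carrier ?G" "h x = h y" for x y
    using that by (auto simp: bij_betw_def inj_on_def)
  have "1 \<in> h ` carrier ?G" using bij by (auto simp: bij_betw_def)
  then obtain \<sigma> where s: "\<sigma> \<in> carrier ?G" "h \<sigma> = 1" by auto
  interpret s: embedding ?L \<sigma> using galois_group_embedding[OF s(1)] by blast
  have sL: "\<sigma> x \<in> ?L" if "x \<in> ?L" for x
    using galois_group_embedding(2)[OF s(1)] that by blast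
  let ?c = "compose ?L"
  have s2: "?c \<sigma> \<sigma> \<in> carrier ?G" "h (?c \<sigma> \<sigma>) = 2"
    using galois_group_mult[OF s(1) s(1)] hom[OF s(1) s(1)] s(2) by auto
  have s3: "?c \<sigma> (?c \<sigma> \<sigma>) \<in> carrier ?G" "h (?c \<sigma> (?c \<sigma> \<sigma>)) = 3"
    using galois_group_mult[OF s(1) s2(1)] hom[OF s(1) s2(1)] s(2) s2(2) by auto
  have s4: "?c \<sigma> (?c \<sigma> (?c \<sigma> \<sigma>)) \<in> carrier ?G" "h (?c \<sigma> (?c \<sigma> (?c \<sigma> \<sigma>))) = 0"
    using galois_group_mult[OF s(1) s3(1)] hom[OF s(1) s3(1)] s(2) s3(2) by auto
  \<comment> \<open>An element mapped to 0 is idempotent, and an injective idempotent map is the identity.\<close>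
  have zero: "\<tau> x = x" if t: "\<tau> \<in> carrier ?G" "h \<tau> = 0" "x \<in> ?L" for \<tau> x
  proof -
    interpret t: embedding ?L \<tau> using galois_group_embedding[OF t(1)] by blast
    have "\<tau> \<otimes>\<^bsub>?G\<^esub> \<tau> = \<tau>"
      using galois_group_mult[OF t(1) t(1)] hom[OF t(1) t(1)] t(2) by (intro inj) (auto simp: t(1))
    hence "\<tau> (\<tau> x) = \<tau> x"
      using galois_group_mult(1)[OF t(1) t(1)] t(3) by (metis compose_eq)
    moreover have "\<tau> x \<in> ?L" using galois_group_embedding(2)[OF t(1)] t(3) by blast
    ultimately show ?thesis using t.hom_inj t(3) by blast
  qed
  have four: "\<sigma> (\<sigma> (\<sigma> (\<sigma> x))) = x" if "x \<in> ?L" for x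
    using zero[OF s4 that] that sL by (simp add: compose_eq)
  have all: "\<tau> z = z" if t: "\<tau> \<in> carrier ?G" and z: "z \<in> ?L" "\<sigma> z = z" for \<tau> z
  proof -
    have "h \<tau> \<in> {0..<4}" using bij t by (auto simp: bij_betw_def)
    hence "h \<tau> = 0 \<or> h \<tau> = 1 \<or> h \<tau> = 2 \<or> h \<tau> = 3" by auto
    moreover have "\<tau> = \<sigma>" if "h \<tau> = 1" using inj t s that by metis
    moreover have "\<tau> = ?c \<sigma> \<sigma>" if "h \<tau> = 2" using inj t s2 that by metis
    moreover have "\<tau> = ?c \<sigma> (?c \<sigma> \<sigma>)" if "h \<tau> = 3" using inj t s3 that by metis
    ultimately show ?thesis
      using zero[OF t] z by (auto simp: compose_eq)
  qed
  have fixed: "z \<in> \<int>" if "z \<in> ?L" "algebraic_int z" "\<sigma> z = z" for z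
  proof -
    have "z \<in> \<rat>"
      using exists_moving_automorphism[OF f0, of z] all that by blast
    thus ?thesis using that(2) rational_algebraic_int_is_int by blast
  qed
  have "\<exists>a\<in>?R. \<sigma> (\<sigma> a) \<noteq> a"
  proof (rule ccontr)
    assume "\<not> ?thesis"
    hence eq: "\<sigma> (\<sigma> a) = a" if "a \<in> ?R" for a using that by blast
    interpret s2: embedding ?L "?c \<sigma> \<sigma>" using galois_group_embedding[OF s2(1)] by blast
    have "?L \<subseteq> {x \<in> ?L. ?c \<sigma> \<sigma> x = x}"
      unfolding splitting_field_def
      by (rule rat_adjoin_subset[OF s2.subfield_fixed[unfolded splitting_field_def]])
        (use R eq in \<open>auto simp: splitting_field_def compose_eq\<close>)
    hence "?c \<sigma> \<sigma> x = x" if "x \<in> ?L" for x using that by auto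
    hence "?c (?c \<sigma> \<sigma>) (?c \<sigma> \<sigma>) = ?c \<sigma> \<sigma>"
      using sL by (auto simp: compose_def fun_eq_iff restrict_def)
    hence "(2 + 2) mod 4 = (2::int)"
      using hom[OF s2(1) s2(1)] s2(2) galois_group_mult(1)[OF s2(1) s2(1)] by simp
    thus False by simp
  qed
  then obtain a where a: "a \<in> ?R" "\<sigma> (\<sigma> a) \<noteq> a" by blast
  have sR: "\<sigma> x \<in> ?R" if "x \<in> ?R" for x
    using s.complex_roots_image[OF f0 R] that by blast
  define b where "b = \<sigma> a"
  define c where "c = \<sigma> b"
  define e where "e = \<sigma> c"
  have R4: "{a, b, c, e} \<subseteq> ?R" using a sR by (simp add: b_def c_def e_def)
  hence L4: "a \<in> ?L" "b \<in> ?L" "c \<in> ?L" "e \<in> ?L" using R by auto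
  have ea: "\<sigma> e = a" using four[OF L4(1)] by (simp add: b_def c_def e_def)
  have ac: "a \<noteq> c" using a by (simp add: b_def c_def)
  have be: "b \<noteq> e" using s.hom_inj[OF L4(1,3)] ac by (auto simp: b_def e_def)
  have ab: "a \<noteq> b"
    using ac by (auto simp: c_def b_def)
  have bc: "b \<noteq> c" using s.hom_inj[OF L4(1,2)] ab by (auto simp: b_def c_def)
  have ce: "c \<noteq> e" using s.hom_inj[OF L4(2,3)] bc by (auto simp: c_def e_def)
  have ae: "e \<noteq> a" using s.hom_inj[OF L4(3,4)] ce ea by (auto simp: e_def)
  have dist: "distinct [a, b, c, e]" using ac be ab bc ce ae by auto
  have "card ?R \<le> 4"
    using card_poly_roots_bound[of "cpoly f"] f0 f(2) by (simp add: complex_roots_def)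
  moreover have "card {a, b, c, e} = 4"
    using distinct_card[OF dist] by simp
  ultimately have "?R = {a, b, c, e}"
    using card_seteq[OF finite_complex_roots[OF f0] R4] by simp
  thus ?thesis
    by (rule that[OF s.embedding_axioms dist _ b_def[symmetric] c_def[symmetric] e_def[symmetric] ea fixed])
qed

text \<open>
  Write \<open>d = gcd d w * h\<close>. A prime divisor of \<open>h\<close> would divide \<open>d\<close>, hence \<open>w\<close> and the gcd, so its
  square would divide \<open>d\<close>.
\<close>
section \<open>Trinomials with a linear or cubic middle term\<close>

lemma squarefree_dvd_power:
  fixes d w :: int
  assumes "squarefree d" "d dvd w ^ n"
  shows "d dvd w"
proof -
  obtain h where h: "d = gcd d w * h" by (metis dvdE gcd_dvd1)
  have d0: "d \<noteq> 0" using assms(1) by auto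
  have "is_unit h"
  proof (rule ccontr)
    assume "\<not> is_unit h"
    moreover have "h \<noteq> 0" using h d0 by auto
    ultimately obtain p where p: "p dvd h" "prime p"
      using prime_divisor_exists by blast
    have "p dvd d" using p(1) h by (metis dvd_mult)
    hence "p dvd w" using assms(2) p(2) by (meson dvd_trans prime_dvd_power)
    hence "p dvd gcd d w" using \<open>p dvd d\<close> by simp
    hence "p ^ 2 dvd d" using p(1) h by (metis mult_dvd_mono power2_eq_square)
    hence "is_unit p" using assms(1) squarefreeD by blast
    thus False using p(2) not_prime_unit by blast
  qed
  hence "d dvd gcd d w" using h by (metis dvd_refl mult_unit_dvd_iff)
  thus ?thesis by simp
qed

text \<open>
  With \<open>p = x0 x2\<close> and \<open>q = x1 x3\<close> the quartic factors as
  \<open>(X\<^sup>2 - s X + p) (X\<^sup>2 + s X + q)\<close>, and comparing coefficients gives \<open>p + q = s\<^sup>2\<close>,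
  \<open>s (p - q) = C\<close> and \<open>p q = D\<close>. The first equation of the conclusion is the cubic resolvent in
  \<open>s\<^sup>2\<close>; the second one uses \<open>(x0 - x2)\<^sup>2 = s\<^sup>2 - 4 p\<close> and \<open>(x1 - x3)\<^sup>2 = s\<^sup>2 - 4 q\<close>.
\<close>
lemma depressed_quartic_resolvent:
  fixes x0 x1 x2 x3 C D :: complex
  assumes e1: "x0 + x1 + x2 + x3 = 0"
    and e2: "x0 * x1 + x0 * x2 + x0 * x3 + x1 * x2 + x1 * x3 + x2 * x3 = 0"
    and e3: "x0 * x1 * x2 + x0 * x1 * x3 + x0 * x2 * x3 + x1 * x2 * x3 = - C"
    and e4: "x0 * x1 * x2 * x3 = D"
  defines "s \<equiv> x0 + x2"
  shows "(s ^ 2) ^ 3 - 4 * D * s ^ 2 = C ^ 2"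
    "(s * (x0 - x2) * (x1 - x3)) ^ 2 = (s ^ 2) ^ 3 - 4 * C ^ 2"
    "x0 ^ 2 = s * x0 - x0 * x2" "2 * s * (x0 * x2) = s ^ 3 + C"
proof -
  define p where "p = x0 * x2"
  define q where "q = x1 * x3"
  have t: "x1 + x3 = - s" using e1 unfolding s_def by (simp add: eq_neg_iff_add_eq_0 algebra_simps)
  have "x0 * x1 + x0 * x2 + x0 * x3 + x1 * x2 + x1 * x3 + x2 * x3 = p + q + (x0 + x2) * (x1 + x3)"
    by (simp add: p_def q_def algebra_simps)
  hence "p + q + s * (- s) = 0" using e2 unfolding t s_def[symmetric] by simp
  hence pq: "p + q = s ^ 2" by (simp add: power2_eq_square)
  have "x0 * x1 * x2 + x0 * x1 * x3 + x0 * x2 * x3 + x1 * x2 * x3 = p * (x1 + x3) + q * (x0 + x2)"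
    by (simp add: p_def q_def algebra_simps)
  hence C: "s * (p - q) = C" using e3 t by (simp add: s_def algebra_simps)
  have D: "p * q = D" using e4 by (simp add: p_def q_def algebra_simps)
  show A: "(s ^ 2) ^ 3 - 4 * D * s ^ 2 = C ^ 2"
  proof -
    have "C ^ 2 = s ^ 2 * ((p + q) ^ 2 - 4 * (p * q))"
      unfolding C[symmetric] by (simp add: power2_eq_square algebra_simps)
    thus ?thesis
      unfolding pq D by (simp add: algebra_simps eval_nat_numeral)
  qed
  have 1: "(x0 - x2) ^ 2 = s ^ 2 - 4 * p"
    by (simp add: s_def p_def power2_eq_square algebra_simps)
  have "(x1 - x3) ^ 2 = (x1 + x3) ^ 2 - 4 * q"
    by (simp add: q_def power2_eq_square algebra_simps)
  hence 2: "(x1 - x3) ^ 2 = s ^ 2 - 4 * q" using t by simp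
  have "(s * (x0 - x2) * (x1 - x3)) ^ 2 = s ^ 2 * (s ^ 2 - 4 * p) * (s ^ 2 - 4 * q)"
    unfolding 1[symmetric] 2[symmetric] by (simp add: power_mult_distrib)
  also have "\<dots> = (s ^ 2) ^ 3 - 4 * C ^ 2"
  proof -
    have "s ^ 2 * (s ^ 2 - 4 * p) * (s ^ 2 - 4 * q) = s ^ 2 * ((s ^ 2) ^ 2 - 4 * s ^ 2 * (p + q) + 16 * D)"
      unfolding D[symmetric] by (simp add: power2_eq_square algebra_simps)
    also have "\<dots> = (s ^ 2) ^ 3 - 4 * C ^ 2"
      unfolding pq A[symmetric] by (simp add: algebra_simps eval_nat_numeral)
    finally show ?thesis .
  qed
  finally show "(s * (x0 - x2) * (x1 - x3)) ^ 2 = (s ^ 2) ^ 3 - 4 * C ^ 2" .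
  show "x0 ^ 2 = s * x0 - x0 * x2"
    by (simp add: s_def power2_eq_square algebra_simps)
  show "2 * s * (x0 * x2) = s ^ 3 + C"
  proof -
    have "2 * s * p = s * (p + q) + s * (p - q)" by (simp add: algebra_simps)
    thus ?thesis unfolding pq C p_def[symmetric] by (simp add: eval_nat_numeral)
  qed
qed

text \<open>
  Solving \<open>x\<^sup>2 - s x + p = 0\<close> for \<open>s\<close> with \<open>2 u p = u\<^sup>2 + c s\<close> gives
  \<open>s = (2 u x\<^sup>2 + u\<^sup>2) / (2 u x - c)\<close>; inverting the denominator modulo the quartic leads to this
  polynomial expression for \<open>s\<close>. The proof eliminates \<open>p\<close> from the powers of \<open>x\<close>.
\<close>
lemma resolvent_root_as_polynomial:
  fixes x p s u c :: complex
  assumes x2: "x ^ 2 = s * x - p" and p: "2 * s * p = s ^ 3 + c" and u: "s ^ 2 = u"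
  shows "(c ^ 2 + 2 * u ^ 3) * s = - 4 * u ^ 2 * x ^ 3 - 2 * u * c * x ^ 2 + 2 * u ^ 3 * x - 3 * c * u ^ 2"
proof -
  have "2 * u * p = s * (2 * s * p)"
    unfolding u[symmetric] by (simp add: power2_eq_square)
  also have "\<dots> = (s ^ 2) ^ 2 + c * s"
    unfolding p by (simp add: algebra_simps eval_nat_numeral)
  finally have p': "2 * u * p = u ^ 2 + c * s" unfolding u .
  have "x ^ 3 = x ^ 2 * x"
    by (simp add: power3_eq_cube power2_eq_square)
  also have "\<dots> = (s * x - p) * x"
    by (simp only: x2)
  also have "\<dots> = s * x ^ 2 - p * x"
    by (simp add: power2_eq_square algebra_simps)
  also have "\<dots> = s ^ 2 * x - s * p - p * x"
    unfolding x2 by (simp add: algebra_simps power2_eq_square)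
  finally have x3: "x ^ 3 = u * x - s * p - p * x"
    unfolding u .
  have "4 * u ^ 2 * x ^ 3 = 4 * u ^ 3 * x - 2 * u * s * (2 * u * p) - 2 * u * x * (2 * u * p)"
    unfolding x3 by (simp add: algebra_simps power2_eq_square power3_eq_cube)
  also have "\<dots> = 2 * u ^ 3 * x - 2 * u ^ 3 * s - 2 * u * c * s ^ 2 - 2 * u * c * (s * x)"
    unfolding p' by (simp add: algebra_simps power2_eq_square power3_eq_cube)
  finally have 3: "4 * u ^ 2 * x ^ 3 =
      2 * u ^ 3 * x - 2 * u ^ 3 * s - 2 * u ^ 2 * c - 2 * u * c * (s * x)"
    unfolding u by (simp add: algebra_simps power2_eq_square)
  have "2 * u * c * x ^ 2 = 2 * u * c * (s * x) - c * (2 * u * p)"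
    unfolding x2 by (simp add: algebra_simps)
  hence 2: "2 * u * c * x ^ 2 = 2 * u * c * (s * x) - c * u ^ 2 - c ^ 2 * s"
    unfolding p' by (simp add: algebra_simps power2_eq_square)
  have "- 4 * u ^ 2 * x ^ 3 - 2 * u * c * x ^ 2 + 2 * u ^ 3 * x - 3 * c * u ^ 2 =
      2 * u ^ 3 * x - 4 * u ^ 2 * x ^ 3 - 2 * u * c * x ^ 2 - 3 * c * u ^ 2"
    by simp
  also have "\<dots> = (c ^ 2 + 2 * u ^ 3) * s"
    unfolding 3 2 by (simp add: algebra_simps)
  finally show ?thesis by (rule sym)
qed

lemma trinomial_pCons:
  "monom 1 4 + monom a 3 + [:d:] = [:d, 0, 0, a, 1 :: int:]"
  "monom 1 4 + monom b 2 + [:d:] = [:d, 0, b, 0, 1 :: int:]"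
  "monom 1 4 + monom c 1 + [:d:] = [:d, c, 0, 0, 1 :: int:]"
  by (simp_all add: numeral_eq_Suc monom_Suc monom_0)

lemma algebraic_int_complex_root: "lead_coeff f = 1 \<Longrightarrow> x \<in> complex_roots f \<Longrightarrow> algebraic_int x"
  unfolding algebraic_int_altdef_ipoly complex_roots_def by auto

lemma algebraic_int_trinomial:
  fixes z :: complex
  assumes "z ^ 4 + of_int c * z + of_int d = 0"
  shows "algebraic_int z"
  unfolding algebraic_int_altdef_ipoly
proof (intro exI conjI)
  have "poly (map_poly of_int [:d, c, 0, 0, 1:]) z = z ^ 4 + of_int c * z + of_int d"
    by (simp add: map_poly_pCons algebra_simps eval_nat_numeral)
  thus "poly (map_poly of_int [:d, c, 0, 0, 1:]) z = 0"
    using assms by simp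
qed simp

lemma of_int_complex_inj: "(of_int m :: complex) = of_int n \<Longrightarrow> m = n"
  by simp

text \<open>
  Both \<open>(x0 + x2)\<^sup>2\<close> and \<open>(x0 + x2) (x0 - x2) (x1 - x3)\<close> are invariant under the 4-cycle, because
  it changes the sign of \<open>x0 + x2 = - (x1 + x3)\<close> and maps \<open>x0 - x2\<close> to \<open>x1 - x3\<close> and that to
  \<open>x2 - x0\<close>. So they are integers \<open>u\<close> and \<open>m\<close>.
\<close>
lemma (in embedding) cyclic_depressed_quartic:
  fixes C D :: int
  assumes x: "x0 \<in> F" "x1 \<in> F" "x2 \<in> F" "x3 \<in> F"
    and ai: "algebraic_int x0" "algebraic_int x1" "algebraic_int x2" "algebraic_int x3"
    and sx: "\<phi> x0 = x1" "\<phi> x1 = x2" "\<phi> x2 = x3" "\<phi> x3 = x0"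
    and fixed: "\<And>z. z \<in> F \<Longrightarrow> algebraic_int z \<Longrightarrow> \<phi> z = z \<Longrightarrow> z \<in> \<int>"
    and e1: "x0 + x1 + x2 + x3 = 0"
    and e2: "x0 * x1 + x0 * x2 + x0 * x3 + x1 * x2 + x1 * x3 + x2 * x3 = 0"
    and e3: "x0 * x1 * x2 + x0 * x1 * x3 + x0 * x2 * x3 + x1 * x2 * x3 = - of_int C"
    and e4: "x0 * x1 * x2 * x3 = of_int D"
  obtains u m :: int where "(x0 + x2) ^ 2 = of_int u" "\<phi> (x0 + x2) = - (x0 + x2)"
    "u ^ 3 - 4 * D * u = C ^ 2" "m ^ 2 = u ^ 3 - 4 * C ^ 2"
proof -
  define s where "s = x0 + x2"
  define m where "m = s * (x0 - x2) * (x1 - x3)"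
  note res = depressed_quartic_resolvent[OF e1 e2 e3 e4, folded s_def, folded m_def]
  have sF: "s \<in> F" and sai: "algebraic_int s"
    unfolding s_def using x ai by (auto intro: add algebraic_int_intros)
  have "\<phi> s = x1 + x3" using x sx by (simp add: s_def hom_add)
  hence ss: "\<phi> s = - s" using e1 by (simp add: s_def eq_neg_iff_add_eq_0 algebra_simps)
  have "s ^ 2 \<in> \<int>"
    using sF sai ss by (intro fixed) (auto simp: hom_power power intro: algebraic_int_intros)
  then obtain u where u: "s ^ 2 = of_int u" by (elim Ints_cases)
  have "m \<in> \<int>"
  proof (rule fixed)
    show "m \<in> F" unfolding m_def using x sF by (intro mult diff)
    show "algebraic_int m" unfolding m_def using sai ai by (intro algebraic_int_intros)
    have "\<phi> m = \<phi> s * (\<phi> x0 - \<phi> x2) * (\<phi> x1 - \<phi> x3)"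
      unfolding m_def using x sF by (simp add: hom_mult hom_diff mult diff)
    also have "\<dots> = m"
      unfolding ss sx m_def by (simp add: algebra_simps)
    finally show "\<phi> m = m" .
  qed
  then obtain m' where m': "m = of_int m'" by (elim Ints_cases)
  have "of_int (u ^ 3 - 4 * D * u) = (of_int (C ^ 2) :: complex)"
    using res(1) by (simp add: u)
  hence ud: "u ^ 3 - 4 * D * u = C ^ 2" by (rule of_int_complex_inj)
  have "of_int (m' ^ 2) = (of_int (u ^ 3 - 4 * C ^ 2) :: complex)"
    using res(2) by (simp add: u m')
  hence um: "m' ^ 2 = u ^ 3 - 4 * C ^ 2" by (rule of_int_complex_inj)
  show ?thesis
    using that[of u m'] u ss ud um by (simp add: s_def)
qed

text \<open>
  The integer \<open>N = c\<^sup>2 + 2 u\<^sup>3\<close> must divide \<open>4 u\<^sup>2\<close>, the coefficient of \<open>x0\<^sup>3\<close> in \<open>N s\<close>. As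
  \<open>u > 0\<close>, comparing sizes leaves only \<open>u = 1\<close>, and then \<open>s = \<plusminus>1\<close> would be fixed by \<open>\<sigma>\<close>.
\<close>
lemma linear_trinomial_not_cyclic_monogenic:
  assumes f: "f = monom 1 4 + monom c 1 + [:d:]" and c: "c \<noteq> 0"
    and mono: "monogenic f" and cyc: "cyclic_poly f"
  shows False
proof -
  have coeffs: "coeff f 0 = d" "coeff f 1 = c" "coeff f 2 = 0" "coeff f 3 = 0" "coeff f 4 = 1"
    unfolding f trinomial_pCons by (simp_all add: numeral_eq_Suc)
  have deg: "degree f = 4"
    unfolding f trinomial_pCons by simp
  have lc: "lead_coeff f = 1" by (simp add: deg coeffs)
  have irr: "irreducible_over_rat f" using mono by (simp add: monogenic_def)
  obtain \<sigma> x0 x1 x2 x3 where sig: "embedding (splitting_field f) \<sigma>"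
    and dist: "distinct [x0, x1, x2, x3]" and roots: "complex_roots f = {x0, x1, x2, x3}"
    and sx: "\<sigma> x0 = x1" "\<sigma> x1 = x2" "\<sigma> x2 = x3" "\<sigma> x3 = x0"
    and fixed: "\<And>z. z \<in> splitting_field f \<Longrightarrow> algebraic_int z \<Longrightarrow> \<sigma> z = z \<Longrightarrow> z \<in> \<int>"
    by (rule cyclic_quartic_generator[OF cyc deg]) (rule that)
  interpret embedding "splitting_field f" \<sigma> by (fact sig)
  have L: "x0 \<in> splitting_field f" "x1 \<in> splitting_field f" "x2 \<in> splitting_field f" "x3 \<in> splitting_field f"
    using subset_rat_adjoin[of "complex_roots f"] roots by (auto simp: splitting_field_def)
  have ai: "algebraic_int x0" "algebraic_int x1" "algebraic_int x2" "algebraic_int x3"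
    using algebraic_int_complex_root[OF lc] roots by auto
  note v = quartic_vieta[OF lc deg dist, unfolded roots coeffs, OF subset_refl]
  define s where "s = x0 + x2"
  have e: "x0 + x1 + x2 + x3 = 0"
     "x0 * x1 + x0 * x2 + x0 * x3 + x1 * x2 + x1 * x3 + x2 * x3 = 0"
     "x0 * x1 * x2 + x0 * x1 * x3 + x0 * x2 * x3 + x1 * x2 * x3 = - of_int c"
     "x0 * x1 * x2 * x3 = of_int d"
    using v by simp_all
  note res = depressed_quartic_resolvent[OF e, folded s_def]
  have sai: "algebraic_int s"
    unfolding s_def using ai by (intro algebraic_int_intros)
  obtain u m where u: "s ^ 2 = of_int u" and ss: "\<sigma> s = - s"
    and um: "m ^ 2 = u ^ 3 - 4 * c ^ 2"
    unfolding s_def by (rule cyclic_depressed_quartic[OF L ai sx fixed e]) auto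
  have "c ^ 2 > 0" using c by simp
  hence "u ^ 3 > 0" using um zero_le_power2[of m] by linarith
  hence upos: "u > 0" by (simp add: zero_less_power_eq)
  define N where "N = c ^ 2 + 2 * u ^ 3"
  have key: "of_int N * s = - 4 * of_int u ^ 2 * x0 ^ 3 - 2 * of_int u * of_int c * x0 ^ 2
      + 2 * of_int u ^ 3 * x0 - 3 * of_int c * of_int u ^ 2"
    using resolvent_root_as_polynomial[OF res(3,4) u] by (simp only: N_def of_int_add of_int_mult of_int_power of_int_numeral)
  have x0r: "x0 \<in> complex_roots f" using roots by simp
  have Npos: "N > 0" using \<open>c ^ 2 > 0\<close> upos by (simp add: N_def add_pos_pos)
  have eq: "of_int N * s = of_int (- 3 * c * u ^ 2) + of_int (2 * u ^ 3) * x0 + of_int (- 2 * u * c) * x0 ^ 2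
      + of_int (- 4 * u ^ 2) * x0 ^ 3"
    unfolding key by simp
  have "N dvd - 4 * u ^ 2"
    using Npos by (intro monogenic_divides(4)[OF mono deg x0r sai _ eq]) simp
  hence "N dvd 4 * u ^ 2"
    by simp
  hence "N \<le> 4 * u ^ 2" using upos by (intro zdvd_imp_le) auto
  hence "2 * u ^ 3 < 4 * u ^ 2" using \<open>c ^ 2 > 0\<close> unfolding N_def by linarith
  hence "u ^ 2 * u < u ^ 2 * 2" by (simp add: power3_eq_cube power2_eq_square)
  hence "u = 1" using upos by (simp add: mult_less_cancel_left)
  hence "s = 1 \<or> s = - 1" using u by (simp add: power2_eq_1_iff)
  hence "\<sigma> s = s" using hom_uminus[OF one] by auto
  hence "s = 0" using ss by simp
  thus False using \<open>s = 1 \<or> s = - 1\<close> by auto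
qed

text \<open>
  Squarefreeness of \<open>d\<close> lets one cancel \<open>d\<close> repeatedly: \<open>u = d\<^sup>2 v\<close>, \<open>a = d b\<close> and \<open>m = d\<^sup>3 k\<close>,
  which reduces the equations to \<open>d (v\<^sup>3 - b\<^sup>2) = 4 v\<close> and \<open>k\<^sup>2 = v\<^sup>3 - 4 b\<^sup>2\<close>. The second one
  gives \<open>4 (v\<^sup>3 - b\<^sup>2) \<ge> 3 v\<^sup>3\<close>, so the first one bounds \<open>v\<close> by 2, and neither value is possible.
\<close>
lemma cubic_trinomial_arith:
  fixes a d u m :: int
  assumes a: "a \<noteq> 0" and sq: "squarefree d"
    and u: "u ^ 3 - 4 * d ^ 3 * u = (a * d ^ 2) ^ 2" and m: "m ^ 2 = u ^ 3 - 4 * (a * d ^ 2) ^ 2"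
  shows False
proof -
  have d: "d \<noteq> 0" using sq by auto
  have "u ^ 3 = d ^ 3 * (4 * u + a ^ 2 * d)"
    using u by (simp add: algebra_simps power2_eq_square power3_eq_cube)
  hence "d ^ 3 dvd u ^ 3" by simp
  hence "d dvd u" by simp
  then obtain w where w: "u = d * w" by (elim dvdE)
  have "d ^ 3 * w ^ 3 = d ^ 3 * (d * (4 * w + a ^ 2))"
    using u unfolding w by (simp add: algebra_simps power2_eq_square power3_eq_cube)
  hence w3: "w ^ 3 = d * (4 * w + a ^ 2)" using d by simp
  hence "d dvd w ^ 3" by simp
  hence "d dvd w" using squarefree_dvd_power[OF sq] by blast
  then obtain v where v: "w = d * v" by (elim dvdE)
  have "d * (d ^ 2 * v ^ 3) = d * (4 * d * v + a ^ 2)"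
    using w3 unfolding v by (simp add: algebra_simps power2_eq_square power3_eq_cube)
  hence v3: "d ^ 2 * v ^ 3 = 4 * d * v + a ^ 2" using d by simp
  hence "a ^ 2 = d * (d * v ^ 3 - 4 * v)" by (simp add: algebra_simps power2_eq_square)
  hence "d dvd a ^ 2" by simp
  hence "d dvd a" using squarefree_dvd_power[OF sq] by blast
  then obtain b where b: "a = d * b" by (elim dvdE)
  have b0: "b \<noteq> 0" using a b by auto
  have "d * (d * v ^ 3) = d * (4 * v + d * b ^ 2)"
    using v3 unfolding b by (simp add: algebra_simps power2_eq_square)
  hence dv: "d * v ^ 3 = 4 * v + d * b ^ 2" using d by simp
  have m2: "m ^ 2 = (d ^ 3) ^ 2 * (v ^ 3 - 4 * b ^ 2)"
    using m unfolding w v b by (simp add: algebra_simps power2_eq_square power3_eq_cube)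
  hence "(d ^ 3) ^ 2 dvd m ^ 2" by simp
  hence "d ^ 3 dvd m" by (simp only: pow_divides_pow_iff zero_less_numeral)
  then obtain k where k: "m = d ^ 3 * k" by (elim dvdE)
  have k2: "k ^ 2 = v ^ 3 - 4 * b ^ 2"
    using m2 d unfolding k power_mult_distrib by simp
  have bpos: "b ^ 2 > 0" using b0 by simp
  have v3pos: "v ^ 3 > 0" using k2 bpos zero_le_power2[of k] by linarith
  hence vpos: "v > 0" by (simp add: zero_less_power_eq)
  have eq: "d * (v ^ 3 - b ^ 2) = 4 * v" using dv by (simp add: algebra_simps)
  have pos: "v ^ 3 - b ^ 2 > 0" using k2 bpos zero_le_power2[of k] by linarith
  hence "d > 0" using eq vpos by (metis mult_pos_pos zero_less_mult_pos2 zero_less_numeral)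
  hence "v ^ 3 - b ^ 2 \<le> 4 * v" using eq pos by (metis mult_le_cancel_right1 less_le_not_le int_one_le_iff_zero_less)
  hence "3 * v ^ 3 \<le> 16 * v" using k2 zero_le_power2[of k] by linarith
  hence "v * (3 * v ^ 2) \<le> v * 16" by (simp add: power2_eq_square power3_eq_cube algebra_simps)
  hence v2: "3 * v ^ 2 \<le> 16" using vpos by (simp add: mult_le_cancel_left)
  have "v < 3"
  proof (rule ccontr)
    assume "\<not> v < 3"
    hence "v ^ 2 \<ge> 3 ^ 2" by (intro power_mono) auto
    thus False using v2 by simp
  qed
  hence "v = 1 \<or> v = 2" using vpos by auto
  thus False
  proof
    assume "v = 1"
    hence "4 * b ^ 2 \<le> 1" using k2 zero_le_power2[of k] by simp
    thus False using bpos by linarith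
  next
    assume v: "v = 2"
    hence "4 * b ^ 2 \<le> 8" using k2 zero_le_power2[of k] by simp
    hence "b ^ 2 = 1 \<or> b ^ 2 = 2" using bpos by linarith
    moreover have "d * (8 - b ^ 2) = 8" using eq v by simp
    moreover have "b ^ 2 \<noteq> 2"
    proof
      assume "b ^ 2 = 2"
      hence "\<bar>b\<bar> ^ 2 = 2" by simp
      moreover have "\<bar>b\<bar> \<le> 1 \<or> \<bar>b\<bar> \<ge> 2" by linarith
      moreover have "\<bar>b\<bar> ^ 2 \<ge> 2 ^ 2" if "\<bar>b\<bar> \<ge> 2" using that by (intro power_mono) auto
      moreover have "\<bar>b\<bar> ^ 2 \<le> 1 ^ 2" if "\<bar>b\<bar> \<le> 1" using that by (intro power_mono) auto
      ultimately show False by auto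
    qed
    ultimately have "d * 7 = 8" by auto
    thus False by presburger
  qed
qed

text \<open>
  The reversed roots \<open>d / x\<^sub>i\<close> satisfy a quartic without quadratic and cubic terms, which gives
  access to \<open>cyclic_depressed_quartic\<close>. Monogenicity enters only through squarefreeness of \<open>d\<close>.
\<close>
lemma cubic_trinomial_not_cyclic_monogenic:
  assumes f: "f = monom 1 4 + monom a 3 + [:d:]" and a: "a \<noteq> 0" and d: "d \<noteq> 0"
    and mono: "monogenic f" and cyc: "cyclic_poly f"
  shows False
proof -
  have coeffs: "coeff f 0 = d" "coeff f 1 = 0" "coeff f 2 = 0" "coeff f 3 = a" "coeff f 4 = 1"
    unfolding f trinomial_pCons by (simp_all add: numeral_eq_Suc)
  have deg: "degree f = 4"
    unfolding f trinomial_pCons by simp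
  have lc: "lead_coeff f = 1" by (simp add: deg coeffs)
  have irr: "irreducible_over_rat f" using mono by (simp add: monogenic_def)
  obtain \<sigma> x0 x1 x2 x3 where sig: "embedding (splitting_field f) \<sigma>"
    and dist: "distinct [x0, x1, x2, x3]" and roots: "complex_roots f = {x0, x1, x2, x3}"
    and sx: "\<sigma> x0 = x1" "\<sigma> x1 = x2" "\<sigma> x2 = x3" "\<sigma> x3 = x0"
    and fixed: "\<And>z. z \<in> splitting_field f \<Longrightarrow> algebraic_int z \<Longrightarrow> \<sigma> z = z \<Longrightarrow> z \<in> \<int>"
    by (rule cyclic_quartic_generator[OF cyc deg]) (rule that)
  interpret embedding "splitting_field f" \<sigma> by (fact sig)
  have L: "x0 \<in> splitting_field f" "x1 \<in> splitting_field f" "x2 \<in> splitting_field f" "x3 \<in> splitting_field f"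
    using subset_rat_adjoin[of "complex_roots f"] roots by (auto simp: splitting_field_def)
  have root: "x ^ 4 + of_int a * x ^ 3 + of_int d = 0" if "x \<in> complex_roots f" for x
  proof -
    have "poly (cpoly f) x = (\<Sum>i\<le>4. of_int (coeff f i) * x ^ i)"
      by (simp add: poly_altdef deg coeff_map_poly)
    also have "\<dots> = x ^ 4 + of_int a * x ^ 3 + of_int d"
      using coeffs by (simp add: eval_nat_numeral)
    finally show ?thesis using that by (simp add: complex_roots_def)
  qed
  note v = quartic_vieta[OF lc deg dist, unfolded roots coeffs, OF subset_refl]
  have nz: "x0 \<noteq> 0" "x1 \<noteq> 0" "x2 \<noteq> 0" "x3 \<noteq> 0" using v(4) d by force+
  have "squarefree d"
  proof (rule squarefreeI)
    fix n :: int assume "n ^ 2 dvd d"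
    then obtain e where e: "d = n ^ 2 * e" by (elim dvdE)
    have n0: "n \<noteq> 0" using d e by auto
    have x0r: "x0 \<in> complex_roots f" using roots by simp
    define z where "z = (x0 ^ 3 + of_int a * x0 ^ 2) / of_int n"
    have zn: "z * of_int n = x0 ^ 3 + of_int a * x0 ^ 2" using n0 by (simp add: z_def)
    have "of_int n * (z * x0) = of_int n * (- of_int n * of_int e)"
    proof -
      have "of_int n * (z * x0) = (z * of_int n) * x0" by simp
      also have "\<dots> = x0 ^ 4 + of_int a * x0 ^ 3"
        unfolding zn by (simp add: algebra_simps eval_nat_numeral)
      also have "\<dots> = - of_int d"
        using root[OF x0r] by (simp add: eq_neg_iff_add_eq_0)
      also have "\<dots> = of_int n * (- of_int n * of_int e)"
        by (simp add: e power2_eq_square)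
      finally show ?thesis .
    qed
    hence zx: "z * x0 = - of_int n * of_int e"
      using n0 by (simp only: mult_cancel_left of_int_eq_0_iff) simp
    \<comment> \<open>Multiply the equation of \<open>x0\<close> by \<open>z\<^sup>4\<close> and use \<open>z x0 = - n e\<close>: this is \<open>d\<close> times the
      monic equation of \<open>z\<close>.\<close>
    have expand: "N ^ 2 * E * (z ^ 4 - A * N * E ^ 2 * z + N ^ 2 * E ^ 3) =
      z ^ 4 * (N ^ 2 * E) + A * (- N * E) ^ 3 * z + (- N * E) ^ 4" for N E A :: complex
      by (simp add: algebra_simps eval_nat_numeral)
    have "of_int (n ^ 2 * e) * (z ^ 4 - of_int (a * n * e ^ 2) * z + of_int (n ^ 2 * e ^ 3)) =
      z ^ 4 * of_int d + of_int a * (- of_int n * of_int e) ^ 3 * z + (- of_int n * of_int e) ^ 4"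
      unfolding e of_int_mult of_int_power by (rule expand)
    also have "\<dots> = z ^ 4 * (x0 ^ 4 + of_int a * x0 ^ 3 + of_int d)"
      unfolding zx[symmetric] by (simp add: algebra_simps eval_nat_numeral)
    also have "\<dots> = 0" using root[OF x0r] by simp
    finally have z4: "z ^ 4 - of_int (a * n * e ^ 2) * z + of_int (n ^ 2 * e ^ 3) = 0"
      using d e by simp
    have "algebraic_int z"
      by (rule algebraic_int_trinomial[of _ "- (a * n * e ^ 2)" "n ^ 2 * e ^ 3"]) (use z4 in simp)
    have "of_int n * z = of_int 0 + of_int 0 * x0 + of_int a * x0 ^ 2 + of_int 1 * x0 ^ 3"
      using zn by (simp add: mult.commute add.commute)
    thus "n dvd 1"
      by (rule monogenic_divides(4)[OF mono deg x0r \<open>algebraic_int z\<close> n0])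
  qed
  have yai: "algebraic_int (of_int d / x)" if "x \<in> complex_roots f" "x \<noteq> 0" for x
  proof -
    define t where "t = of_int d / x"
    have d': "of_int d = t * x" using that(2) by (simp add: t_def)
    have "x * (x ^ 3 + of_int a * x ^ 2 + t) = x ^ 4 + of_int a * x ^ 3 + t * x"
      by (simp add: algebra_simps eval_nat_numeral)
    hence 0: "x ^ 3 + of_int a * x ^ 2 + t = 0"
      using root[OF that(1)] that(2) unfolding d' by simp
    have "t ^ 4 + of_int a * (t * x) ^ 2 * t + (t * x) ^ 3 = t ^ 3 * (x ^ 3 + of_int a * x ^ 2 + t)"
      by (simp add: algebra_simps eval_nat_numeral)
    also have "\<dots> = 0" unfolding 0 by simp
    finally have "t ^ 4 + of_int (a * d ^ 2) * t + of_int (d ^ 3) = 0"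
      unfolding of_int_mult of_int_power d' .
    thus ?thesis unfolding t_def by (rule algebraic_int_trinomial)
  qed
  define y0 where "y0 = of_int d / x0"
  define y1 where "y1 = of_int d / x1"
  define y2 where "y2 = of_int d / x2"
  define y3 where "y3 = of_int d / x3"
  have dx: "of_int d = x0 * x1 * x2 * x3" using v(4) by (rule sym)
  have ysimp: "y0 = x1 * x2 * x3" "y1 = x0 * x2 * x3" "y2 = x0 * x1 * x3" "y3 = x0 * x1 * x2"
    using nz by (simp_all add: y0_def y1_def y2_def y3_def dx)
  have yL: "y0 \<in> splitting_field f" "y1 \<in> splitting_field f" "y2 \<in> splitting_field f" "y3 \<in> splitting_field f"
    unfolding ysimp using L by (auto intro: mult)
  have ai: "algebraic_int y0" "algebraic_int y1" "algebraic_int y2" "algebraic_int y3"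
    unfolding y0_def y1_def y2_def y3_def using yai nz roots by auto
  have sy: "\<sigma> y0 = y1" "\<sigma> y1 = y2" "\<sigma> y2 = y3" "\<sigma> y3 = y0"
    unfolding y0_def y1_def y2_def y3_def using L sx by (simp_all add: hom_divide)
  have e1: "y0 + y1 + y2 + y3 = 0"
    using v(3) unfolding ysimp by (simp add: algebra_simps)
  have "y0 * y1 + y0 * y2 + y0 * y3 + y1 * y2 + y1 * y3 + y2 * y3 =
    (x0 * x1 * x2 * x3) * (x0 * x1 + x0 * x2 + x0 * x3 + x1 * x2 + x1 * x3 + x2 * x3)"
    unfolding ysimp by (simp add: algebra_simps)
  hence e2: "y0 * y1 + y0 * y2 + y0 * y3 + y1 * y2 + y1 * y3 + y2 * y3 = 0"
    using v(2) by simp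
  have "y0 * y1 * y2 + y0 * y1 * y3 + y0 * y2 * y3 + y1 * y2 * y3 =
    (x0 * x1 * x2 * x3) ^ 2 * (x0 + x1 + x2 + x3)"
    unfolding ysimp by (simp add: algebra_simps power2_eq_square)
  also have "\<dots> = - (of_int (a * d ^ 2))"
    unfolding dx[symmetric] of_int_mult v(1) by (simp add: algebra_simps)
  finally have e3: "y0 * y1 * y2 + y0 * y1 * y3 + y0 * y2 * y3 + y1 * y2 * y3 = - (of_int (a * d ^ 2))" .
  have e4: "y0 * y1 * y2 * y3 = of_int (d ^ 3)"
    unfolding ysimp of_int_power dx by (simp add: algebra_simps power3_eq_cube)
  obtain u m where ud: "u ^ 3 - 4 * d ^ 3 * u = (a * d ^ 2) ^ 2"
    and um: "m ^ 2 = u ^ 3 - 4 * (a * d ^ 2) ^ 2"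
    by (rule cyclic_depressed_quartic[OF yL ai sy fixed e1 e2 e3 e4]) auto
  show False by (rule cubic_trinomial_arith[OF a \<open>squarefree d\<close> ud um])
qed

section \<open>Biquadratic trinomials\<close>

text \<open>
  Put \<open>b = m k\<close> and \<open>2 d = m n\<close>. Dividing the equation by \<open>m\<^sup>2\<close> gives \<open>d k\<^sup>2 = n\<^sup>2 + 1\<close>, and as \<open>n\<close>
  divides \<open>2 d\<close> it divides \<open>2 n\<^sup>2 + 2\<close>, hence 2. So \<open>d k\<^sup>2\<close> is 2 or 5.
\<close>
lemma biquadratic_trinomial_arith:
  fixes b d m :: int
  assumes b: "b \<noteq> 0" and d: "d \<noteq> 0" and m: "m ^ 2 = d * (b ^ 2 - 4 * d)"
    and dvd: "m dvd b" "m dvd b ^ 2 - 2 * d"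
  shows "d = 2 \<and> (b = 4 \<or> b = - 4) \<or> d = 5 \<and> (b = 5 \<or> b = - 5)"
proof -
  obtain k where k: "b = m * k" using dvd(1) by (elim dvdE)
  hence m0: "m \<noteq> 0" and k0: "k \<noteq> 0" using b by auto
  have "m dvd b ^ 2" using dvd(1) by (simp add: power2_eq_square)
  hence "m dvd b ^ 2 - (b ^ 2 - 2 * d)" using dvd(2) by (rule dvd_diff)
  hence "m dvd 2 * d" by simp
  then obtain n where n: "2 * d = m * n" by (elim dvdE)
  have "m ^ 2 * (d * k ^ 2) = d * b ^ 2" unfolding k by (simp add: power_mult_distrib)
  also have "\<dots> = m ^ 2 + (2 * d) ^ 2" unfolding m by (simp add: algebra_simps power2_eq_square)
  also have "\<dots> = m ^ 2 * (n ^ 2 + 1)" unfolding n by (simp add: power_mult_distrib algebra_simps)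
  finally have dk: "d * k ^ 2 = n ^ 2 + 1" using m0 by simp
  have "n * (m * k ^ 2) = 2 * (d * k ^ 2)"
    using n by (simp only: mult.assoc[symmetric]) (simp add: mult.commute)
  also have "\<dots> = n * (2 * n) + 2"
    unfolding dk by (simp add: power2_eq_square)
  finally have "n * (m * k ^ 2) = n * (2 * n) + 2" .
  hence "n dvd n * (2 * n) + 2" by (metis dvd_triv_left)
  hence n2: "n dvd 2" by (simp add: dvd_add_right_iff)
  hence "\<bar>n\<bar> \<le> 2" using dvd_imp_le_int[of 2 n] by simp
  moreover have "n \<noteq> 0" using n d by auto
  ultimately have nn: "n = 1 \<or> n = - 1 \<or> n = 2 \<or> n = - 2" by linarith
  have "d * k ^ 2 > 0" using dk by (simp add: add_nonneg_pos)
  hence "d > 0" by (simp add: zero_less_mult_iff)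
  have kk: "k = 1 \<or> k = - 1"
  proof (rule ccontr)
    assume "\<not> ?thesis"
    hence "\<bar>k\<bar> \<ge> 2" using k0 by linarith
    hence "\<bar>k\<bar> ^ 2 \<ge> 2 ^ 2" by (intro power_mono) auto
    hence k4: "k ^ 2 \<ge> 4" by simp
    have "d * k ^ 2 \<ge> 1 * k ^ 2" using \<open>d > 0\<close> by (intro mult_right_mono) auto
    moreover have "d * k ^ 2 = 2 \<or> d * k ^ 2 = 5" using dk nn by auto
    ultimately have five: "d * k ^ 2 = 5" "k ^ 2 \<le> 5" using k4 by auto
    hence "k ^ 2 = 4 \<or> k ^ 2 = 5" using k4 by linarith
    moreover have "\<bar>k\<bar> < 3"
    proof (rule ccontr)
      assume "\<not> \<bar>k\<bar> < 3"
      hence "\<bar>k\<bar> ^ 2 \<ge> 3 ^ 2" by (intro power_mono) auto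
      thus False using five by simp
    qed
    hence "\<bar>k\<bar> = 2" using \<open>\<bar>k\<bar> \<ge> 2\<close> by linarith
    hence "\<bar>k\<bar> ^ 2 = 4" by simp
    hence "k ^ 2 = 4" by simp
    hence "d * 4 = 5" using five by simp
    thus False by presburger
  qed
  hence "k ^ 2 = 1" by auto
  hence "d = n ^ 2 + 1" using dk by simp
  thus ?thesis using nn kk n k by auto
qed

text \<open>
  Here \<open>t = - x\<^sup>2 - 3\<close> satisfies \<open>t\<^sup>2 + t - 1 = 0\<close> and \<open>z = (x + t) / 2\<close> satisfies
  \<open>z\<^sup>2 - t z + 1 = 0\<close>, so \<open>z\<close> is a primitive fifth root of unity; its coordinate at \<open>x\<close> is one half.
\<close>
lemma biquadratic_not_5_5:
  assumes f: "f = monom 1 4 + monom 5 2 + [:5:]" and mono: "monogenic f"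
  shows False
proof -
  have deg: "degree f = 4"
    unfolding f trinomial_pCons by simp
  obtain x where root: "x \<in> complex_roots f"
    by (rule exists_complex_root[of f]) (use deg in simp)
  hence x: "poly (cpoly f) x = 0" by (simp add: complex_roots_def)
  have "poly (cpoly f) x = x ^ 4 + 5 * x ^ 2 + 5"
    unfolding f trinomial_pCons by (simp add: map_poly_pCons algebra_simps eval_nat_numeral)
  hence x4: "x ^ 4 + 5 * x ^ 2 + 5 = 0" using x by simp
  define z where "z = (x - x ^ 2 - 3) / 2"
  define t where "t = - (x ^ 2) - 3"
  have "t ^ 2 + t - 1 = x ^ 4 + 5 * x ^ 2 + 5"
    unfolding t_def by (simp add: algebra_simps eval_nat_numeral)
  hence t: "t ^ 2 + t - 1 = 0" using x4 by simp
  hence t2: "t ^ 2 = x ^ 2 + 4" by (simp add: t_def algebra_simps)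
  have z2: "2 * z = x + t" by (simp add: z_def t_def)
  have "4 * (z ^ 2 + 1 - t * z) = (2 * z) ^ 2 - 2 * t * (2 * z) + 4"
    by (simp add: algebra_simps power2_eq_square)
  also have "\<dots> = x ^ 2 - t ^ 2 + 4"
    unfolding z2 by (simp add: algebra_simps power2_eq_square)
  also have "\<dots> = 0" unfolding t2 by simp
  finally have "z ^ 2 + 1 - t * z = 0"
    by (simp only: mult_eq_0_iff) simp
  hence zt: "z ^ 2 + 1 = t * z" by simp
  have "z ^ 4 + z ^ 3 + z ^ 2 + z + 1 = (z ^ 2 + 1) ^ 2 + z * (z ^ 2 + 1) - z ^ 2"
    by (simp add: algebra_simps eval_nat_numeral)
  also have "\<dots> = z ^ 2 * (t ^ 2 + t - 1)"
    unfolding zt by (simp add: algebra_simps power2_eq_square)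
  finally have "z ^ 4 + z ^ 3 + z ^ 2 + z + 1 = 0"
    using t by simp
  moreover have "poly (map_poly of_int [:1, 1, 1, 1, 1:]) z = z ^ 4 + z ^ 3 + z ^ 2 + z + 1"
    by (simp add: map_poly_pCons algebra_simps eval_nat_numeral)
  ultimately have "poly (map_poly of_int [:1, 1, 1, 1, 1:]) z = 0" by simp
  moreover have "lead_coeff [:1, 1, 1, 1, 1 :: int:] = 1" by simp
  ultimately have "algebraic_int z"
    unfolding algebraic_int_altdef_ipoly by blast
  moreover have "of_int 2 * z = of_int (- 3) + of_int 1 * x + of_int (- 1) * x ^ 2 + of_int 0 * x ^ 3"
    by (simp add: z_def)
  ultimately have "(2::int) dvd 1"
    using monogenic_divides(2)[OF mono deg root] by (metis zero_neq_numeral)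
  thus False by simp
qed

text \<open>
  The root \<open>- x\<close> must be \<open>\<sigma>\<^sup>2 x\<close>, since \<open>\<sigma> x = - x\<close> or \<open>\<sigma>\<^sup>3 x = - x\<close> would give \<open>\<sigma>\<^sup>2 x = x\<close>. Therefore
  \<open>\<sigma>\<close> fixes \<open>m = x y (x\<^sup>2 - y\<^sup>2)\<close>, and \<open>m y\<close> is a polynomial in \<open>x\<close> with integer coefficients.
\<close>
lemma biquadratic_cyclic_monogenic:
  assumes f: "f = monom 1 4 + monom b 2 + [:d:]" and b: "b \<noteq> 0" and d: "d \<noteq> 0"
    and mono: "monogenic f" and cyc: "cyclic_poly f"
  shows "d = 2 \<and> (b = 4 \<or> b = - 4) \<or> d = 5 \<and> b = - 5"
proof -
  have coeffs: "coeff f 0 = d" "coeff f 1 = 0" "coeff f 2 = b" "coeff f 3 = 0" "coeff f 4 = 1"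
    unfolding f trinomial_pCons by (simp_all add: numeral_eq_Suc)
  have deg: "degree f = 4"
    unfolding f trinomial_pCons by simp
  have lc: "lead_coeff f = 1" by (simp add: deg coeffs)
  obtain \<sigma> x y x' y' where sig: "embedding (splitting_field f) \<sigma>"
    and dist: "distinct [x, y, x', y']" and roots: "complex_roots f = {x, y, x', y'}"
    and sx: "\<sigma> x = y" "\<sigma> y = x'" "\<sigma> x' = y'" "\<sigma> y' = x"
    and fixed: "\<And>z. z \<in> splitting_field f \<Longrightarrow> algebraic_int z \<Longrightarrow> \<sigma> z = z \<Longrightarrow> z \<in> \<int>"
    by (rule cyclic_quartic_generator[OF cyc deg]) (rule that)
  interpret embedding "splitting_field f" \<sigma> by (fact sig)
  have L: "x \<in> splitting_field f" "y \<in> splitting_field f" "x' \<in> splitting_field f" "y' \<in> splitting_field f"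
    using subset_rat_adjoin[of "complex_roots f"] roots by (auto simp: splitting_field_def)
  have ai: "algebraic_int x" "algebraic_int y"
    using algebraic_int_complex_root[OF lc] roots by auto
  note v = quartic_vieta[OF lc deg dist, unfolded roots coeffs, OF subset_refl]
  have nz: "x \<noteq> 0" "y \<noteq> 0" using v(4) d by force+
  have even: "poly (cpoly f) z = z ^ 4 + of_int b * z ^ 2 + of_int d" for z
    unfolding f trinomial_pCons by (simp add: map_poly_pCons algebra_simps eval_nat_numeral)
  have "x \<in> complex_roots f" using roots by simp
  hence "- x \<in> complex_roots f"
    by (simp add: complex_roots_def even)
  hence "- x \<in> {x, y, x', y'}" using roots by simp
  moreover have "- x \<noteq> x" using nz by (simp add: neg_eq_iff_add_eq_0 mult_2[symmetric])
  moreover have "- x \<noteq> y"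
  proof
    assume "- x = y"
    hence "x' = - y" using sx L hom_uminus[of x] by simp
    thus False using dist \<open>- x = y\<close> by auto
  qed
  moreover have "- x \<noteq> y'"
  proof
    assume "- x = y'"
    hence "x = - y" using sx L hom_uminus[of x] by simp
    thus False using dist \<open>- x = y'\<close> by auto
  qed
  ultimately have x': "x' = - x" by auto
  hence y': "y' = - y" using sx L hom_uminus[of x] by simp
  have bv: "of_int b = - (x ^ 2 + y ^ 2)" and dv: "of_int d = x ^ 2 * y ^ 2"
    using v(2,4) unfolding x' y' by (simp_all add: algebra_simps power2_eq_square)
  define m where "m = x * y * (x ^ 2 - y ^ 2)"
  have "m \<in> \<int>"
  proof (rule fixed)
    show "m \<in> splitting_field f" unfolding m_def using L by (intro mult diff power)
    show "algebraic_int m" unfolding m_def using ai by (intro algebraic_int_intros)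
    have "\<sigma> m = \<sigma> x * \<sigma> y * (\<sigma> x ^ 2 - \<sigma> y ^ 2)"
      unfolding m_def using L by (simp add: hom_mult hom_diff hom_power mult diff power)
    also have "\<dots> = m"
      unfolding sx x' m_def by (simp add: algebra_simps)
    finally show "\<sigma> m = m" .
  qed
  then obtain n where n: "m = of_int n" by (elim Ints_cases)
  have "of_int (n ^ 2) = m ^ 2" by (simp add: n)
  also have "\<dots> = x ^ 2 * y ^ 2 * ((x ^ 2 + y ^ 2) ^ 2 - 4 * (x ^ 2 * y ^ 2))"
    unfolding m_def by (simp add: algebra_simps power2_eq_square)
  also have "\<dots> = of_int (d * (b ^ 2 - 4 * d))"
    unfolding of_int_mult of_int_diff of_int_power of_int_numeral bv dv power2_minus by (rule refl)
  finally have n2: "n ^ 2 = d * (b ^ 2 - 4 * d)" by (rule of_int_complex_inj)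
  have "n \<noteq> 0"
  proof
    assume "n = 0"
    hence "x ^ 2 - y ^ 2 = 0" using n nz by (simp add: m_def)
    hence "(x - y) * (x + y) = 0" by (simp add: algebra_simps power2_eq_square)
    thus False using dist y' by (auto simp: eq_neg_iff_add_eq_0)
  qed
  have "of_int n * y = - (of_int b * x ^ 3 + (of_int b ^ 2 - 2 * of_int d) * x)"
    unfolding n[symmetric] m_def bv dv by (simp add: algebra_simps power2_eq_square power3_eq_cube)
  hence eq: "of_int n * y = of_int 0 + of_int (2 * d - b ^ 2) * x + of_int 0 * x ^ 2 + of_int (- b) * x ^ 3"
    by (simp add: algebra_simps)
  note dvd = monogenic_divides[OF mono deg \<open>x \<in> complex_roots f\<close> ai(2) \<open>n \<noteq> 0\<close> eq]
  have "n dvd b" using dvd(4) by simp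
  moreover have "n dvd b ^ 2 - 2 * d" using dvd(2) by (simp add: dvd_diff_commute)
  ultimately have "d = 2 \<and> (b = 4 \<or> b = - 4) \<or> d = 5 \<and> (b = 5 \<or> b = - 5)"
    by (rule biquadratic_trinomial_arith[OF b d n2])
  moreover have "\<not> (d = 5 \<and> b = 5)"
    using biquadratic_not_5_5 f mono by auto
  ultimately show ?thesis by auto
qed

section \<open>Irreducibility and conjugates of biquadratic trinomials\<close>

lemma rat_square_int:
  fixes q :: rat
  assumes "q ^ 2 = of_int n"
  shows "\<exists>k. k ^ 2 = n"
proof -
  define z where "z = (of_rat q :: complex)"
  have z2: "z ^ 2 = of_int n"
    unfolding z_def using assms by (metis of_rat_of_int_eq of_rat_power)
  have "poly (map_poly of_int [:- n, 0, 1:]) z = z ^ 2 - of_int n"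
    by (simp add: map_poly_pCons power2_eq_square)
  hence "poly (map_poly of_int [:- n, 0, 1:]) z = 0" using z2 by simp
  moreover have "lead_coeff [:- n, 0, 1:] = 1" by simp
  ultimately have "algebraic_int z"
    unfolding algebraic_int_altdef_ipoly by blast
  moreover have "z \<in> \<rat>" by (simp add: z_def)
  ultimately have "z \<in> \<int>" by (rule rational_algebraic_int_is_int)
  then obtain k where "z = of_int k" by (elim Ints_cases)
  hence "of_int (k ^ 2) = (of_int n :: complex)" using z2 by simp
  thus ?thesis by (intro exI[of _ k]) (rule of_int_complex_inj)
qed

text \<open>
  These three integers are the constant terms and the values of \<open>b\<^sup>2 - 4 d\<close> of the exceptional
  polynomials.
\<close>
lemma not_rat_square:
  fixes q :: rat
  assumes "n = 2 \<or> n = 5 \<or> n = (8 :: int)"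
  shows "q ^ 2 \<noteq> of_int n"
proof
  assume "q ^ 2 = of_int n"
  then obtain k where k: "k ^ 2 = n" using rat_square_int by blast
  have "\<bar>k\<bar> < 3"
  proof (rule ccontr)
    assume "\<not> \<bar>k\<bar> < 3"
    hence "\<bar>k\<bar> ^ 2 \<ge> 3 ^ 2" by (intro power_mono) auto
    thus False using k assms by auto
  qed
  hence "k = - 2 \<or> k = - 1 \<or> k = 0 \<or> k = 1 \<or> k = 2" by linarith
  thus False using k assms by auto
qed

text \<open>
  A rational root \<open>q\<close> makes \<open>b\<^sup>2 - 4 d = (2 q\<^sup>2 + b)\<^sup>2\<close>. A factorisation into quadratics, normalised
  to be monic, has the form \<open>(X\<^sup>2 + p X + q) (X\<^sup>2 - p X + s)\<close> with \<open>p (s - q) = 0\<close>, so either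
  \<open>b\<^sup>2 - 4 d = (q - s)\<^sup>2\<close> or \<open>d = q\<^sup>2\<close>.
\<close>
lemma biquadratic_irreducible:
  fixes b d :: int
  assumes f: "f = monom 1 4 + monom b 2 + [:d:]"
    and sq: "\<And>q :: rat. q ^ 2 \<noteq> of_int d" "\<And>q :: rat. q ^ 2 \<noteq> of_int (b ^ 2 - 4 * d)"
  shows "irreducible_over_rat f"
proof -
  define F where "F = (map_poly of_int f :: rat poly)"
  have F: "F = [:of_int d, 0, of_int b, 0, 1:]"
    unfolding F_def f trinomial_pCons by (simp add: map_poly_pCons)
  have small: False if gh: "F = g * h" and dg: "degree g = 1 \<or> degree g = 2" for g h
  proof -
    have g0: "g \<noteq> 0" "h \<noteq> 0" using gh F by auto
    have "degree F = degree g + degree h" unfolding gh using g0 by (simp add: degree_mult_eq)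
    hence deg: "degree g + degree h = 4" by (simp add: F)
    show False
    proof (cases "degree g = 1")
      case True
      hence "coeff g 1 \<noteq> 0" by (metis degree_0 leading_coeff_0_iff zero_neq_one)
      hence "\<exists>q. poly g q = 0"
        by (intro exI[of _ "- coeff g 0 / coeff g 1"]) (use True in \<open>simp add: poly_altdef\<close>)
      then obtain q where "poly g q = 0" by blast
      hence "poly F q = 0" by (simp add: gh)
      moreover have "poly F q = q ^ 4 + of_int b * q ^ 2 + of_int d"
        unfolding F by (simp add: algebra_simps eval_nat_numeral)
      moreover have "(2 * q ^ 2 + of_int b) ^ 2 =
        4 * (q ^ 4 + of_int b * q ^ 2 + of_int d) + of_int (b ^ 2 - 4 * d)"
        by (simp add: algebra_simps eval_nat_numeral)
      ultimately show False using sq(2)[of "2 * q ^ 2 + of_int b"] by simp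
    next
      case False
      hence d2: "degree g = 2" "degree h = 2" using dg deg by auto
      define a0 where "a0 = coeff g 0"
      define a1 where "a1 = coeff g 1"
      define a2 where "a2 = coeff g 2"
      define c0 where "c0 = coeff h 0"
      define c1 where "c1 = coeff h 1"
      define c2 where "c2 = coeff h 2"
      have g: "g = [:a0, a1, a2:]" 
        by (rule poly_eqI) (auto simp: a0_def a1_def a2_def coeff_pCons d2 numeral_eq_Suc coeff_eq_0 split: nat.splits)
      have h: "h = [:c0, c1, c2:]"
        by (rule poly_eqI) (auto simp: c0_def c1_def c2_def coeff_pCons d2 numeral_eq_Suc coeff_eq_0 split: nat.splits)
      have eqs: "a0 * c0 = of_int d" "a0 * c1 + a1 * c0 = 0" "a0 * c2 + a1 * c1 + a2 * c0 = of_int b"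
        "a1 * c2 + a2 * c1 = 0" "a2 * c2 = 1"
        using gh unfolding F g h by (simp_all add: algebra_simps)
      define p where "p = a1 * c2"
      define q where "q = a0 * c2"
      define s where "s = a2 * c0"
      have p': "a2 * c1 = - p" using eqs(4) by (simp add: p_def eq_neg_iff_add_eq_0 add.commute)
      have qs: "q * s = of_int d"
      proof -
        have "q * s = (a0 * c0) * (a2 * c2)" by (simp add: q_def s_def)
        thus ?thesis using eqs(1,5) by simp
      qed
      have "a1 * c1 = (a2 * c2) * (a1 * c1)" using eqs(5) by simp
      also have "\<dots> = p * (a2 * c1)" by (simp add: p_def)
      finally have pp: "a1 * c1 = - (p ^ 2)" by (simp add: p' power2_eq_square)
      have b: "q + s - p ^ 2 = of_int b" using eqs(3) pp by (simp add: q_def s_def)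
      have "(a2 * c2) * (a0 * c1 + a1 * c0) = q * (a2 * c1) + p * s"
        by (simp add: q_def p_def s_def algebra_simps)
      hence "q * (- p) + p * s = 0" using eqs(2) p' by simp
      moreover have "p * (s - q) = q * (- p) + p * s" by (simp add: algebra_simps)
      ultimately have "p * (s - q) = 0" by simp
      hence "p = 0 \<or> s = q" by auto
      thus False
      proof
        assume "p = 0"
        have "(q - s) ^ 2 = (q + s - p ^ 2) ^ 2 - 4 * (q * s)"
          by (simp add: \<open>p = 0\<close> algebra_simps power2_eq_square)
        hence "(q - s) ^ 2 = of_int (b ^ 2 - 4 * d)" unfolding b qs by simp
        thus False using sq(2) by blast
      next
        assume "s = q"
        hence "q ^ 2 = of_int d" using qs by (simp add: power2_eq_square)
        thus False using sq(1) by blast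
      qed
    qed
  qed
  have F0: "F \<noteq> 0" and dF: "degree F = 4" by (simp_all add: F)
  have "Factorial_Ring.irreducible F"
  proof (rule irreducibleI)
    show "F \<noteq> 0" by (fact F0)
    show "\<not> F dvd 1" using dF F0 by (auto simp: is_unit_iff_degree)
    fix g h assume gh: "F = g * h"
    have g0: "g \<noteq> 0" "h \<noteq> 0" using gh F0 by auto
    have "degree F = degree g + degree h" unfolding gh using g0 by (simp add: degree_mult_eq)
    hence deg: "degree g + degree h = 4" using dF by simp
    have "\<not> (degree g = 1 \<or> degree g = 2)" using small[OF gh] by blast
    moreover have "\<not> (degree h = 1 \<or> degree h = 2)" using small[of h g] gh by (auto simp: mult.commute)
    ultimately have "degree g = 0 \<or> degree h = 0" using deg by arith
    thus "g dvd 1 \<or> h dvd 1" using g0 by (auto simp: is_unit_iff_degree)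
  qed
  thus ?thesis by (simp add: irreducible_over_rat_def F_def)
qed

lemma rat_adjoin_root:
  assumes irr: "irreducible_over_rat f" and deg: "degree f = 4" and root: "\<theta> \<in> complex_roots f"
    and z: "z \<in> rat_adjoin {\<theta>}"
  obtains g where "coeffs_in \<rat> g" "degree g \<le> 3" "z = poly g \<theta>"
proof -
  interpret Q: complex_subfield \<rat> by (rule complex_subfield_Rats)
  have f0: "cpoly f \<noteq> 0" using deg by auto
  have r: "poly (cpoly f) \<theta> = 0" using root by (simp add: complex_roots_def)
  have min: "degree (cpoly f) \<le> degree g" if "coeffs_in \<rat> g" "g \<noteq> 0" "poly g \<theta> = 0" for g
    using irreducible_degree_le[OF irr root that] by simp
  have sub: "complex_subfield ((\<lambda>g. poly g \<theta>) ` {g. coeffs_in \<rat> g})"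
    by (rule Q.simple_extension_subfield[OF coeffs_in_cpoly f0 r min])
  have "rat_adjoin {\<theta>} \<subseteq> (\<lambda>g. poly g \<theta>) ` {g. coeffs_in \<rat> g}"
  proof (rule rat_adjoin_subset[OF sub])
    have "\<theta> = poly [:0, 1:] \<theta>" "coeffs_in \<rat> [:0, 1:]" by simp_all
    thus "{\<theta>} \<subseteq> (\<lambda>g. poly g \<theta>) ` {g. coeffs_in \<rat> g}" by blast
  qed
  then obtain g where g: "coeffs_in \<rat> g" "z = poly g \<theta>" using z by blast
  obtain q r' where qr: "coeffs_in \<rat> q" "coeffs_in \<rat> r'" "g = q * cpoly f + r'"
    "r' = 0 \<or> degree r' < degree (cpoly f)"
    using Q.coeffs_in_division[OF g(1) coeffs_in_cpoly f0] by blast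
  have "z = poly r' \<theta>" using g qr(3) r by simp
  moreover have "degree r' \<le> 3" using qr(4) deg by auto
  ultimately show ?thesis using that qr(2) by blast
qed

text \<open>
  If \<open>h\<close> is a monic integer polynomial with root \<open>g(\<theta>)\<close>, then \<open>f\<close> divides the composition of \<open>h\<close>
  and \<open>g\<close>, so \<open>g(\<theta>')\<close> is a root of \<open>h\<close> too.
\<close>
lemma conjugate_algebraic_int:
  assumes irr: "irreducible_over_rat f" and root: "\<theta> \<in> complex_roots f" "\<theta>' \<in> complex_roots f"
    and f0: "f \<noteq> 0" and g: "coeffs_in \<rat> g" and ai: "algebraic_int (poly g \<theta>)"
  shows "algebraic_int (poly g \<theta>')"
proof -
  interpret Q: complex_subfield \<rat> by (rule complex_subfield_Rats)
  obtain h where h: "poly (cpoly h) (poly g \<theta>) = 0" "lead_coeff h = 1"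
    using ai unfolding algebraic_int_altdef_ipoly by blast
  let ?p = "pcompose (cpoly h) g"
  have comp: "coeffs_in \<rat> (pcompose p g)" if "coeffs_in \<rat> p" for p
    using that
  proof (induction p)
    case (pCons a p)
    thus ?case using g by (simp add: pcompose_pCons Q.coeffs_in_add Q.coeffs_in_mult)
  qed simp
  have r: "poly (cpoly f) \<theta> = 0" "poly (cpoly f) \<theta>' = 0" using root by (simp_all add: complex_roots_def)
  have c0: "cpoly f \<noteq> 0" using f0 by simp
  have "\<exists>q. coeffs_in \<rat> q \<and> ?p = q * cpoly f"
  proof (rule Q.minimal_poly_dvd[OF coeffs_in_cpoly c0 r(1)])
    show "degree (cpoly f) \<le> degree g'" if "coeffs_in \<rat> g'" "g' \<noteq> 0" "poly g' \<theta> = 0" for g'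
      using irreducible_degree_le[OF irr root(1) that] by simp
    show "coeffs_in \<rat> ?p" by (rule comp) simp
    show "poly ?p \<theta> = 0" using h(1) by (simp add: poly_pcompose)
  qed
  then obtain q where "?p = q * cpoly f" by blast
  hence "poly ?p \<theta>' = 0" using r(2) by simp
  hence "poly (cpoly h) (poly g \<theta>') = 0" by (simp add: poly_pcompose)
  thus ?thesis using h(2) unfolding algebraic_int_altdef_ipoly by blast
qed

section \<open>A criterion for cyclic Galois groups\<close>

lemma galois_group_eqI:
  assumes s: "\<sigma> \<in> carrier (galois_group f)" and t: "\<tau> \<in> carrier (galois_group f)"
    and eq: "\<And>x. x \<in> complex_roots f \<Longrightarrow> \<sigma> x = \<tau> x"
  shows "\<sigma> = \<tau>"
proof -
  interpret s: embedding "splitting_field f" \<sigma> using galois_group_embedding[OF s] by blast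
  interpret t: embedding "splitting_field f" \<tau> using galois_group_embedding[OF t] by blast
  have "complex_subfield {x \<in> splitting_field f. \<sigma> x = \<tau> x}"
    by standard (auto simp: s.add s.mult s.uminus s.inverse s.hom_add s.hom_mult s.hom_uminus s.hom_inverse
        t.hom_add t.hom_mult t.hom_uminus t.hom_inverse)
  hence "splitting_field f \<subseteq> {x \<in> splitting_field f. \<sigma> x = \<tau> x}"
    using eq subset_rat_adjoin[of "complex_roots f"] unfolding splitting_field_def
    by (intro rat_adjoin_subset) auto
  hence "\<sigma> x = \<tau> x" if "x \<in> splitting_field f" for x using that by auto
  thus ?thesis
    using galois_group_embedding(3)[OF s] galois_group_embedding(3)[OF t] by (intro extensionalityI) auto
qed

text \<open>
  When one root generates the splitting field, embeddings of \<open>\<rat>(x)\<close> are already automorphisms.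
\<close>
lemma exists_automorphism_to_root:
  assumes irr: "irreducible_over_rat f" and f0: "f \<noteq> 0"
    and x: "x \<in> complex_roots f" and gen: "complex_roots f \<subseteq> rat_adjoin {x}" and w: "w \<in> complex_roots f"
  shows "\<exists>\<sigma> \<in> carrier (galois_group f). \<sigma> x = w"
proof -
  interpret Q: embedding \<rat> id by (rule embedding_Rats)
  have c0: "cpoly f \<noteq> 0" using f0 by simp
  have r: "poly (cpoly f) x = 0" using x by (simp add: complex_roots_def)
  have min: "degree (cpoly f) \<le> degree g" if "coeffs_in \<rat> g" "g \<noteq> 0" "poly g x = 0" for g
    using irreducible_degree_le[OF irr x that] by simp
  have wr: "poly (map_poly id (cpoly f)) w = 0" using w by (simp add: complex_roots_def)
  obtain K \<psi> where K: "embedding K \<psi>" "x \<in> K" "\<psi> x = w"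
    by (rule Q.extend[OF coeffs_in_cpoly c0 r min wr]) auto
  have sub: "complex_subfield K" using K(1) by (simp add: embedding_def)
  have "rat_adjoin {x} \<subseteq> K" using rat_adjoin_subset[OF sub] K(2) by simp
  hence "complex_roots f \<subseteq> K" using gen by simp
  hence "splitting_field f \<subseteq> K"
    unfolding splitting_field_def by (rule rat_adjoin_subset[OF sub])
  hence "restrict \<psi> (splitting_field f) \<in> carrier (galois_group f)"
    by (rule galois_groupI[OF K(1) _ f0])
  moreover have "x \<in> splitting_field f"
    using x subset_rat_adjoin[of "complex_roots f"] by (auto simp: splitting_field_def)
  hence "restrict \<psi> (splitting_field f) x = w" using K(3) by simp
  ultimately show ?thesis by blast
qed

text \<open>
  Every automorphism commutes with \<open>\<kappa>\<close>, and \<open>\<kappa>\<close> rotates the roots \<open>x, \<kappa> x, - x, - \<kappa> x\<close>. So an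
  automorphism is determined by the image of \<open>x\<close> and acts as a rotation; numbering the roots along
  \<open>\<kappa>\<close> by \<open>r\<close> turns composition into addition modulo 4.
\<close>
lemma biquadratic_cyclic:
  fixes b d k l :: int and \<kappa> :: "complex \<Rightarrow> complex"
  assumes f: "f = monom 1 4 + monom b 2 + [:d:]" and d: "d \<noteq> 0" and irr: "irreducible_over_rat f"
    and \<kappa>_def: "\<And>x. \<kappa> x = of_int k * x ^ 3 + of_int l * x"
    and root: "\<And>x. x \<in> complex_roots f \<Longrightarrow> \<kappa> x \<in> complex_roots f"
    and neg: "\<And>x. x \<in> complex_roots f \<Longrightarrow> \<kappa> (\<kappa> x) = - x"
  shows "cyclic_poly f"
proof -
  have deg: "degree f = 4" and f0: "f \<noteq> 0" and lc: "lead_coeff f = 1"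
    unfolding f trinomial_pCons by simp_all
  have val: "poly (cpoly f) z = z ^ 4 + of_int b * z ^ 2 + of_int d" for z
    unfolding f trinomial_pCons by (simp add: map_poly_pCons algebra_simps eval_nat_numeral)
  have odd: "\<kappa> (- z) = - \<kappa> z" for z
    by (simp add: \<kappa>_def power3_eq_cube)
  have neg_root: "- z \<in> complex_roots f" if "z \<in> complex_roots f" for z
    using that by (simp add: complex_roots_def val)
  obtain x where x: "x \<in> complex_roots f"
    by (rule exists_complex_root[of f]) (use deg in simp)
  have x0: "x \<noteq> 0" using x d by (auto simp: complex_roots_def val)
  have nx: "- x \<noteq> x" using x0 by (simp add: neg_eq_iff_add_eq_0 mult_2[symmetric])
  define y where "y = \<kappa> x"
  have y: "y \<in> complex_roots f" "\<kappa> x = y" "\<kappa> y = - x" "\<kappa> (- x) = - y" "\<kappa> (- y) = x"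
    using root[OF x] neg[OF x] odd[of x] odd[of y] by (simp_all add: y_def)
  have xy: "x \<noteq> y" using nx y by auto
  have xy': "- x \<noteq> y" using nx y by auto
  have yy: "- y \<noteq> y" using xy y by (metis minus_minus nx)
  define r where "r i = (if i = 0 then x else if i = 1 then y else if i = 2 then - x else - y)" for i :: int
  have I: "{0..<4::int} = {0, 1, 2, 3}" by auto
  have dist: "distinct [x, y, - x, - y]" using xy xy' yy nx by auto
  have inj: "inj_on r {0..<4}"
    unfolding I using dist by (auto simp: inj_on_def r_def)
  have rimg: "r ` {0..<4} = {x, y, - x, - y}" unfolding I by (auto simp: r_def)
  have "card (complex_roots f) \<le> 4"
    using card_poly_roots_bound[of "cpoly f"] f0 deg by (simp add: complex_roots_def)
  moreover have "card {x, y, - x, - y} = 4"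
    using distinct_card[OF dist] by simp
  moreover have "{x, y, - x, - y} \<subseteq> complex_roots f" using x y neg_root by auto
  ultimately have roots: "complex_roots f = {x, y, - x, - y}"
    using card_seteq[OF finite_complex_roots[OF f0], of "{x, y, - x, - y}"] by simp
  let ?G = "galois_group f" and ?L = "splitting_field f"
  interpret A: complex_subfield "rat_adjoin {x}" by (rule complex_subfield_rat_adjoin)
  have xA: "x \<in> rat_adjoin {x}" using subset_rat_adjoin by blast
  have "y \<in> rat_adjoin {x}" unfolding y_def \<kappa>_def using xA by (intro A.closed)
  hence gen: "complex_roots f \<subseteq> rat_adjoin {x}" unfolding roots using xA A.uminus by auto
  have L: "complex_roots f \<subseteq> ?L"
    unfolding splitting_field_def by (rule subset_rat_adjoin)
  have comm: "\<tau> (\<kappa> z) = \<kappa> (\<tau> z)" "\<tau> (- z) = - \<tau> z" if t: "\<tau> \<in> carrier ?G" "z \<in> ?L" for \<tau> z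
  proof -
    interpret t: embedding ?L \<tau> using galois_group_embedding[OF t(1)] by blast
    show "\<tau> (\<kappa> z) = \<kappa> (\<tau> z)"
      unfolding \<kappa>_def using t(2) by (simp add: t.hom_add t.hom_mult t.hom_power t.mult t.power)
    show "\<tau> (- z) = - \<tau> z" using t.hom_uminus t(2) by blast
  qed
  have xL: "x \<in> ?L" "y \<in> ?L" using L roots by auto
  have rot: "\<tau> (r j) = r ((i + j) mod 4)"
    if t: "\<tau> \<in> carrier ?G" "\<tau> x = r i" and ij: "i \<in> {0..<4}" "j \<in> {0..<4}" for \<tau> i j
  proof -
    have "\<tau> y = \<kappa> (\<tau> x)" using comm(1)[OF t(1) xL(1)] y(2) by simp
    moreover have "\<tau> (- x) = - \<tau> x" "\<tau> (- y) = - \<tau> y" using comm(2)[OF t(1)] xL by auto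
    ultimately have t1: "\<tau> x = r i" "\<tau> y = \<kappa> (r i)" "\<tau> (- x) = - r i" "\<tau> (- y) = - \<kappa> (r i)"
      using t(2) by simp_all
    have r1: "\<kappa> (r i) = r ((i + 1) mod 4)" "- r i = r ((i + 2) mod 4)" "- \<kappa> (r i) = r ((i + 3) mod 4)"
      using ij(1) unfolding I by (elim insertE emptyE; simp add: r_def y(2-5))+
    have r0: "r i = r ((i + 0) mod 4)" using ij(1) by simp
    have rv: "r 0 = x" "r 1 = y" "r 2 = - x" "r 3 = - y" by (simp_all add: r_def)
    have t2: "\<tau> (r 0) = r ((i + 0) mod 4)" "\<tau> (r 1) = r ((i + 1) mod 4)"
      "\<tau> (r 2) = r ((i + 2) mod 4)" "\<tau> (r 3) = r ((i + 3) mod 4)"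
      unfolding rv t1 r1[symmetric] r0[symmetric] by (rule refl)+
    have "j = 0 \<or> j = 1 \<or> j = 2 \<or> j = 3" using ij(2) unfolding I by simp
    thus ?thesis by (elim disjE; simp only: t2)
  qed
  have maps: "\<tau> x \<in> complex_roots f" if t: "\<tau> \<in> carrier ?G" for \<tau>
  proof -
    interpret t: embedding ?L \<tau> using galois_group_embedding[OF t] by blast
    show ?thesis using t.complex_roots_image[OF f0 L] x by blast
  qed
  have ev: "bij_betw (\<lambda>\<tau>. \<tau> x) (carrier ?G) (complex_roots f)"
  proof (rule bij_betwI')
    fix \<sigma> \<tau> assume st: "\<sigma> \<in> carrier ?G" "\<tau> \<in> carrier ?G"
    show "(\<sigma> x = \<tau> x) = (\<sigma> = \<tau>)"
    proof
      assume eq: "\<sigma> x = \<tau> x"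
      have "\<sigma> y = \<tau> y" using comm(1)[OF st(1) xL(1)] comm(1)[OF st(2) xL(1)] eq y(2) by simp
      hence "\<sigma> z = \<tau> z" if "z \<in> complex_roots f" for z
        using that eq comm(2)[OF st(1)] comm(2)[OF st(2)] xL unfolding roots by auto
      thus "\<sigma> = \<tau>" by (rule galois_group_eqI[OF st])
    qed simp
  next
    fix w assume "w \<in> complex_roots f"
    thus "\<exists>\<tau>\<in>carrier ?G. w = \<tau> x"
      using exists_automorphism_to_root[OF irr f0 x gen, of w] by auto
  qed (rule maps)
  define h where "h = (\<lambda>\<tau>. inv_into {0..<4} r (\<tau> x))"
  have rbij: "bij_betw r {0..<4} (complex_roots f)"
    using inj rimg roots by (simp add: bij_betw_def)
  have hbij: "bij_betw h (carrier ?G) {0..<4}"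
    using bij_betw_trans[OF ev bij_betw_inv_into[OF rbij]] by (simp add: h_def o_def)
  have rh: "r (h \<tau>) = \<tau> x" if "\<tau> \<in> carrier ?G" for \<tau>
    unfolding h_def using maps[OF that] rbij by (simp add: bij_betw_def f_inv_into_f)
  have h4: "h \<tau> \<in> {0..<4}" if "\<tau> \<in> carrier ?G" for \<tau>
    using hbij that by (auto simp: bij_betw_def)
  have "h \<in> iso ?G (integer_mod_group 4)"
    unfolding iso_def hom_def
  proof (intro CollectI conjI ballI)
    show "h \<in> carrier ?G \<rightarrow> carrier (integer_mod_group 4)"
      using h4 by (auto simp: carrier_integer_mod_group)
    show "bij_betw h (carrier ?G) (carrier (integer_mod_group 4))"
      using hbij by (simp add: carrier_integer_mod_group)
    fix \<sigma> \<tau> assume st: "\<sigma> \<in> carrier ?G" "\<tau> \<in> carrier ?G"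
    have "r (h (\<sigma> \<otimes>\<^bsub>?G\<^esub> \<tau>)) = \<sigma> (\<tau> x)"
      using galois_group_mult[OF st] rh xL(1) by (simp add: compose_eq)
    also have "\<dots> = \<sigma> (r (h \<tau>))" using rh[OF st(2)] by simp
    also have "\<dots> = r ((h \<sigma> + h \<tau>) mod 4)"
      by (rule rot[OF st(1) rh[OF st(1), symmetric] h4[OF st(1)] h4[OF st(2)]])
    finally have "h (\<sigma> \<otimes>\<^bsub>?G\<^esub> \<tau>) = (h \<sigma> + h \<tau>) mod 4"
      using h4[OF galois_group_mult(2)[OF st]] galois_group_mult(1)[OF st]
      by (intro inj_onD[OF inj]) simp_all
    thus "h (\<sigma> \<otimes>\<^bsub>?G\<^esub> \<tau>) = h \<sigma> \<otimes>\<^bsub>integer_mod_group 4\<^esub> h \<tau>" by simp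
  qed
  hence "?G \<cong> integer_mod_group 4" by (auto simp: is_iso_def)
  thus ?thesis using lc irr deg by (simp add: cyclic_poly_def)
qed

section \<open>Rings of integers\<close>

lemma monogenicI:
  assumes lc: "lead_coeff f = 1" and deg: "degree f = 4" and irr: "irreducible_over_rat f"
    and sat: "\<And>\<theta> z. \<theta> \<in> complex_roots f \<Longrightarrow> z \<in> rat_adjoin {\<theta>} \<Longrightarrow> algebraic_int z \<Longrightarrow>
      z \<in> int_module.span {\<theta> ^ i | i. i < (4::nat)}"
  shows "monogenic f"
  unfolding monogenic_def
proof (intro conjI ballI lc irr)
  fix \<theta> assume root: "\<theta> \<in> complex_roots f"
  let ?B = "{1, \<theta>, \<theta> ^ 2, \<theta> ^ 3}"
  have ind: "q0 = 0 \<and> q1 = 0 \<and> q2 = 0 \<and> q3 = 0"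
    if "of_int q0 + of_int q1 * \<theta> + of_int q2 * \<theta> ^ 2 + of_int q3 * \<theta> ^ 3 = 0" for q0 q1 q2 q3 :: int
    using quartic_powers_independent[OF irr deg root _ _ _ _ that] by simp
  have "1 \<noteq> \<theta>" using ind[of 1 "- 1" 0 0] by auto
  moreover have "1 \<noteq> \<theta> ^ 2" using ind[of 1 0 "- 1" 0] by auto
  moreover have "1 \<noteq> \<theta> ^ 3" using ind[of 1 0 0 "- 1"] by auto
  moreover have "\<theta> \<noteq> \<theta> ^ 2" using ind[of 0 1 "- 1" 0] by auto
  moreover have "\<theta> \<noteq> \<theta> ^ 3" using ind[of 0 1 0 "- 1"] by auto
  moreover have "\<theta> ^ 2 \<noteq> \<theta> ^ 3" using ind[of 0 0 1 "- 1"] by auto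
  ultimately have sum: "(\<Sum>v\<in>?B. of_int (u v) * v) =
      of_int (u 1) + of_int (u \<theta>) * \<theta> + of_int (u (\<theta> ^ 2)) * \<theta> ^ 2 + of_int (u (\<theta> ^ 3)) * \<theta> ^ 3" for u
    by (simp add: add.assoc)
  have "\<not> int_module.dependent ?B"
  proof
    assume "int_module.dependent ?B"
    then obtain u where u: "\<exists>v\<in>?B. u v \<noteq> 0" "(\<Sum>v\<in>?B. of_int (u v) * v) = 0"
      using int_module.dependent_finite[of ?B] by auto
    thus False using ind[OF u(2)[unfolded sum]] by auto
  qed
  hence indep: "int_module.independent {\<theta> ^ i | i. i < (4::nat)}" by (simp add: powers_below_4)
  interpret A: complex_subfield "rat_adjoin {\<theta>}" by (rule complex_subfield_rat_adjoin)
  have tA: "\<theta> \<in> rat_adjoin {\<theta>}" using subset_rat_adjoin by blast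
  have ai: "algebraic_int \<theta>" by (rule algebraic_int_complex_root[OF lc root])
  have "int_module.span {\<theta> ^ i | i. i < (4::nat)} \<subseteq> ring_of_integers (rat_adjoin {\<theta>})"
  proof
    fix z assume "z \<in> int_module.span {\<theta> ^ i | i. i < (4::nat)}"
    then obtain n0 n1 n2 n3 where z:
      "z = of_int n0 + of_int n1 * \<theta> + of_int n2 * \<theta> ^ 2 + of_int n3 * \<theta> ^ 3"
      unfolding span_powers_iff by blast
    have "z \<in> rat_adjoin {\<theta>}" unfolding z using tA by (intro A.closed)
    moreover have "algebraic_int z" unfolding z using ai by (intro algebraic_int_intros)
    ultimately show "z \<in> ring_of_integers (rat_adjoin {\<theta>})" by (simp add: ring_of_integers_def)
  qed
  moreover have "ring_of_integers (rat_adjoin {\<theta>}) \<subseteq> int_module.span {\<theta> ^ i | i. i < (4::nat)}"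
    using sat[OF root] by (auto simp: ring_of_integers_def)
  ultimately show "is_int_basis {\<theta> ^ i | i. i < degree f} (ring_of_integers (rat_adjoin {\<theta>}))"
    using indep by (simp add: is_int_basis_def deg)
qed

text \<open>
  For a prime \<open>p\<close> this says that \<open>p\<close> does not divide the index of \<open>\<int>[\<theta>]\<close> in the ring of
  integers of \<open>\<rat>(\<theta>)\<close>.
\<close>
definition saturated_at :: "int \<Rightarrow> complex \<Rightarrow> bool" where
  "saturated_at p \<theta> \<longleftrightarrow> (\<forall>z n0 n1 n2 n3. algebraic_int z \<longrightarrow>
     of_int p * z = of_int n0 + of_int n1 * \<theta> + of_int n2 * \<theta> ^ 2 + of_int n3 * \<theta> ^ 3 \<longrightarrow>
     p dvd n0 \<and> p dvd n1 \<and> p dvd n2 \<and> p dvd n3)"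

lemma saturated_at_span:
  assumes sat: "saturated_at p \<theta>" and p: "p \<noteq> 0" and z: "algebraic_int z"
    and pz: "of_int p * z \<in> int_module.span {\<theta> ^ i | i. i < (4::nat)}"
  shows "z \<in> int_module.span {\<theta> ^ i | i. i < (4::nat)}"
proof -
  obtain n0 n1 n2 n3 where n:
    "of_int p * z = of_int n0 + of_int n1 * \<theta> + of_int n2 * \<theta> ^ 2 + of_int n3 * \<theta> ^ 3"
    using pz unfolding span_powers_iff by blast
  have "p dvd n0 \<and> p dvd n1 \<and> p dvd n2 \<and> p dvd n3"
    using sat z n unfolding saturated_at_def by blast
  then obtain m0 m1 m2 m3 where m: "n0 = p * m0" "n1 = p * m1" "n2 = p * m2" "n3 = p * m3"
    by (elim conjE dvdE)
  have lin: "P * a0 + P * a1 * t + P * a2 * t ^ 2 + P * a3 * t ^ 3 =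
      P * (a0 + a1 * t + a2 * t ^ 2 + a3 * t ^ 3)" for P a0 a1 a2 a3 t :: complex
    by (simp add: algebra_simps)
  have "of_int p * z = of_int p * (of_int m0 + of_int m1 * \<theta> + of_int m2 * \<theta> ^ 2 + of_int m3 * \<theta> ^ 3)"
    using n unfolding m of_int_mult lin .
  hence "z = of_int m0 + of_int m1 * \<theta> + of_int m2 * \<theta> ^ 2 + of_int m3 * \<theta> ^ 3"
    using p by (simp only: mult_cancel_left of_int_eq_0_iff) simp
  thus ?thesis unfolding span_powers_iff by blast
qed

lemma saturated_at_span_power:
  assumes sat: "saturated_at p \<theta>" and p: "p \<noteq> 0" and z: "algebraic_int z"
    and pz: "of_int (p ^ k) * z \<in> int_module.span {\<theta> ^ i | i. i < (4::nat)}"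
  shows "z \<in> int_module.span {\<theta> ^ i | i. i < (4::nat)}"
  using pz
proof (induction k)
  case (Suc k)
  have "algebraic_int (of_int (p ^ k) * z)" using z by (intro algebraic_int_intros)
  moreover have "of_int p * (of_int (p ^ k) * z) \<in> int_module.span {\<theta> ^ i | i. i < (4::nat)}"
    using Suc.prems by (simp add: mult.assoc)
  ultimately show ?case using saturated_at_span[OF sat p] Suc.IH by blast
qed simp

lemma Rats_algebraic_int_obtain:
  fixes z :: complex
  assumes "z \<in> \<rat>" "algebraic_int z"
  obtains n where "z = of_int n"
  using rational_algebraic_int_is_int[OF assms(2,1)] by (elim Ints_cases)

text \<open>
  With \<open>v = \<theta>\<^sup>2\<close> and \<open>w = \<theta>'\<^sup>2\<close>, the traces of \<open>z, \<theta> z, \<theta>\<^sup>2 z, \<theta>\<^sup>3 z\<close> are the algebraic integers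
  \<open>s0, s1, s2, s3\<close> below, computed from \<open>v + w = - b\<close> and \<open>v w = d\<close>. They are linear forms in the
  coordinates \<open>q0, q1, q2, q3\<close>, and solving for the latter by Cramer's rule produces the
  denominator \<open>2 d (b\<^sup>2 - 4 d)\<close>.
\<close>
lemma biquadratic_discriminant_bound:
  fixes b d :: int
  assumes f: "f = monom 1 4 + monom b 2 + [:d:]" and irr: "irreducible_over_rat f"
    and t: "\<theta> \<in> complex_roots f" and t': "\<theta>' \<in> complex_roots f" "\<theta>' ^ 2 = - of_int b - \<theta> ^ 2"
    and z: "z \<in> rat_adjoin {\<theta>}" "algebraic_int z"
  shows "of_int (2 * d * (b ^ 2 - 4 * d)) * z \<in> int_module.span {\<theta> ^ i | i. i < (4::nat)}"
proof -
  have deg: "degree f = 4" and f0: "f \<noteq> 0" and lc: "lead_coeff f = 1"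
    unfolding f trinomial_pCons by simp_all
  have val: "poly (cpoly f) z = z ^ 4 + of_int b * z ^ 2 + of_int d" for z
    unfolding f trinomial_pCons by (simp add: map_poly_pCons algebra_simps eval_nat_numeral)
  define B where "B = (of_int b :: complex)"
  define C where "C = (of_int d :: complex)"
  have BC: "algebraic_int B" "algebraic_int C" "B \<in> \<rat>" "C \<in> \<rat>" by (simp_all add: B_def C_def)
  obtain g where g: "coeffs_in \<rat> g" "degree g \<le> 3" "z = poly g \<theta>"
    by (rule rat_adjoin_root[OF irr deg t z(1)])
  define q0 where "q0 = coeff g 0"
  define q1 where "q1 = coeff g 1"
  define q2 where "q2 = coeff g 2"
  define q3 where "q3 = coeff g 3"
  have qQ: "q0 \<in> \<rat>" "q1 \<in> \<rat>" "q2 \<in> \<rat>" "q3 \<in> \<rat>"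
    using g(1) by (simp_all add: q0_def q1_def q2_def q3_def coeffs_in_def)
  have gx: "poly g x = q0 + q1 * x + q2 * x ^ 2 + q3 * x ^ 3" for x
  proof -
    have "poly g x = (\<Sum>i\<le>3. coeff g i * x ^ i)"
      unfolding poly_altdef using g(2) by (intro sum.mono_neutral_left) (auto simp: coeff_eq_0)
    thus ?thesis by (simp add: q0_def q1_def q2_def q3_def eval_nat_numeral)
  qed
  have nroot: "- x \<in> complex_roots f" if "x \<in> complex_roots f" for x
    using that by (simp add: complex_roots_def val)
  have A: "algebraic_int (poly g x)" if "x \<in> complex_roots f" for x
    using conjugate_algebraic_int[OF irr t that f0 g(1)] z(2) g(3) by simp
  have ai: "algebraic_int x" if "x \<in> complex_roots f" for x
    using algebraic_int_complex_root[OF lc that] .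
  define E where "E x = poly g x + poly g (- x)" for x
  define H where "H x = x * (poly g x - poly g (- x))" for x
  have E: "E x = 2 * q0 + 2 * q2 * x ^ 2" for x
    by (simp add: E_def gx)
  have H: "H x = 2 * q1 * x ^ 2 + 2 * q3 * x ^ 4" for x
    unfolding H_def gx by (simp add: algebra_simps eval_nat_numeral)
  have EH: "algebraic_int (E x)" "algebraic_int (H x)" if "x \<in> complex_roots f" for x
    unfolding E_def H_def using A[OF that] A[OF nroot[OF that]] ai[OF that]
    by (auto intro: algebraic_int_intros)
  define v where "v = \<theta> ^ 2"
  define w where "w = \<theta>' ^ 2"
  have vw: "v + w = - B" using t'(2) by (simp add: v_def w_def B_def)
  have "v ^ 2 + B * v + C = 0" using t by (simp add: complex_roots_def val v_def B_def C_def)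
  hence vC: "v ^ 2 + B * v = - C" by (simp only: eq_neg_iff_add_eq_0)
  have wv: "w = - B - v" using t'(2) by (simp add: v_def w_def B_def)
  have "v * w = - (v ^ 2 + B * v)" unfolding wv by (simp add: algebra_simps power2_eq_square)
  hence vwd: "v * w = C" unfolding vC by simp
  have vwai: "algebraic_int v" "algebraic_int w"
    unfolding v_def w_def using ai[OF t] ai[OF t'(1)] by (simp_all only: algebraic_int_power)
  have S0: "algebraic_int (4 * q0 - 2 * B * q2)"
  proof -
    have "E \<theta> + E \<theta>' = 4 * q0 + 2 * q2 * (v + w)"
      unfolding E v_def w_def by (simp add: algebra_simps)
    hence eq: "E \<theta> + E \<theta>' = 4 * q0 - 2 * B * q2" unfolding vw by simp
    have "algebraic_int (E \<theta> + E \<theta>')"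
      using EH[OF t] EH[OF t'(1)] by (intro algebraic_int_intros)
    thus ?thesis unfolding eq .
  qed
  have S2: "algebraic_int (2 * (B ^ 2 - 2 * C) * q2 - 2 * B * q0)"
  proof -
    have "v * E \<theta> + w * E \<theta>' = 2 * q0 * (v + w) + 2 * q2 * ((v + w) ^ 2 - 2 * (v * w))"
      unfolding E v_def[symmetric] w_def[symmetric] by (simp add: algebra_simps power2_eq_square)
    also have "\<dots> = 2 * (B ^ 2 - 2 * C) * q2 - 2 * B * q0" unfolding vw vwd by simp
    finally have eq: "v * E \<theta> + w * E \<theta>' = 2 * (B ^ 2 - 2 * C) * q2 - 2 * B * q0" .
    have "algebraic_int (v * E \<theta> + w * E \<theta>')"
      using EH[OF t] EH[OF t'(1)] vwai by (intro algebraic_int_intros)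
    thus ?thesis unfolding eq .
  qed
  have S1: "algebraic_int (2 * (B ^ 2 - 2 * C) * q3 - 2 * B * q1)"
  proof -
    have "H \<theta> + H \<theta>' = 2 * q1 * (v + w) + 2 * q3 * ((v + w) ^ 2 - 2 * (v * w))"
      unfolding H v_def w_def by (simp add: algebra_simps eval_nat_numeral)
    also have "\<dots> = 2 * (B ^ 2 - 2 * C) * q3 - 2 * B * q1" unfolding vw vwd by simp
    finally have eq: "H \<theta> + H \<theta>' = 2 * (B ^ 2 - 2 * C) * q3 - 2 * B * q1" .
    have "algebraic_int (H \<theta> + H \<theta>')"
      using EH[OF t] EH[OF t'(1)] by (intro algebraic_int_intros)
    thus ?thesis unfolding eq .
  qed
  have S3: "algebraic_int (2 * (B ^ 2 - 2 * C) * q1 + 2 * (3 * B * C - B ^ 3) * q3)"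
  proof -
    have "v * H \<theta> + w * H \<theta>' = 2 * q1 * ((v + w) ^ 2 - 2 * (v * w))
        + 2 * q3 * ((v + w) ^ 3 - 3 * (v * w) * (v + w))"
      unfolding H v_def w_def by (simp add: algebra_simps eval_nat_numeral)
    also have "\<dots> = 2 * (B ^ 2 - 2 * C) * q1 + 2 * (3 * B * C - B ^ 3) * q3"
      unfolding vw vwd by (simp add: algebra_simps eval_nat_numeral)
    finally have eq: "v * H \<theta> + w * H \<theta>' =
      2 * (B ^ 2 - 2 * C) * q1 + 2 * (3 * B * C - B ^ 3) * q3" .
    have "algebraic_int (v * H \<theta> + w * H \<theta>')"
      using EH[OF t] EH[OF t'(1)] vwai by (intro algebraic_int_intros)
    thus ?thesis unfolding eq .
  qed
  define s0 where "s0 = 4 * q0 - 2 * B * q2"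
  define s1 where "s1 = 2 * (B ^ 2 - 2 * C) * q3 - 2 * B * q1"
  define s2 where "s2 = 2 * (B ^ 2 - 2 * C) * q2 - 2 * B * q0"
  define s3 where "s3 = 2 * (B ^ 2 - 2 * C) * q1 + 2 * (3 * B * C - B ^ 3) * q3"
  have sai: "algebraic_int s0" "algebraic_int s1" "algebraic_int s2" "algebraic_int s3"
    unfolding s0_def s1_def s2_def s3_def by (fact S0 S1 S2 S3)+
  let ?D = "2 * C * (B ^ 2 - 4 * C)"
  note ints = Rats_algebraic_int_obtain
  have Q: "?D * q \<in> \<rat>" if "q \<in> \<rat>" for q using that BC by simp
  have R0: "?D * q0 = C * ((B ^ 2 - 2 * C) * s0 + B * s2)"
    unfolding s0_def s1_def s2_def s3_def by (simp add: algebra_simps eval_nat_numeral)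
  have R2: "?D * q2 = C * (B * s0 + 2 * s2)"
    unfolding s0_def s1_def s2_def s3_def by (simp add: algebra_simps eval_nat_numeral)
  have R1: "?D * q1 = (3 * B * C - B ^ 3) * s1 - (B ^ 2 - 2 * C) * s3"
    unfolding s0_def s1_def s2_def s3_def by (simp add: algebra_simps eval_nat_numeral)
  have R3: "?D * q3 = - ((B ^ 2 - 2 * C) * s1 + B * s3)"
    unfolding s0_def s1_def s2_def s3_def by (simp add: algebra_simps eval_nat_numeral)
  have D0: "algebraic_int (?D * q0)" unfolding R0 using BC sai by (intro algebraic_int_intros)
  obtain n0 where n0: "?D * q0 = of_int n0" by (rule ints[OF Q[OF qQ(1)] D0])
  have D1: "algebraic_int (?D * q1)" unfolding R1 using BC sai by (intro algebraic_int_intros)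
  obtain n1 where n1: "?D * q1 = of_int n1" by (rule ints[OF Q[OF qQ(2)] D1])
  have D2: "algebraic_int (?D * q2)" unfolding R2 using BC sai by (intro algebraic_int_intros)
  obtain n2 where n2: "?D * q2 = of_int n2" by (rule ints[OF Q[OF qQ(3)] D2])
  have D3: "algebraic_int (?D * q3)" unfolding R3 using BC sai by (intro algebraic_int_intros)
  obtain n3 where n3: "?D * q3 = of_int n3" by (rule ints[OF Q[OF qQ(4)] D3])
  have lin: "P * (a0 + a1 * t + a2 * t ^ 2 + a3 * t ^ 3) =
      P * a0 + P * a1 * t + P * a2 * t ^ 2 + P * a3 * t ^ 3" for P a0 a1 a2 a3 t :: complex
    by (simp add: algebra_simps)
  have "of_int (2 * d * (b ^ 2 - 4 * d)) * z = ?D * z" by (simp add: B_def C_def)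
  also have "\<dots> = of_int n0 + of_int n1 * \<theta> + of_int n2 * \<theta> ^ 2 + of_int n3 * \<theta> ^ 3"
    unfolding g(3) gx lin n0 n1 n2 n3 ..
  finally show ?thesis unfolding span_powers_iff by blast
qed

text \<open>
  Write 1 as an integral combination of \<open>n\<close> and \<open>p\<close>.
\<close>
lemma algebraic_int_bezout:
  fixes n p :: int and y :: complex
  assumes "coprime n p" "algebraic_int (of_int n * y)" "algebraic_int (of_int p * y)"
  shows "algebraic_int y"
proof -
  obtain u v where "u * n + v * p = gcd n p" using bezout_int by blast
  hence uv: "u * n + v * p = 1" using assms(1) by simp
  have lin: "(U * N + V * P) * y = U * (N * y) + V * (P * y)" for U N V P :: complex
    by (simp add: algebra_simps)
  have "y = of_int (u * n + v * p) * y" unfolding uv by simp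
  also have "\<dots> = of_int u * (of_int n * y) + of_int v * (of_int p * y)"
    unfolding of_int_add of_int_mult by (rule lin)
  finally have "y = of_int u * (of_int n * y) + of_int v * (of_int p * y)" .
  moreover have "algebraic_int (of_int u * (of_int n * y) + of_int v * (of_int p * y))"
    by (rule algebraic_int_ring(1)[OF algebraic_int_ring(2)[OF algebraic_int_of_int assms(2)]
      algebraic_int_ring(2)[OF algebraic_int_of_int assms(3)]])
  ultimately show ?thesis by simp
qed

lemma algebraic_int_quotient:
  fixes a p :: int
  assumes "p \<noteq> 0" "of_int p * z = of_int a" "algebraic_int (z :: complex)"
  shows "p dvd a"
proof -
  have "z = of_int a / of_int p" using assms(1,2) by (simp add: field_simps)
  hence "z \<in> \<rat>" by simp
  then obtain n where "z = of_int n"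
    using Rats_algebraic_int_obtain[OF _ assms(3)] by blast
  hence "of_int (p * n) = (of_int a :: complex)" using assms(2) by simp
  hence "p * n = a" by (rule of_int_complex_inj)
  thus ?thesis by auto
qed

text \<open>
  Eisenstein's criterion as a statement about the index. Here \<open>\<theta>\<^sup>4 = p \<epsilon>\<close> with an algebraic integer
  \<open>\<epsilon>\<close>. Multiplying an element of \<open>(1 / p) \<int>[\<theta>]\<close> by a suitable power of \<open>\<theta>\<close> isolates its lowest
  coefficient \<open>n\<close> in the form \<open>n \<theta>\<^sup>3 / p\<close>, up to an algebraic integer. If \<open>p\<close> did not divide \<open>n\<close>, then \<open>\<theta>\<^sup>3 / p\<close> would be integral;
  its square shows that \<open>\<theta>\<^sup>2 / p\<close> is integral, and the square of that shows that \<open>1 / p\<close> is, which is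
  absurd.
\<close>
lemma eisenstein_saturated:
  fixes p c :: int
  assumes p: "prime p" and ai: "algebraic_int \<theta>"
    and eq: "\<theta> ^ 4 + of_int (p * c) * \<theta> ^ 2 + of_int p = 0"
  shows "saturated_at p \<theta>"
  unfolding saturated_at_def
proof (intro allI impI)
  fix z n0 n1 n2 n3
  assume z: "algebraic_int z"
    and pz: "of_int p * z = of_int n0 + of_int n1 * \<theta> + of_int n2 * \<theta> ^ 2 + of_int n3 * \<theta> ^ 3"
  define P where "P = (of_int p :: complex)"
  define C where "C = (of_int c :: complex)"
  define \<epsilon> where "\<epsilon> = - (C * \<theta> ^ 2 + 1)"
  have P0: "P \<noteq> 0" using p by (auto simp: P_def)
  have aiC: "algebraic_int C" by (simp add: C_def)
  have aie: "algebraic_int \<epsilon>"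
    unfolding \<epsilon>_def using ai aiC by (intro algebraic_int_intros algebraic_int_one)
  have "\<theta> ^ 4 + P * C * \<theta> ^ 2 + P = 0" using eq by (simp add: P_def C_def)
  moreover have "\<theta> ^ 4 - P * \<epsilon> = \<theta> ^ 4 + P * C * \<theta> ^ 2 + P"
    by (simp add: \<epsilon>_def algebra_simps)
  ultimately have t4: "\<theta> ^ 4 = P * \<epsilon>" by simp
  have key: "p dvd n" if n: "P * y = of_int n * \<theta> ^ 3" "algebraic_int y" for n y
  proof (rule ccontr)
    assume "\<not> p dvd n"
    hence cop: "coprime n p"
      using prime_imp_coprime[OF p] by (simp add: coprime_commute)
    define x3 where "x3 = \<theta> ^ 3 / P"
    have x3: "P * x3 = \<theta> ^ 3" using P0 by (simp add: x3_def)
    have "P * (of_int n * x3) = of_int n * (P * x3)" by simp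
    also have "\<dots> = P * y" unfolding x3 n(1) ..
    finally have "of_int n * x3 = y" using P0 by simp
    hence b1: "algebraic_int (of_int n * x3)" using n(2) by simp
    have "of_int p * x3 = \<theta> ^ 3" using x3 by (simp only: P_def)
    hence b2: "algebraic_int (of_int p * x3)" using algebraic_int_power[OF ai, of 3] by simp
    have "algebraic_int x3" by (rule algebraic_int_bezout[OF cop b1 b2])
    define x2 where "x2 = \<theta> ^ 2 / P"
    have x2: "P * x2 = \<theta> ^ 2" using P0 by (simp add: x2_def)
    have "P ^ 2 * x3 ^ 2 = (P * x3) ^ 2" by (simp add: power_mult_distrib)
    also have "\<dots> = \<theta> ^ 2 * \<theta> ^ 4" unfolding x3 by (simp add: eval_nat_numeral)
    also have "\<dots> = P ^ 2 * (x2 * \<epsilon>)" unfolding t4 x2[symmetric] by (simp add: power2_eq_square)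
    finally have "x3 ^ 2 = x2 * \<epsilon>" using P0 by simp
    moreover have "x2 * \<epsilon> = - (C * \<epsilon>) - x2"
    proof -
      have "P * (x2 * \<epsilon>) = \<theta> ^ 2 * \<epsilon>" unfolding x2[symmetric] by simp
      also have "\<dots> = - (C * \<theta> ^ 4) - \<theta> ^ 2"
        unfolding \<epsilon>_def by (simp add: algebra_simps eval_nat_numeral)
      also have "\<dots> = P * (- (C * \<epsilon>) - x2)"
        unfolding t4 x2[symmetric] by (simp add: algebra_simps)
      finally show ?thesis using P0 by simp
    qed
    ultimately have "x2 = - (C * \<epsilon>) - x3 ^ 2" by simp
    moreover have "algebraic_int (- (C * \<epsilon>) - x3 ^ 2)"
      using aie aiC \<open>algebraic_int x3\<close> by (intro algebraic_int_intros)
    ultimately have ai2: "algebraic_int x2" by simp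
    have "P ^ 2 * x2 ^ 2 = (P * x2) ^ 2" by (simp add: power_mult_distrib)
    also have "\<dots> = P * \<epsilon>" unfolding x2 t4[symmetric] by (simp add: eval_nat_numeral)
    finally have "P * (P * x2 ^ 2) = P * \<epsilon>" by (simp add: power2_eq_square)
    hence "P * x2 ^ 2 = - (C * (P * x2) + 1)" using P0 unfolding \<epsilon>_def x2 by simp
    note Px2 = this
    have "P * (- (x2 ^ 2) - C * x2) = - (P * x2 ^ 2) - C * (P * x2)" by (simp add: algebra_simps)
    also have "\<dots> = 1" unfolding Px2 by simp
    finally have "P * (- (x2 ^ 2) - C * x2) = 1" .
    hence "of_int p * (- (x2 ^ 2) - C * x2) = of_int 1" by (simp add: P_def)
    moreover have "algebraic_int (- (x2 ^ 2) - C * x2)"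
      using aiC ai2 by (intro algebraic_int_intros)
    ultimately have "p dvd 1"
      using algebraic_int_quotient[of p _ 1] p by auto
    thus False using p not_prime_unit by blast
  qed
  have pz0: "P * z = of_int n0 + of_int n1 * \<theta> + of_int n2 * \<theta> ^ 2 + of_int n3 * \<theta> ^ 3"
    using pz by (simp add: P_def)
  define A0 where "A0 = (of_int n0 :: complex)"
  define A1 where "A1 = (of_int n1 :: complex)"
  define A2 where "A2 = (of_int n2 :: complex)"
  define A3 where "A3 = (of_int n3 :: complex)"
  have aiA: "algebraic_int A1" "algebraic_int A2" "algebraic_int A3"
    by (simp_all add: A1_def A2_def A3_def)
  note pz0 = pz0[folded A0_def A1_def A2_def A3_def]
  have "P * (z * \<theta> ^ 3 - \<epsilon> * (A1 + A2 * \<theta> + A3 * \<theta> ^ 2)) =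
      (P * z) * \<theta> ^ 3 - (P * \<epsilon>) * (A1 + A2 * \<theta> + A3 * \<theta> ^ 2)"
    by (simp add: algebra_simps)
  also have "\<dots> = A0 * \<theta> ^ 3"
    unfolding pz0 t4[symmetric] by (simp add: algebra_simps eval_nat_numeral)
  finally have "P * (z * \<theta> ^ 3 - \<epsilon> * (A1 + A2 * \<theta> + A3 * \<theta> ^ 2)) = of_int n0 * \<theta> ^ 3" by (simp only: A0_def)
  moreover have "algebraic_int (z * \<theta> ^ 3 - \<epsilon> * (A1 + A2 * \<theta> + A3 * \<theta> ^ 2))"
    using z ai aie aiA by (intro algebraic_int_intros)
  ultimately have "p dvd n0" by (rule key)
  then obtain m0 where m0: "n0 = p * m0" by (elim dvdE)
  define z1 where "z1 = z - of_int m0"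
  have z1: "algebraic_int z1" unfolding z1_def using z by (intro algebraic_int_intros)
  have "P * z1 = P * z - A0" unfolding z1_def
    by (simp only: A0_def m0 P_def of_int_mult right_diff_distrib mult.assoc)
  hence pz1: "P * z1 = A1 * \<theta> + A2 * \<theta> ^ 2 + A3 * \<theta> ^ 3" unfolding pz0 by simp
  have "P * (z1 * \<theta> ^ 2 - \<epsilon> * (A2 + A3 * \<theta>)) = (P * z1) * \<theta> ^ 2 - (P * \<epsilon>) * (A2 + A3 * \<theta>)"
    by (simp add: algebra_simps)
  also have "\<dots> = A1 * \<theta> ^ 3"
    unfolding pz1 t4[symmetric] by (simp add: algebra_simps eval_nat_numeral)
  finally have "P * (z1 * \<theta> ^ 2 - \<epsilon> * (A2 + A3 * \<theta>)) = of_int n1 * \<theta> ^ 3" by (simp only: A1_def)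
  moreover have "algebraic_int (z1 * \<theta> ^ 2 - \<epsilon> * (A2 + A3 * \<theta>))"
    using z1 ai aie aiA by (intro algebraic_int_intros)
  ultimately have "p dvd n1" by (rule key)
  then obtain m1 where m1: "n1 = p * m1" by (elim dvdE)
  define z2 where "z2 = z1 - of_int m1 * \<theta>"
  have z2: "algebraic_int z2" unfolding z2_def using z1 ai by (intro algebraic_int_intros)
  have "P * z2 = P * z1 - A1 * \<theta>" unfolding z2_def
    by (simp only: A1_def m1 P_def of_int_mult right_diff_distrib mult.assoc)
  hence pz2: "P * z2 = A2 * \<theta> ^ 2 + A3 * \<theta> ^ 3" unfolding pz1 by simp
  have "P * (z2 * \<theta> - \<epsilon> * A3) = (P * z2) * \<theta> - (P * \<epsilon>) * A3"
    by (simp add: algebra_simps)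
  also have "\<dots> = A2 * \<theta> ^ 3"
    unfolding pz2 t4[symmetric] by (simp add: algebra_simps eval_nat_numeral)
  finally have "P * (z2 * \<theta> - \<epsilon> * A3) = of_int n2 * \<theta> ^ 3" by (simp only: A2_def)
  moreover have "algebraic_int (z2 * \<theta> - \<epsilon> * A3)"
    using z2 ai aie aiA by (intro algebraic_int_intros)
  ultimately have "p dvd n2" by (rule key)
  then obtain m2 where m2: "n2 = p * m2" by (elim dvdE)
  define z3 where "z3 = z2 - of_int m2 * \<theta> ^ 2"
  have z3: "algebraic_int z3" unfolding z3_def using z2 ai by (intro algebraic_int_intros)
  have "P * z3 = P * z2 - A2 * \<theta> ^ 2" unfolding z3_def
    by (simp only: A2_def m2 P_def of_int_mult right_diff_distrib mult.assoc)
  hence "P * z3 = of_int n3 * \<theta> ^ 3" unfolding pz2 A3_def by simp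
  hence "p dvd n3" using z3 by (rule key)
  show "p dvd n0 \<and> p dvd n1 \<and> p dvd n2 \<and> p dvd n3"
    using \<open>p dvd n0\<close> \<open>p dvd n1\<close> \<open>p dvd n2\<close> \<open>p dvd n3\<close> by blast
qed

text \<open>
  Modulo 2 the polynomial is the square of \<open>\<eta> = \<theta>\<^sup>2 + \<theta> + 1\<close>, so \<open>\<int>[\<theta>]/2\<close> is a local ring with
  maximal ideal \<open>(\<eta>)\<close> and residue field of four elements. Integrality of \<open>\<eta> / 2\<close> would imply that
  of \<open>\<theta>\<^sup>2 / 2\<close>, hence of \<open>5 / 2\<close> (\<open>no_eta\<close>). A multiple \<open>(c0 + c1 \<theta>) \<eta> / 2\<close> reduces to this
  case by multiplying with the conjugate of \<open>c0 + c1 \<theta>\<close>, whose norm \<open>c0\<^sup>2 - c0 c1 + c1\<^sup>2\<close> is odd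
  unless \<open>c0\<close> and \<open>c1\<close> are even (\<open>key\<close>). A general element is divided by \<open>\<eta>\<close> with remainder.
\<close>
lemma saturated_at_2:
  assumes ai: "algebraic_int \<theta>" and eq: "\<theta> ^ 4 - 5 * \<theta> ^ 2 + 5 = 0"
  shows "saturated_at 2 \<theta>"
proof -
  define \<eta> where "\<eta> = \<theta> ^ 2 + \<theta> + 1"
  define \<mu> where "\<mu> = \<theta> ^ 3 + 4 * \<theta> ^ 2 + \<theta> - 2"
  have "algebraic_int \<eta>"
    unfolding \<eta>_def using ai by (intro algebraic_int_intros algebraic_int_one)
  moreover have "algebraic_int \<mu>"
    unfolding \<mu>_def using ai by (intro algebraic_int_intros)
  ultimately have aie: "algebraic_int \<eta>" "algebraic_int \<mu>" .
  have "\<eta> ^ 2 - 2 * \<mu> = \<theta> ^ 4 - 5 * \<theta> ^ 2 + 5"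
    by (simp add: \<eta>_def \<mu>_def algebra_simps eval_nat_numeral)
  hence eta2: "\<eta> ^ 2 = 2 * \<mu>" using eq by simp
  have no_eta: "\<not> algebraic_int y" if y: "2 * y = \<eta>" for y
  proof
    assume aiy: "algebraic_int y"
    define \<phi> where "\<phi> = y * \<theta> - y ^ 2 + 2 * \<theta> ^ 2 - 1"
    have aip: "algebraic_int \<phi>"
      unfolding \<phi>_def using ai aiy by (intro algebraic_int_intros algebraic_int_one)
    have "2 * (2 * y ^ 2) = (2 * y) ^ 2" by (simp add: power2_eq_square)
    also have "\<dots> = 2 * \<mu>" unfolding y by (rule eta2)
    finally have y2: "2 * y ^ 2 = \<mu>" by simp
    have "2 * \<phi> = (2 * y) * \<theta> - 2 * y ^ 2 + 4 * \<theta> ^ 2 - 2"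
      by (simp add: \<phi>_def algebra_simps)
    also have "\<dots> = \<theta> ^ 2"
      unfolding y y2 by (simp add: \<eta>_def \<mu>_def algebra_simps eval_nat_numeral)
    finally have phi: "\<theta> ^ 2 = 2 * \<phi>" by (rule sym)
    have "\<theta> ^ 4 = (\<theta> ^ 2) ^ 2" by simp
    hence "4 * \<phi> ^ 2 - 10 * \<phi> + 5 = 0" using eq unfolding phi by (simp add: power_mult_distrib)
    moreover have "2 * (5 * \<phi> - 2 * \<phi> ^ 2) = 5 - (4 * \<phi> ^ 2 - 10 * \<phi> + 5)"
      by (simp add: algebra_simps)
    ultimately have "of_int 2 * (5 * \<phi> - 2 * \<phi> ^ 2) = of_int 5" by simp
    moreover have "algebraic_int (5 * \<phi> - 2 * \<phi> ^ 2)"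
      using aip by (intro algebraic_int_intros)
    ultimately have "(2::int) dvd 5"
      by (intro algebraic_int_quotient) auto
    thus False by simp
  qed
  have key: "even c0 \<and> even c1"
    if y: "2 * y = (of_int c0 + of_int c1 * \<theta>) * \<eta>" "algebraic_int y" for c0 c1 y
  proof -
    define N where "N = c0 ^ 2 - c0 * c1 + c1 ^ 2"
    define a where "a = (of_int c0 :: complex)"
    define b where "b = (of_int c1 :: complex)"
    have aiab: "algebraic_int a" "algebraic_int b" by (simp_all add: a_def b_def)
    define e where "e = \<eta> / 2"
    have "2 * (y * (a - b - b * \<theta>) + b ^ 2 * \<mu>) = (2 * y) * (a - b - b * \<theta>) + b ^ 2 * \<eta> ^ 2"
      unfolding eta2 by (simp add: algebra_simps)
    also have "\<dots> = \<eta> * ((a + b * \<theta>) * (a - b - b * \<theta>) + b ^ 2 * \<eta>)"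
      unfolding y(1) a_def[symmetric] b_def[symmetric] by (simp add: algebra_simps power2_eq_square)
    also have "(a + b * \<theta>) * (a - b - b * \<theta>) + b ^ 2 * \<eta> = a ^ 2 - a * b + b ^ 2"
      by (simp add: \<eta>_def algebra_simps power2_eq_square)
    also have "\<eta> * (a ^ 2 - a * b + b ^ 2) = 2 * (of_int N * e)"
      by (simp add: N_def a_def b_def e_def)
    finally have "y * (a - b - b * \<theta>) + b ^ 2 * \<mu> = of_int N * e"
      by (simp only: mult_cancel_left) simp
    moreover have "algebraic_int (y * (a - b - b * \<theta>) + b ^ 2 * \<mu>)"
      using y(2) aiab ai aie by (intro algebraic_int_intros)
    ultimately have 1: "algebraic_int (of_int N * e)" by simp
    have 2: "algebraic_int (of_int 2 * e)" using aie by (simp add: e_def)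
    have "\<not> coprime N 2"
      using algebraic_int_bezout[OF _ 1 2] no_eta[of e] by (auto simp: e_def)
    hence "even N" by simp
    thus ?thesis unfolding N_def by auto
  qed
  show ?thesis
    unfolding saturated_at_def
  proof (intro allI impI)
    fix z n0 n1 n2 n3
    assume z: "algebraic_int z"
      and n: "of_int 2 * z = of_int n0 + of_int n1 * \<theta> + of_int n2 * \<theta> ^ 2 + of_int n3 * \<theta> ^ 3"
    define e0 e1 c0 c1 where ec: "e0 = n0 - n2 + n3" "e1 = n1 - n2" "c0 = n2 - n3" "c1 = n3"
    define C where "C = of_int c0 + of_int c1 * \<theta>"
    define E where "E = of_int e0 + of_int e1 * \<theta>"
    have aiC: "algebraic_int C" unfolding C_def using ai by (intro algebraic_int_intros)
    have div: "m0 + m1 * \<theta> + m2 * \<theta> ^ 2 + m3 * \<theta> ^ 3 =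
        ((m0 - m2 + m3) + (m1 - m2) * \<theta>) + ((m2 - m3) + m3 * \<theta>) * \<eta>" for m0 m1 m2 m3
      by (simp add: \<eta>_def algebra_simps eval_nat_numeral)
    have zEC: "2 * z = E + C * \<eta>"
      using n unfolding E_def C_def ec of_int_add of_int_diff div by simp
    define y1 where "y1 = z * \<eta> - C * \<mu>"
    have "2 * y1 = (2 * z) * \<eta> - C * \<eta> ^ 2"
      unfolding y1_def eta2 by (simp add: algebra_simps)
    also have "\<dots> = E * \<eta>"
      unfolding zEC by (simp add: algebra_simps power2_eq_square)
    finally have "2 * y1 = (of_int e0 + of_int e1 * \<theta>) * \<eta>" unfolding E_def .
    moreover have "algebraic_int y1"
      unfolding y1_def using z aie aiC by (intro algebraic_int_intros)
    ultimately have "even e0 \<and> even e1" by (rule key)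
    then obtain f0 f1 where f: "e0 = 2 * f0" "e1 = 2 * f1" by (auto elim!: evenE)
    define y2 where "y2 = z - (of_int f0 + of_int f1 * \<theta>)"
    have "E = 2 * (of_int f0 + of_int f1 * \<theta>)" unfolding E_def f by (simp add: algebra_simps)
    hence "2 * y2 = C * \<eta>" using zEC unfolding y2_def by (simp add: algebra_simps)
    hence "2 * y2 = (of_int c0 + of_int c1 * \<theta>) * \<eta>" unfolding C_def .
    moreover have "algebraic_int y2"
      unfolding y2_def using z ai by (intro algebraic_int_intros)
    ultimately have "even c0 \<and> even c1" by (rule key)
    thus "2 dvd n0 \<and> 2 dvd n1 \<and> 2 dvd n2 \<and> 2 dvd n3"
      using \<open>even e0 \<and> even e1\<close> unfolding ec by auto
  qed
qed

section \<open>The three exceptional polynomials\<close>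

lemma biquadratic_root_iff:
  "f = monom 1 4 + monom b 2 + [:d:] \<Longrightarrow> x \<in> complex_roots f \<longleftrightarrow> x ^ 4 + of_int b * x ^ 2 + of_int d = 0"
proof -
  assume f: "f = monom 1 4 + monom b 2 + [:d:]"
  have "poly (cpoly f) x = x ^ 4 + of_int b * x ^ 2 + of_int d"
    unfolding f trinomial_pCons by (simp add: map_poly_pCons algebra_simps eval_nat_numeral)
  thus ?thesis by (simp add: complex_roots_def)
qed

lemma biquadratic_cyclic_and_monogenic:
  fixes b d k l :: int and \<kappa> :: "complex \<Rightarrow> complex"
  defines "f \<equiv> monom 1 4 + monom b 2 + [:d:]"
  assumes d: "d \<noteq> 0"
    and sq: "\<And>q :: rat. q ^ 2 \<noteq> of_int d" "\<And>q :: rat. q ^ 2 \<noteq> of_int (b ^ 2 - 4 * d)"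
    and \<kappa>_def: "\<And>x. \<kappa> x = of_int k * x ^ 3 + of_int l * x"
    and kap: "\<And>x. x ^ 4 + of_int b * x ^ 2 + of_int d = 0 \<Longrightarrow> \<kappa> x ^ 2 = - of_int b - x ^ 2"
    and neg: "\<And>x. x ^ 4 + of_int b * x ^ 2 + of_int d = 0 \<Longrightarrow> \<kappa> (\<kappa> x) = - x"
    and sat: "\<And>x z. x ^ 4 + of_int b * x ^ 2 + of_int d = 0 \<Longrightarrow> algebraic_int x \<Longrightarrow> algebraic_int z \<Longrightarrow>
      of_int (2 * d * (b ^ 2 - 4 * d)) * z \<in> int_module.span {x ^ i | i. i < (4::nat)} \<Longrightarrow>
      z \<in> int_module.span {x ^ i | i. i < (4::nat)}"
  shows "monogenic f \<and> cyclic_poly f"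
proof
  have f: "f = monom 1 4 + monom b 2 + [:d:]" by (simp add: f_def)
  have irr: "irreducible_over_rat f" by (rule biquadratic_irreducible[OF f sq])
  have deg: "degree f = 4" and lc: "lead_coeff f = 1"
    unfolding f trinomial_pCons by simp_all
  note iff = biquadratic_root_iff[OF f]
  have root: "\<kappa> x \<in> complex_roots f" if x: "x \<in> complex_roots f" for x
  proof -
    have x0: "x ^ 4 + of_int b * x ^ 2 + of_int d = 0" using x iff by blast
    have gen: "(- u - w) ^ 2 + u * (- u - w) + v = w ^ 2 + u * w + v" for u v w :: complex
      by (simp add: algebra_simps power2_eq_square)
    have p4: "y ^ 4 = (y ^ 2) ^ 2" for y :: complex by simp
    have "\<kappa> x ^ 4 + of_int b * \<kappa> x ^ 2 + of_int d = x ^ 4 + of_int b * x ^ 2 + of_int d"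
      unfolding p4 kap[OF x0] by (rule gen)
    thus ?thesis using x0 iff by simp
  qed
  show "cyclic_poly f"
    by (rule biquadratic_cyclic[OF f d irr \<kappa>_def root]) (use neg iff in auto)
  show "monogenic f"
  proof (rule monogenicI[OF lc deg irr])
    fix \<theta> z assume t: "\<theta> \<in> complex_roots f" and z: "z \<in> rat_adjoin {\<theta>}" "algebraic_int z"
    have t0: "\<theta> ^ 4 + of_int b * \<theta> ^ 2 + of_int d = 0" using t iff by blast
    show "z \<in> int_module.span {\<theta> ^ i | i. i < (4::nat)}"
      by (rule sat[OF t0 algebraic_int_complex_root[OF lc t] z(2)
        biquadratic_discriminant_bound[OF f irr t root[OF t] kap[OF t0] z]])
  qed
qed

text \<open>
  Each of the three polynomials has the 4-cycle \<open>x \<mapsto> \<plusminus>x\<^sup>3 - 3 x\<close> of roots; in every case the square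
  of the image is \<open>- b - x\<^sup>2\<close>, by division with remainder of \<open>(\<plusminus>x\<^sup>3 - 3 x)\<^sup>2\<close> by the polynomial. Here
  the denominator bound \<open>2 d (b\<^sup>2 - 4 d)\<close> is 32.
\<close>
lemma monogenic_cyclic_m4_2: "monogenic (monom 1 4 + monom (- 4) 2 + [:2:]) \<and> cyclic_poly (monom 1 4 + monom (- 4) 2 + [:2:])"
proof (rule biquadratic_cyclic_and_monogenic[where \<kappa> = "\<lambda>x. x ^ 3 - 3 * x" and k = 1 and l = "- 3"])
  fix x :: complex assume "x ^ 4 + of_int (- 4) * x ^ 2 + of_int 2 = 0"
  hence x: "x ^ 4 - 4 * x ^ 2 + 2 = 0" by simp
  define y where "y = x ^ 3 - 3 * x"
  have "y ^ 2 = (x ^ 2 - 2) * (x ^ 4 - 4 * x ^ 2 + 2) + 4 - x ^ 2"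
    by (simp add: y_def algebra_simps eval_nat_numeral)
  hence y2: "y ^ 2 = 4 - x ^ 2" unfolding x by simp
  show "(x ^ 3 - 3 * x) ^ 2 = - of_int (- 4) - x ^ 2"
    using y2 by (simp add: y_def)
  have "y ^ 3 - 3 * y = y * (y ^ 2 - 3)"
    by (simp add: algebra_simps eval_nat_numeral)
  also have "\<dots> = - x - x * (x ^ 4 - 4 * x ^ 2 + 2)"
    unfolding y2 by (simp add: y_def algebra_simps eval_nat_numeral)
  also have "\<dots> = - x" unfolding x by simp
  finally show "(x ^ 3 - 3 * x) ^ 3 - 3 * (x ^ 3 - 3 * x) = - x"
    unfolding y_def .
next
  fix x z :: complex
  assume x: "x ^ 4 + of_int (- 4) * x ^ 2 + of_int 2 = 0" and ai: "algebraic_int x" "algebraic_int z"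
    and span: "of_int (2 * 2 * ((- 4) ^ 2 - 4 * 2)) * z \<in> int_module.span {x ^ i | i. i < (4::nat)}"
  have "saturated_at 2 x"
    by (rule eisenstein_saturated[OF _ ai(1), of 2 "- 2"]) (use x in simp_all)
  moreover have "of_int (2 ^ 5) * z \<in> int_module.span {x ^ i | i. i < (4::nat)}"
    using span by simp
  ultimately show "z \<in> int_module.span {x ^ i | i. i < (4::nat)}"
    using saturated_at_span_power[of 2 x z 5] ai(2) by simp
next
  fix q :: rat
  show "q ^ 2 \<noteq> of_int 2" by (rule not_rat_square) simp
  show "q ^ 2 \<noteq> of_int ((- 4) ^ 2 - 4 * 2)" by (rule not_rat_square) simp
qed simp_all

lemma monogenic_cyclic_4_2: "monogenic (monom 1 4 + monom 4 2 + [:2:]) \<and> cyclic_poly (monom 1 4 + monom 4 2 + [:2:])"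
proof (rule biquadratic_cyclic_and_monogenic[where \<kappa> = "\<lambda>x. - (x ^ 3) - 3 * x" and k = "- 1" and l = "- 3"])
  fix x :: complex assume "x ^ 4 + of_int 4 * x ^ 2 + of_int 2 = 0"
  hence x: "x ^ 4 + 4 * x ^ 2 + 2 = 0" by simp
  define y where "y = - (x ^ 3) - 3 * x"
  have "y ^ 2 = (x ^ 2 + 2) * (x ^ 4 + 4 * x ^ 2 + 2) - 4 - x ^ 2"
    by (simp add: y_def algebra_simps eval_nat_numeral)
  hence y2: "y ^ 2 = - 4 - x ^ 2" unfolding x by simp
  show "(- (x ^ 3) - 3 * x) ^ 2 = - of_int 4 - x ^ 2"
    using y2 unfolding y_def by simp
  have "- (y ^ 3) - 3 * y = - (y * (y ^ 2 + 3))"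
    by (simp add: algebra_simps eval_nat_numeral)
  also have "\<dots> = - x - x * (x ^ 4 + 4 * x ^ 2 + 2)"
    unfolding y2 by (simp add: y_def algebra_simps eval_nat_numeral)
  also have "\<dots> = - x" unfolding x by simp
  finally show "- ((- (x ^ 3) - 3 * x) ^ 3) - 3 * (- (x ^ 3) - 3 * x) = - x"
    unfolding y_def .
next
  fix x z :: complex
  assume x: "x ^ 4 + of_int 4 * x ^ 2 + of_int 2 = 0" and ai: "algebraic_int x" "algebraic_int z"
    and span: "of_int (2 * 2 * (4 ^ 2 - 4 * 2)) * z \<in> int_module.span {x ^ i | i. i < (4::nat)}"
  have "saturated_at 2 x"
    by (rule eisenstein_saturated[OF _ ai(1), of 2 2]) (use x in simp_all)
  moreover have "of_int (2 ^ 5) * z \<in> int_module.span {x ^ i | i. i < (4::nat)}"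
    using span by simp
  ultimately show "z \<in> int_module.span {x ^ i | i. i < (4::nat)}"
    using saturated_at_span_power[of 2 x z 5] ai(2) by simp
next
  fix q :: rat
  show "q ^ 2 \<noteq> of_int 2" by (rule not_rat_square) simp
  show "q ^ 2 \<noteq> of_int (4 ^ 2 - 4 * 2)" by (rule not_rat_square) simp
qed simp_all

text \<open>
  The denominator bound is 50, so both primes 2 and 5 have to be removed.
\<close>
lemma monogenic_cyclic_m5_5: "monogenic (monom 1 4 + monom (- 5) 2 + [:5:]) \<and> cyclic_poly (monom 1 4 + monom (- 5) 2 + [:5:])"
proof (rule biquadratic_cyclic_and_monogenic[where \<kappa> = "\<lambda>x. x ^ 3 - 3 * x" and k = 1 and l = "- 3"])
  fix x :: complex assume "x ^ 4 + of_int (- 5) * x ^ 2 + of_int 5 = 0"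
  hence x: "x ^ 4 - 5 * x ^ 2 + 5 = 0" by simp
  define y where "y = x ^ 3 - 3 * x"
  have "y ^ 2 = (x ^ 2 - 1) * (x ^ 4 - 5 * x ^ 2 + 5) + 5 - x ^ 2"
    by (simp add: y_def algebra_simps eval_nat_numeral)
  hence y2: "y ^ 2 = 5 - x ^ 2" unfolding x by simp
  show "(x ^ 3 - 3 * x) ^ 2 = - of_int (- 5) - x ^ 2"
    using y2 by (simp add: y_def)
  have "y ^ 3 - 3 * y = y * (y ^ 2 - 3)"
    by (simp add: algebra_simps eval_nat_numeral)
  also have "\<dots> = - x - x * (x ^ 4 - 5 * x ^ 2 + 5)"
    unfolding y2 by (simp add: y_def algebra_simps eval_nat_numeral)
  also have "\<dots> = - x" unfolding x by simp
  finally show "(x ^ 3 - 3 * x) ^ 3 - 3 * (x ^ 3 - 3 * x) = - x"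
    unfolding y_def .
next
  fix x z :: complex
  assume x: "x ^ 4 + of_int (- 5) * x ^ 2 + of_int 5 = 0" and ai: "algebraic_int x" "algebraic_int z"
    and span: "of_int (2 * 5 * ((- 5) ^ 2 - 4 * 5)) * z \<in> int_module.span {x ^ i | i. i < (4::nat)}"
  have s5: "saturated_at 5 x"
    by (rule eisenstein_saturated[OF _ ai(1), of 5 "- 1"]) (use x in simp_all)
  have s2: "saturated_at 2 x"
    by (rule saturated_at_2[OF ai(1)]) (use x in simp)
  have "of_int 2 * (of_int (5 ^ 2) * z) \<in> int_module.span {x ^ i | i. i < (4::nat)}"
    using span by simp
  hence "of_int (5 ^ 2) * z \<in> int_module.span {x ^ i | i. i < (4::nat)}"
    by (rule saturated_at_span[OF s2 _ algebraic_int_ring(2)[OF algebraic_int_of_int ai(2)], rotated]) simp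
  thus "z \<in> int_module.span {x ^ i | i. i < (4::nat)}"
    by (rule saturated_at_span_power[OF s5 _ ai(2), rotated]) simp
next
  fix q :: rat
  show "q ^ 2 \<noteq> of_int 5" by (rule not_rat_square) simp
  show "q ^ 2 \<noteq> of_int ((- 5) ^ 2 - 4 * 5)" by (rule not_rat_square) simp
qed simp_all

theorem mainTheorem2:
  fixes f :: "int poly"
  assumes "quartic_trinomial f"
  shows "monogenic f \<and> cyclic_poly f \<longleftrightarrow>
    f \<in> {monom 1 4 - monom 4 2 + [:2:],
         monom 1 4 + monom 4 2 + [:2:],
         monom 1 4 - monom 5 2 + [:5:]}"
proof -
  have neg: "monom 1 4 - monom b 2 + [:d:] = monom 1 4 + monom (- b) 2 + [:d :: int:]" for b d
    by (simp add: minus_monom[symmetric])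
  show ?thesis
    unfolding neg
  proof
    assume mc: "monogenic f \<and> cyclic_poly f"
    consider a d where "a \<noteq> 0" "d \<noteq> 0" "f = monom 1 4 + monom a 3 + [:d:]"
      | b d where "b \<noteq> 0" "d \<noteq> 0" "f = monom 1 4 + monom b 2 + [:d:]"
      | c d where "c \<noteq> 0" "d \<noteq> 0" "f = monom 1 4 + monom c 1 + [:d:]"
      using assms unfolding quartic_trinomial_def by blast
    thus "f \<in> {monom 1 4 + monom (- 4) 2 + [:2:], monom 1 4 + monom 4 2 + [:2:],
        monom 1 4 + monom (- 5) 2 + [:5:]}"
    proof cases
      case 1
      thus ?thesis using cubic_trinomial_not_cyclic_monogenic mc by blast
    next
      case 2
      thus ?thesis using biquadratic_cyclic_monogenic[OF 2(3,1,2)] mc by auto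
    next
      case 3
      thus ?thesis using linear_trinomial_not_cyclic_monogenic mc by blast
    qed
  next
    assume "f \<in> {monom 1 4 + monom (- 4) 2 + [:2:], monom 1 4 + monom 4 2 + [:2:],
        monom 1 4 + monom (- 5) 2 + [:5:]}"
    thus "monogenic f \<and> cyclic_poly f"
      using monogenic_cyclic_m4_2 monogenic_cyclic_4_2 monogenic_cyclic_m5_5 by blast
  qed
qed

end
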